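(* Let $d\ge1$, $s>0$, $0<r\le\infty$, $0<q\le\infty$, $M>0$. (Conventions: $1/\infty=0$; suprema are over probability densities $f$ on $\mathbb{S}^d$ belonging to $B^s_{r,q}(M)$; $x_+=\max(x,0)$.) In each case below there is a constant $c>0$ such that for every $n\ge1$ and every estimator $\hat f$ based on a sample $X_1,\dots,X_n$ of i.i.d. random variables with density $f$, the stated inequality holds. (a) If $1\le p\le2$, $$\sup_{f\in B^s_{r,q}(M)}\mathbb{E}_f\big(\|\hat f-f\|_p^p\big)\ge c\,n^{-\frac{sp}{2s+d}} .$$ (b) If $2<p<\infty$, $$\sup_{f\in B^s_{r,q}(M)}\mathbb{E}_f\big(\|\hat f-f\|_p^p\big)\ge\begin{cases}c\,n^{-\frac{sp}{2s+d}}&\text{if } s>p\,\frac d2\big(\frac1r-\frac1p\big)_+,\\[4pt] c\,n^{-\frac{p(s+d(\frac1p-\frac1r))}{2(s+d(\frac12-\frac1r))}}&\text{if }\frac dr<s\le p\,\frac d2\big(\frac1r-\frac1p\big);\end{cases}$$ and, for $p=\infty$, if $s>\frac dr$, $$\sup_{f\in B^s_{r,q}(M)}\mathbb{E}_f\big(\|\hat f-f\|_\infty\big)\ge c\,n^{-\frac{s-\frac dr}{2(s+d(\frac12-\frac1r))}} .$$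
   Context: $\mathbb{S}^d\subset\mathbb{R}^{d+1}$ is the unit sphere, $dx$ its rotation-invariant surface measure, and $\|\cdot\|_p$ the norm of $L^p(\mathbb{S}^d,dx)$. $\mathbb{E}_f$ is expectation when $X_1,\dots,X_n$ are i.i.d. with common density $f$ with respect to $dx$. An estimator $\hat f$ is any measurable function of $X_1,\dots,X_n$ with values in functions on $\mathbb{S}^d$. Needlets. For $l\ge0$, $L_l$ is the (Gegenbauer) polynomial on $[-1,1]$ such that $(x,y)\mapsto L_l(\langle x,y\rangle)$ is the kernel of the orthogonal projection of $L^2(dx)$ onto the space $\mathscr{H}_l$ of spherical harmonics of degree $l$. Let $\phi$ be a $C^\infty$ even function on $\mathbb{R}$, decreasing on $\mathbb{R}^+$, supported in $|\xi|\le1$, with $0\le\phi\le1$ and $\phi(\xi)=1$ for $|\xi|\le\frac12$; put $b(\xi)=(\phi(\xi/2)-\phi(\xi))^{1/2}\ge0$. Let $M_j(x,y)=\sum_{l\ge0}b(l/2^j)L_l(\langle x,y\rangle)$. For every $j\ge0$ fix a finite set $\mathscr{Z}_j\subset\mathbb{S}^d$ of cubature points with weights $\lambda_\eta>0$, $\eta\in\mathscr{Z}_j$, such that $\int_{\mathbb{S}^d}P\,dx=\sum_{\eta\in\mathscr{Z}_j}\lambda_\eta P(\eta)$ for every restriction $P$ to $\mathbb{S}^d$ of a polynomial of degree $\le 2^{j+2}$, and such that for some $c>0$ independent of $j$: $c^{-1}2^{dj}\le\#\mathscr{Z}_j\le c2^{dj}$ and $c^{-1}2^{-dj}\le\lambda_\eta\le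 c2^{-dj}$. The needlets are $\psi_{j,\eta}(x)=\sqrt{\lambda_\eta}\,M_j(x,\eta)$, $j\ge0$, $\eta\in\mathscr{Z}_j$. The following recalled properties of needlets are taken as given: for each $k$ there is $c_k$ with $|\psi_{j,\eta}(x)|\le c_k2^{jd/2}(1+2^{j}\,\mathrm{dist}(\eta,x))^{-k}$ for all $x\in\mathbb{S}^d$ (dist is geodesic distance), and for $1\le p\le\infty$ there are $c_p,C_p>0$ with $c_p2^{jd(\frac12-\frac1p)}\le\|\psi_{j,\eta}\|_p\le C_p2^{jd(\frac12-\frac1p)}$. Besov balls. For integrable $f$ put $\beta_{j\eta}=\int_{\mathbb{S}^d}f\,\psi_{j,\eta}\,dx$ and $$\|f\|_{B^s_{r,q}}=\Big\|\Big(2^{j[s+d(\frac12-\frac1r)]}\big\|(\beta_{j\eta})_{\eta\in\mathscr{Z}_j}\big\|_{\ell_r}\Big)_{j\ge0}\Big\|_{\ell_q}.$$ $B^s_{r,q}(M)$ is the set of $f$ with $\|f\|_{B^s_{r,q}}\le M$. *)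

theory Defs
  imports "HOL-Probability.Probability" "HOL-Computational_Algebra.Polynomial"
begin

text \<open>
  The sphere of dimension \<open>d\<close> is \<open>sphere (0::'a) 1\<close> in a Euclidean space \<open>'a\<close> with
  \<open>DIM('a) = d + 1\<close>.  Functions on the sphere are represented by functions on all of \<open>'a\<close>
  whose values off the sphere are never used.
\<close>

section \<open>Surface measure\<close>

text \<open>
  The surface measure is the cone measure: the area of \<open>A\<close> is the dimension of the ambient space
  times the volume of the solid cone over \<open>A\<close> with apex \<open>0\<close> (integration in polar coordinates).
  Note that \<open>sgn x = x /\<^sub>R norm x\<close>.
\<close>

definition sphere_measure :: "'a::euclidean_space measure" where
  "sphere_measure = scale_measure (of_nat DIM('a))
     (distr (restrict_space lborel (ball 0 1 - {0})) (restrict_space borel (sphere 0 1)) sgn)"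

lemma space_sphere_measure [simp]: "space (sphere_measure :: 'a::euclidean_space measure) = sphere 0 1"
  by (simp add: sphere_measure_def space_scale_measure space_restrict_space)

lemma sets_sphere_measure [simp, measurable_cong]:
  "sets (sphere_measure :: 'a::euclidean_space measure) = sets (restrict_space borel (sphere 0 1))"
  by (simp add: sphere_measure_def)

lemma measurable_sgn_ball:
  "(sgn :: 'a::euclidean_space \<Rightarrow> 'a) \<in>
     restrict_space lborel (ball 0 1 - {0}) \<rightarrow>\<^sub>M restrict_space borel (sphere 0 1)"
proof (rule measurable_restrict_space2)
  show "(sgn :: 'a \<Rightarrow> 'a) \<in> space (restrict_space lborel (ball 0 1 - {0})) \<rightarrow> sphere 0 1"
    by (auto simp: space_restrict_space norm_sgn simp del: sgn_div_norm)
  have "(sgn :: 'a \<Rightarrow> 'a) \<in> borel_measurable borel"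
    by (simp add: sgn_div_norm[abs_def])
  then show "(sgn :: 'a \<Rightarrow> 'a) \<in> borel_measurable (restrict_space lborel (ball 0 1 - {0}))"
    by (intro measurable_restrict_space1) simp
qed

lemma emeasure_sphere_measure:
  fixes A :: "'a::euclidean_space set"
  assumes "A \<in> sets sphere_measure"
  shows "emeasure sphere_measure A
       = of_nat DIM('a) * emeasure lborel {x \<in> ball 0 1 - {0}. sgn x \<in> A}"
proof -
  have A: "A \<in> sets (restrict_space borel (sphere 0 1))"
    using assms by simp
  have "{x \<in> ball 0 1 - {0}. sgn x \<in> A} = sgn -` A \<inter> (ball 0 1 - {0})"
    by auto
  then show ?thesis
    unfolding sphere_measure_def
    by (simp add: emeasure_distr[OF measurable_sgn_ball A] space_restrict_space
        emeasure_restrict_space)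
qed

lemma emeasure_sphere_measure_space:
  "emeasure sphere_measure (sphere (0::'a::euclidean_space) 1)
     = ennreal (real DIM('a) * unit_ball_vol (real DIM('a)))"
proof -
  have top: "sphere (0::'a) 1 \<in> sets sphere_measure"
    using sets.top[of "sphere_measure :: 'a measure"] by simp
  have eq: "{x \<in> ball 0 1 - {0}. sgn x \<in> sphere (0::'a) 1} = ball 0 1 - {0}"
    by (auto simp: norm_sgn)
  have "emeasure lborel (ball (0::'a) 1 - {0}) = emeasure lborel (ball (0::'a) 1)"
    by (subst emeasure_Diff) auto
  then show ?thesis
    unfolding emeasure_sphere_measure[OF top] eq
    by (simp add: emeasure_ball ennreal_mult ennreal_of_nat_eq_real_of_nat)
qed


section \<open>Norms\<close>

text \<open>Exponents in \<open>(0, \<infinity>]\<close> are of type \<^typ>\<open>ennreal\<close>; in particular \<open>recip \<infinity> = 0\<close>.\<close>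

definition recip :: "ennreal \<Rightarrow> real" where
  "recip r = enn2real (inverse r)"

text \<open>Powers of extended nonnegative reals, meant for exponents \<open>a > 0\<close> only.\<close>

definition enn_powr :: "ennreal \<Rightarrow> real \<Rightarrow> ennreal" where
  "enn_powr x a = (if x = \<infinity> then \<infinity> else ennreal (enn2real x powr a))"

text \<open>
  The \<open>L\<^sup>p\<close> (quasi-)norm for \<open>0 < p \<le> \<infinity>\<close>, as a possibly infinite quantity.  The argument is the
  absolute value of the function.  Counting measures yield the sequence norms.
\<close>

definition eLp_norm :: "'b measure \<Rightarrow> ennreal \<Rightarrow> ('b \<Rightarrow> ennreal) \<Rightarrow> ennreal" where
  "eLp_norm N p g = (if p = \<infinity> then esssup N g
     else enn_powr (\<integral>\<^sup>+ x. enn_powr (g x) (enn2real p) \<partial>N) (1 / enn2real p))"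

definition sphere_norm :: "ennreal \<Rightarrow> ('a::euclidean_space \<Rightarrow> real) \<Rightarrow> ennreal" where
  "sphere_norm p f = eLp_norm sphere_measure p (\<lambda>x. ennreal \<bar>f x\<bar>)"

definition seq_norm :: "ennreal \<Rightarrow> 'i set \<Rightarrow> ('i \<Rightarrow> ennreal) \<Rightarrow> ennreal" where
  "seq_norm p I a = eLp_norm (count_space I) p a"


section \<open>Polynomials and spherical harmonics\<close>

definition homogeneous_poly :: "nat \<Rightarrow> ('a::euclidean_space \<Rightarrow> real) \<Rightarrow> bool" where
  "homogeneous_poly l p \<longleftrightarrow>
     real_polynomial_function p \<and> (\<forall>t x. p (t *\<^sub>R x) = t ^ l * p x)"

definition poly_degree_le :: "nat \<Rightarrow> ('a::euclidean_space \<Rightarrow> real) \<Rightarrow> bool" where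
  "poly_degree_le N p \<longleftrightarrow>
     (\<exists>h. (\<forall>k\<le>N. homogeneous_poly k (h k)) \<and> p = (\<lambda>x. \<Sum>k\<le>N. h k x))"

definition laplacian :: "('a::euclidean_space \<Rightarrow> real) \<Rightarrow> 'a \<Rightarrow> real" where
  "laplacian p x = (\<Sum>b\<in>Basis. (deriv ^^ 2) (\<lambda>t. p (x + t *\<^sub>R b)) 0)"

definition spherical_harmonic :: "nat \<Rightarrow> ('a::euclidean_space \<Rightarrow> real) \<Rightarrow> bool" where
  "spherical_harmonic l h \<longleftrightarrow>
     (\<exists>p. homogeneous_poly l p \<and> (\<forall>x. laplacian p x = 0) \<and> (\<forall>x\<in>sphere 0 1. h x = p x))"

definition sphere_L2 :: "('a::euclidean_space \<Rightarrow> real) set" where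
  "sphere_L2 = {f \<in> borel_measurable sphere_measure. integrable sphere_measure (\<lambda>x. (f x)\<^sup>2)}"

definition zonal_operator :: "'a itself \<Rightarrow> real poly \<Rightarrow> ('a::euclidean_space \<Rightarrow> real) \<Rightarrow> 'a \<Rightarrow> real" where
  "zonal_operator _ P f x = (\<integral>y. poly P (x \<bullet> y) * f y \<partial>sphere_measure)"

text \<open>
  \<open>(x, y) \<mapsto> P (x \<bullet> y)\<close> is the kernel of the orthogonal projection of \<open>L\<^sup>2\<close> of the sphere onto the
  spherical harmonics of degree \<open>l\<close>.  For \<open>DIM('a) \<ge> 2\<close> this determines \<open>P\<close> uniquely, since the
  inner products \<open>x \<bullet> y\<close> then fill the interval from \<open>-1\<close> to \<open>1\<close>.
\<close>

definition harmonic_projection_kernel :: "'a::euclidean_space itself \<Rightarrow> nat \<Rightarrow> real poly \<Rightarrow> bool" where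
  "harmonic_projection_kernel T l P \<longleftrightarrow>
     (\<forall>f\<in>sphere_L2. spherical_harmonic l (zonal_operator T P f) \<and>
        (\<forall>h. spherical_harmonic l h \<longrightarrow>
           (\<integral>x. (f x - zonal_operator T P f x) * h x \<partial>sphere_measure) = 0))"


section \<open>Needlets\<close>

definition needlet_cutoff :: "(real \<Rightarrow> real) \<Rightarrow> bool" where
  "needlet_cutoff \<phi> \<longleftrightarrow>
     (\<forall>k x. (deriv ^^ k) \<phi> differentiable at x) \<and>
     (\<forall>\<xi>. \<phi> (- \<xi>) = \<phi> \<xi>) \<and>
     antimono_on {0..} \<phi> \<and>
     (\<forall>\<xi>. \<bar>\<xi>\<bar> > 1 \<longrightarrow> \<phi> \<xi> = 0) \<and>
     (\<forall>\<xi>. 0 \<le> \<phi> \<xi> \<and> \<phi> \<xi> \<le> 1) \<and>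
     (\<forall>\<xi>. \<bar>\<xi>\<bar> \<le> 1/2 \<longrightarrow> \<phi> \<xi> = 1)"

definition needlet_window :: "(real \<Rightarrow> real) \<Rightarrow> real \<Rightarrow> real" where
  "needlet_window \<phi> \<xi> = sqrt (\<phi> (\<xi> / 2) - \<phi> \<xi>)"

definition needlet_kernel ::
    "(real \<Rightarrow> real) \<Rightarrow> (nat \<Rightarrow> real poly) \<Rightarrow> nat \<Rightarrow> 'a::euclidean_space \<Rightarrow> 'a \<Rightarrow> real" where
  "needlet_kernel \<phi> L j x y = (\<Sum>l. needlet_window \<phi> (real l / 2 ^ j) * poly (L l) (x \<bullet> y))"

text \<open>The cubature weight of the point \<open>\<eta>\<close> at level \<open>j\<close> is \<open>w j \<eta>\<close>.\<close>

definition needlet_cubature ::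
    "nat \<Rightarrow> (nat \<Rightarrow> 'a::euclidean_space set) \<Rightarrow> (nat \<Rightarrow> 'a \<Rightarrow> real) \<Rightarrow> bool" where
  "needlet_cubature d Z w \<longleftrightarrow>
     (\<forall>j. finite (Z j) \<and> Z j \<subseteq> sphere 0 1 \<and> (\<forall>\<eta>\<in>Z j. w j \<eta> > 0)) \<and>
     (\<forall>j P. poly_degree_le (2 ^ (j + 2)) P \<longrightarrow>
        (\<integral>x. P x \<partial>sphere_measure) = (\<Sum>\<eta>\<in>Z j. w j \<eta> * P \<eta>)) \<and>
     (\<exists>c>0. \<forall>j.
        inverse c * 2 ^ (d * j) \<le> real (card (Z j)) \<and> real (card (Z j)) \<le> c * 2 ^ (d * j) \<and>
        (\<forall>\<eta>\<in>Z j. inverse c / 2 ^ (d * j) \<le> w j \<eta> \<and> w j \<eta> \<le> c / 2 ^ (d * j)))"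

definition needlet ::
    "(real \<Rightarrow> real) \<Rightarrow> (nat \<Rightarrow> real poly) \<Rightarrow> (nat \<Rightarrow> 'a::euclidean_space \<Rightarrow> real) \<Rightarrow> nat \<Rightarrow> 'a \<Rightarrow> 'a \<Rightarrow> real"
  where
  "needlet \<phi> L w j \<eta> x = sqrt (w j \<eta>) * needlet_kernel \<phi> L j x \<eta>"

definition geodesic_dist :: "'a::euclidean_space \<Rightarrow> 'a \<Rightarrow> real" where
  "geodesic_dist x y = arccos (x \<bullet> y)"

definition needlets_localized ::
    "nat \<Rightarrow> (nat \<Rightarrow> 'a::euclidean_space set) \<Rightarrow> (nat \<Rightarrow> 'a \<Rightarrow> 'a \<Rightarrow> real) \<Rightarrow> bool" where
  "needlets_localized d Z \<psi> \<longleftrightarrow>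
     (\<forall>k::nat. \<exists>c. \<forall>j. \<forall>\<eta>\<in>Z j. \<forall>x\<in>sphere 0 1.
        \<bar>\<psi> j \<eta> x\<bar> \<le> c * 2 powr (real j * real d / 2) / (1 + 2 ^ j * geodesic_dist \<eta> x) ^ k)"

definition needlets_norm_bounds ::
    "nat \<Rightarrow> (nat \<Rightarrow> 'a::euclidean_space set) \<Rightarrow> (nat \<Rightarrow> 'a \<Rightarrow> 'a \<Rightarrow> real) \<Rightarrow> bool" where
  "needlets_norm_bounds d Z \<psi> \<longleftrightarrow>
     (\<forall>p::ennreal. p \<ge> 1 \<longrightarrow> (\<exists>c>0. \<exists>C>0. \<forall>j. \<forall>\<eta>\<in>Z j.
        ennreal (c * 2 powr (real j * real d * (1/2 - recip p))) \<le> sphere_norm p (\<psi> j \<eta>) \<and>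
        sphere_norm p (\<psi> j \<eta>) \<le> ennreal (C * 2 powr (real j * real d * (1/2 - recip p)))))"


section \<open>Besov balls\<close>

definition needlet_coeff :: "(nat \<Rightarrow> 'a \<Rightarrow> 'a \<Rightarrow> real) \<Rightarrow> ('a::euclidean_space \<Rightarrow> real) \<Rightarrow> nat \<Rightarrow> 'a \<Rightarrow> real"
  where
  "needlet_coeff \<psi> f j \<eta> = (\<integral>x. f x * \<psi> j \<eta> x \<partial>sphere_measure)"

definition besov_norm ::
    "nat \<Rightarrow> (nat \<Rightarrow> 'a::euclidean_space set) \<Rightarrow> (nat \<Rightarrow> 'a \<Rightarrow> 'a \<Rightarrow> real) \<Rightarrow>
     real \<Rightarrow> ennreal \<Rightarrow> ennreal \<Rightarrow> ('a \<Rightarrow> real) \<Rightarrow> ennreal" where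
  "besov_norm d Z \<psi> s r q f =
     seq_norm q UNIV (\<lambda>j. ennreal (2 powr (real j * (s + real d * (1/2 - recip r)))) *
                          seq_norm r (Z j) (\<lambda>\<eta>. ennreal \<bar>needlet_coeff \<psi> f j \<eta>\<bar>))"

definition besov_ball ::
    "nat \<Rightarrow> (nat \<Rightarrow> 'a::euclidean_space set) \<Rightarrow> (nat \<Rightarrow> 'a \<Rightarrow> 'a \<Rightarrow> real) \<Rightarrow>
     real \<Rightarrow> ennreal \<Rightarrow> ennreal \<Rightarrow> real \<Rightarrow> ('a \<Rightarrow> real) set" where
  "besov_ball d Z \<psi> s r q M =
     {f. integrable sphere_measure f \<and> besov_norm d Z \<psi> s r q f \<le> ennreal M}"


section \<open>Statistical model\<close>

definition sphere_densities :: "('a::euclidean_space \<Rightarrow> real) set" where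
  "sphere_densities = {f \<in> borel_measurable sphere_measure.
     (\<forall>x\<in>sphere 0 1. 0 \<le> f x) \<and> (\<integral>\<^sup>+ x. ennreal (f x) \<partial>sphere_measure) = 1}"

text \<open>A sample of size \<open>n\<close> is indexed by \<open>{..<n}\<close>; its law is the product of its marginals.\<close>

definition sample_expectation ::
    "nat \<Rightarrow> ('a::euclidean_space \<Rightarrow> real) \<Rightarrow> ((nat \<Rightarrow> 'a) \<Rightarrow> ennreal) \<Rightarrow> ennreal" where
  "sample_expectation n f g =
     (\<integral>\<^sup>+ X. g X \<partial>(\<Pi>\<^sub>M i\<in>{..<n}. density sphere_measure (\<lambda>x. ennreal (f x))))"

text \<open>
  Estimators are jointly measurable in the sample and the point of the sphere, so that all losses
  below are measurable functions of the sample.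
\<close>

definition estimator :: "nat \<Rightarrow> ((nat \<Rightarrow> 'a::euclidean_space) \<Rightarrow> 'a \<Rightarrow> real) \<Rightarrow> bool" where
  "estimator n fhat \<longleftrightarrow>
     (\<lambda>(X, x). fhat X x) \<in>
       borel_measurable ((\<Pi>\<^sub>M i\<in>{..<n}. sphere_measure) \<Otimes>\<^sub>M sphere_measure)"

end

theory Submission
  imports Defs
begin

text \<open>
  The lower bounds come from families of densities that no estimator can tell apart.  Their
  members are \<open>1 / |S| + \<gamma> \<Sum>\<^bsub>\<eta>\<in>E\<^esub> \<psi>\<^bsub>j\<eta>\<^esub>\<close>, where \<open>E\<close> ranges over the subsets of a set \<open>A\<close> of
  cubature points of one level \<open>j\<close>.  A needlet of level \<open>j\<close> is a bump of height \<open>2\<^bsup>jd/2\<^esup>\<close> and mean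
  square of order \<open>1\<close>, concentrated on a peak set of measure of order \<open>2\<^bsup>-jd\<^esup>\<close> (\<open>peak_measure_bound\<close>).
  Moving one point in or out of \<open>E\<close> changes the law of the sample by a bounded amount as long as
  \<open>n \<gamma>\<^sup>2\<close> is bounded (\<open>two_point_bound\<close>), but moves the density by \<open>\<gamma> 2\<^bsup>jd/2\<^esup>\<close> on the peak set.  The
  peak sets of one level overlap boundedly often (\<open>peak_overlap\<close>), so the losses on them add up, and
  averaging over all \<open>E\<close> (\<open>hypercube_average\<close>) yields a density with loss of order
  \<open>#A 2\<^bsup>-jd\<^esup> (\<gamma> 2\<^bsup>jd/2\<^esup>)\<^sup>p\<close>.

  Two choices of \<open>A\<close> give the two rates.  With all cubature points of the level, the Besov norm of
  the perturbation is of order \<open>\<gamma> 2\<^bsup>j(s+d/2)\<^esup>\<close> (\<open>besov_norm_dense\<close>); with a single point it is only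
  \<open>\<gamma> 2\<^bsup>j(s+d/2-d/r)\<^esup>\<close> (\<open>besov_norm_sparse\<close>).  In both cases \<open>\<gamma>\<close> is the largest size that keeps the
  densities in the Besov ball, and \<open>j\<close> is chosen so that \<open>n \<gamma>\<^sup>2\<close> is of order \<open>1\<close>
  (\<open>minimax_local_bound\<close>).  For the supremum norm the average loss over one peak set is used.

  The Besov norms can be computed because needlet coefficients of a needlet vanish unless the levels
  differ by at most one: the windows are otherwise disjoint, and spherical harmonics of different
  degrees are orthogonal (\<open>integral_spherical_harmonics_eq_0\<close>, from Green's identity in the ball).  At
  neighbouring levels the coefficients decay with the distance of the centres.  Summing such decay
  over the cubature points requires that these do not accumulate.  This is extracted from the
  cubature formula, applied to the square of the kernel \<open>x \<mapsto> M\<^sub>j(x, y)\<close>: it gives the bounded overlap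
  of the peak sets and then, by averaging over them, \<open>decay_sum_bound\<close>.  That the square of the kernel
  is a polynomial of sufficiently low degree is \<open>zonal_eq_projection\<close>.
\<close>

section \<open>Green's identity for harmonic polynomials in the ball\<close>

text \<open>
  All partial derivatives of polynomials are handled through one total derivative whose
  components \<open>P b\<close> are again polynomials, so that differentiation can be iterated.
\<close>
lemma real_polynomial_function_gradient:
  fixes p :: "'a::euclidean_space \<Rightarrow> real"
  assumes "real_polynomial_function p"
  shows "\<exists>P. (\<forall>b. real_polynomial_function (P b)) \<and>
    (\<forall>x. (p has_derivative (\<lambda>v. \<Sum>b\<in>Basis. (v \<bullet> b) * P b x)) (at x))"
  using assms
proof (induction rule: real_polynomial_function.induct)
  case (linear f)
  have "f v = (\<Sum>b\<in>Basis. (v \<bullet> b) * f b)" for v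
  proof -
    interpret bounded_linear f by fact
    have "f v = f (\<Sum>b\<in>Basis. (v \<bullet> b) *\<^sub>R b)" by (simp add: euclidean_representation)
    also have "\<dots> = (\<Sum>b\<in>Basis. (v \<bullet> b) * f b)" by (simp add: sum scaleR)
    finally show ?thesis .
  qed
  then have "f = (\<lambda>v. \<Sum>b\<in>Basis. (v \<bullet> b) * f b)" by blast
  with bounded_linear_imp_has_derivative[OF linear]
  have "(f has_derivative (\<lambda>v. \<Sum>b\<in>Basis. (v \<bullet> b) * f b)) (at x)" for x by metis
  then show ?case by (intro exI[of _ "\<lambda>b x. f b"]) auto
next
  case (const c)
  show ?case by (intro exI[of _ "\<lambda>b x. 0"]) auto
next
  case (add f g)
  then obtain P Q where P: "\<And>b. real_polynomial_function (P b)"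
     "\<And>x. (f has_derivative (\<lambda>v. \<Sum>b\<in>Basis. (v \<bullet> b) * P b x)) (at x)"
    and Q: "\<And>b. real_polynomial_function (Q b)"
     "\<And>x. (g has_derivative (\<lambda>v. \<Sum>b\<in>Basis. (v \<bullet> b) * Q b x)) (at x)" by blast
  show ?case
    using P(1) Q(1) has_derivative_add[OF P(2) Q(2)]
    by (intro exI[of _ "\<lambda>b x. P b x + Q b x"]) (auto simp: algebra_simps sum.distrib)
next
  case (mult f g)
  then obtain P Q where P: "\<And>b. real_polynomial_function (P b)"
     "\<And>x. (f has_derivative (\<lambda>v. \<Sum>b\<in>Basis. (v \<bullet> b) * P b x)) (at x)"
    and Q: "\<And>b. real_polynomial_function (Q b)"
     "\<And>x. (g has_derivative (\<lambda>v. \<Sum>b\<in>Basis. (v \<bullet> b) * Q b x)) (at x)" by blast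
  have "((\<lambda>x. f x * g x) has_derivative
      (\<lambda>v. \<Sum>b\<in>Basis. (v \<bullet> b) * (f x * Q b x + P b x * g x))) (at x)" for x
    using has_derivative_mult[OF P(2) Q(2), of x]
    by (simp add: algebra_simps sum.distrib sum_distrib_left)
  then show ?case
    using P(1) Q(1) mult.hyps
    by (intro exI[of _ "\<lambda>b x. f x * Q b x + P b x * g x"])
      (simp add: real_polynomial_function.intros(3,4))
qed

lemma has_derivative_line_poly:
  fixes p :: "'a::euclidean_space \<Rightarrow> real"
  assumes "\<And>x. (p has_derivative (\<lambda>v. \<Sum>b\<in>Basis. (v \<bullet> b) * P b x)) (at x)" and "e \<in> Basis"
  shows "((\<lambda>t. p (x + t *\<^sub>R e)) has_real_derivative P e (x + t *\<^sub>R e)) (at t)"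
proof -
  have "((\<lambda>t. x + t *\<^sub>R e) has_derivative (\<lambda>h. h *\<^sub>R e)) (at t)"
    by (auto intro!: derivative_eq_intros)
  then have "((\<lambda>t. p (x + t *\<^sub>R e)) has_derivative
     (\<lambda>h. \<Sum>b\<in>Basis. ((h *\<^sub>R e) \<bullet> b) * P b (x + t *\<^sub>R e))) (at t)"
    using has_derivative_compose[OF _ assms(1)] by fast
  moreover have "(\<Sum>b\<in>Basis. ((h *\<^sub>R e) \<bullet> b) * P b y) = P e y * h" for h y
    using \<open>e \<in> Basis\<close> by (simp add: inner_Basis sum.If_cases if_distrib if_distribR cong: if_cong)
  ultimately show ?thesis by (simp add: has_field_derivative_def)
qed

lemma laplacian_eq_sum:
  fixes p :: "'a::euclidean_space \<Rightarrow> real"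
  assumes "\<And>x. (p has_derivative (\<lambda>v. \<Sum>b\<in>Basis. (v \<bullet> b) * P b x)) (at x)"
    and "\<And>e x. (P e has_derivative (\<lambda>v. \<Sum>b\<in>Basis. (v \<bullet> b) * PP e b x)) (at x)"
  shows "laplacian p x = (\<Sum>b\<in>Basis. PP b b x)"
  unfolding laplacian_def
proof (rule sum.cong[OF refl])
  fix b :: 'a assume b: "b \<in> Basis"
  have 1: "deriv (\<lambda>t. p (x + t *\<^sub>R b)) = (\<lambda>t. P b (x + t *\<^sub>R b))"
    using DERIV_imp_deriv[OF has_derivative_line_poly[OF assms(1) b]] by blast
  have "deriv (\<lambda>t. P b (x + t *\<^sub>R b)) 0 = PP b b (x + 0 *\<^sub>R b)"
    by (rule DERIV_imp_deriv[OF has_derivative_line_poly[of _ "PP b", OF assms(2) b]])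
  then show "(deriv ^^ 2) (\<lambda>t. p (x + t *\<^sub>R b)) 0 = PP b b x"
    by (simp add: numeral_2_eq_2 1)
qed

lemma homogeneous_poly_Euler:
  fixes p :: "'a::euclidean_space \<Rightarrow> real"
  assumes "homogeneous_poly l p"
    and der: "\<And>x. (p has_derivative (\<lambda>v. \<Sum>b\<in>Basis. (v \<bullet> b) * P b x)) (at x)"
  shows "(\<Sum>b\<in>Basis. (x \<bullet> b) * P b x) = real l * p x"
proof -
  have "((\<lambda>t. t *\<^sub>R x) has_derivative (\<lambda>h. h *\<^sub>R x)) (at (1::real))"
    by (auto intro!: derivative_eq_intros)
  then have "((\<lambda>t. p (t *\<^sub>R x)) has_derivative
     (\<lambda>h. \<Sum>b\<in>Basis. ((h *\<^sub>R x) \<bullet> b) * P b (1 *\<^sub>R x))) (at 1)"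
    using has_derivative_compose[OF _ der] by fast
  then have "((\<lambda>t. p (t *\<^sub>R x)) has_real_derivative (\<Sum>b\<in>Basis. (x \<bullet> b) * P b x)) (at 1)"
    unfolding has_field_derivative_def
    by (rule has_derivative_eq_rhs) (simp add: fun_eq_iff sum_distrib_left mult_ac)
  moreover have "(\<lambda>t. p (t *\<^sub>R x)) = (\<lambda>t. t ^ l * p x)"
    using assms(1) by (auto simp: homogeneous_poly_def)
  moreover have "((\<lambda>t. t ^ l * p x) has_real_derivative (real l * p x)) (at 1)"
    by (auto intro!: derivative_eq_intros)
  ultimately show ?thesis using DERIV_unique by fastforce
qed

text \<open>
  Translation invariance of Lebesgue measure makes every difference quotient of \<open>g\<close> integrate
  to \<open>0\<close>; the Lipschitz bound lets the limit pass under the integral.  Differentiability almost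
  everywhere suffices, which admits cutoffs with a kink.
\<close>
lemma integral_directional_derivative_eq_0:
  fixes g :: "'a::euclidean_space \<Rightarrow> real"
  assumes cont: "continuous_on UNIV g"
    and bound: "\<And>x h. 0 < h \<Longrightarrow> h \<le> 1 \<Longrightarrow> \<bar>g (x + h *\<^sub>R e) - g x\<bar> \<le> K * h"
    and supp: "\<And>x. norm x > R \<Longrightarrow> g x = 0"
    and e: "norm e = 1"
    and der: "AE x in lborel. ((\<lambda>t. g (x + t *\<^sub>R e)) has_real_derivative g' x) (at 0)"
    and meas: "g' \<in> borel_measurable borel"
  shows "(\<integral>x. g' x \<partial>lborel) = 0"
proof -
  let ?h = "\<lambda>k::nat. inverse (real (Suc k))"
  let ?s = "\<lambda>k x. (g (x + ?h k *\<^sub>R e) - g x) / ?h k"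
  have g_meas [measurable]: "g \<in> borel_measurable borel"
    using cont by (rule borel_measurable_continuous_onI)
  have int_g: "integrable lborel g"
  proof -
    have "integrable lborel (\<lambda>x. indicator (cball 0 R) x *\<^sub>R g x)"
      by (rule borel_integrable_compact) (auto intro: continuous_on_subset[OF cont])
    moreover have "(\<lambda>x. indicator (cball 0 R) x *\<^sub>R g x) = g"
      using supp by (auto simp: fun_eq_iff indicator_def)
    ultimately show ?thesis by simp
  qed
  have shift: "(\<integral>x. g (x + c) \<partial>lborel) = (\<integral>x. g x \<partial>lborel)" "integrable lborel (\<lambda>x. g (x + c))" for c
  proof -
    have "(\<integral>x. g x \<partial>lborel) = (\<integral>x. g x \<partial>distr lborel borel ((+) c))"
      by (simp only: lborel_distr_plus)
    also have "\<dots> = (\<integral>x. g (x + c) \<partial>lborel)" by (subst integral_distr) (auto simp: add.commute)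
    finally show "(\<integral>x. g (x + c) \<partial>lborel) = (\<integral>x. g x \<partial>lborel)" ..
    have "integrable (distr lborel borel ((+) c)) g" by (simp only: lborel_distr_plus int_g)
    then show "integrable lborel (\<lambda>x. g (x + c))"
      by (subst (asm) integrable_distr_eq) (auto simp: add.commute)
  qed
  have zero: "(\<integral>x. ?s k x \<partial>lborel) = 0" for k
    using shift int_g by simp
  have "(\<lambda>k. \<integral>x. ?s k x \<partial>lborel) \<longlonglongrightarrow> (\<integral>x. g' x \<partial>lborel)"
  proof (rule integral_dominated_convergence[where w="\<lambda>x. \<bar>K\<bar> * indicator (cball 0 (R + 1)) x"])
    show "integrable lborel (\<lambda>x. \<bar>K\<bar> * indicator (cball (0::'a) (R + 1)) x)"
      using emeasure_bounded_finite[of "cball (0::'a) (R + 1)"]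
      by (intro integrable_mult_right integrable_real_indicator)
        simp_all
    show "AE x in lborel. (\<lambda>k. ?s k x) \<longlonglongrightarrow> g' x"
      using der
    proof eventually_elim
      case (elim x)
      have "((\<lambda>t. (g (x + t *\<^sub>R e) - g x) / t) \<longlongrightarrow> g' x) (at 0)"
        using elim by (simp add: DERIV_def)
      moreover have "filterlim ?h (at 0) sequentially"
        unfolding filterlim_at by (auto simp only: LIMSEQ_inverse_real_of_nat intro!: always_eventually) auto
      ultimately show ?case by (rule filterlim_compose)
    qed
    show "AE x in lborel. norm (?s k x) \<le> \<bar>K\<bar> * indicator (cball 0 (R + 1)) x" for k
    proof (rule AE_I2)
      fix x :: 'a
      have hk: "0 < ?h k" "?h k \<le> 1" by (auto simp: inverse_le_1_iff)
      show "norm (?s k x) \<le> \<bar>K\<bar> * indicator (cball 0 (R + 1)) x"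
      proof (cases "norm x \<le> R + 1")
        case True
        have "\<bar>g (x + ?h k *\<^sub>R e) - g x\<bar> \<le> \<bar>K\<bar> * ?h k"
          using bound[OF hk, of x] mult_right_mono[of K "\<bar>K\<bar>" "?h k"] hk by linarith
        then have "\<bar>g (x + ?h k *\<^sub>R e) - g x\<bar> / ?h k \<le> \<bar>K\<bar>"
          by (subst pos_divide_le_eq) (use hk in auto)
        then show ?thesis using True hk(1) by (simp add: abs_divide)
      next
        case False
        have "norm x \<le> norm (x + ?h k *\<^sub>R e) + ?h k"
          using norm_triangle_ineq4[of "x + ?h k *\<^sub>R e" "?h k *\<^sub>R e"] hk e by simp
        then have "norm (x + ?h k *\<^sub>R e) > R" "norm x > R" using False hk by linarith+
        then show ?thesis using supp by simp
      qed
    qed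
  qed (use meas in measurable)
  then show ?thesis using zero LIMSEQ_unique by (simp add: LIMSEQ_const_iff)
qed

lemma AE_norm_neq_1: "AE x in lborel. norm (x::'a::euclidean_space) \<noteq> 1"
proof -
  have "negligible (frontier (cball (0::'a) 1))"
    by (rule negligible_convex_frontier) simp
  then have "sphere (0::'a) 1 \<in> null_sets lebesgue"
    by (simp add: negligible_iff_null_sets frontier_cball)
  then have "emeasure lborel (sphere (0::'a) 1) = 0"
    by (simp add: null_sets_def)
  then have "sphere (0::'a) 1 \<in> null_sets lborel"
    by (simp add: null_sets_def)
  from AE_not_in[OF this] show ?thesis by simp
qed

text \<open>
  The integrand is the derivative along \<open>e\<close> of \<open>V\<close> times the cutoff \<open>max 0 (1 - x \<bullet> x)\<close>.
  This cutoff is Lipschitz, and smooth off the unit sphere.  Inside the ball its gradient is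
  \<open>-2 x\<close>, so that Green's identity below yields an integral over the ball without a further weight.
\<close>
lemma integral_cutoff_derivative:
  fixes V D :: "'a::euclidean_space \<Rightarrow> real"
  assumes V: "continuous_on UNIV V" and D: "continuous_on UNIV D" and e: "norm e = 1"
    and der: "\<And>x t. ((\<lambda>t. V (x + t *\<^sub>R e)) has_real_derivative D (x + t *\<^sub>R e)) (at t)"
  shows "(\<integral>x. indicator (ball 0 1) x * ((1 - x \<bullet> x) * D x - 2 * (x \<bullet> e) * V x) \<partial>lborel) = 0"
proof -
  define c where "c x = max 0 (1 - x \<bullet> x)" for x :: 'a
  have "compact (V ` cball 0 3)" "compact (D ` cball 0 3)"
    by (auto intro!: compact_continuous_image continuous_on_subset[OF V] continuous_on_subset[OF D])
  then have bdd: "bounded (V ` cball 0 3)" "bounded (D ` cball 0 3)"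
    by (auto intro: compact_imp_bounded)
  obtain KV where KV': "\<forall>y\<in>V ` cball 0 3. norm y \<le> KV" using bdd(1) unfolding bounded_iff by blast
  obtain KD where KD': "\<forall>y\<in>D ` cball 0 3. norm y \<le> KD" using bdd(2) unfolding bounded_iff by blast
  have KV: "\<bar>V x\<bar> \<le> KV" and KD: "\<bar>D x\<bar> \<le> KD" if "norm x \<le> 3" for x
    using KV' KD' that by auto
  have c_diff: "\<bar>c (x + h *\<^sub>R e) - c x\<bar> \<le> 5 * h" if "norm x \<le> 2" "0 < h" "h \<le> 1" for x h
  proof -
    have "\<bar>x \<bullet> e\<bar> \<le> 2" using Cauchy_Schwarz_ineq2[of x e] e that by simp
    have "(x + h *\<^sub>R e) \<bullet> (x + h *\<^sub>R e) - x \<bullet> x = h * (2 * (x \<bullet> e) + h)"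
      using e by (simp add: inner_add inner_commute algebra_simps power2_eq_square norm_eq_1)
    then have "\<bar>(x + h *\<^sub>R e) \<bullet> (x + h *\<^sub>R e) - x \<bullet> x\<bar> = h * \<bar>2 * (x \<bullet> e) + h\<bar>"
      using that by (simp add: abs_mult)
    also have "\<dots> \<le> h * 5" using \<open>\<bar>x \<bullet> e\<bar> \<le> 2\<close> that by (intro mult_left_mono) auto
    finally show ?thesis unfolding c_def by linarith
  qed
  have V_diff: "\<bar>V (x + h *\<^sub>R e) - V x\<bar> \<le> KD * h" if "norm x \<le> 2" "0 < h" "h \<le> 1" for x h
  proof -
    obtain z where z: "0 < z" "z < h" "V (x + h *\<^sub>R e) - V (x + 0 *\<^sub>R e) = (h - 0) * D (x + z *\<^sub>R e)"
      using MVT2[of 0 h "\<lambda>t. V (x + t *\<^sub>R e)" "\<lambda>t. D (x + t *\<^sub>R e)"] der \<open>0 < h\<close> by metis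
    have "norm (x + z *\<^sub>R e) \<le> 3"
      using norm_triangle_ineq[of x "z *\<^sub>R e"] z that e by simp
    then have "\<bar>D (x + z *\<^sub>R e)\<bar> * h \<le> KD * h" using KD that by (intro mult_right_mono) auto
    then show ?thesis using z that by (simp add: abs_mult mult.commute)
  qed
  have KV0: "KV \<ge> 0" "KD \<ge> 0" using KV[of 0] KD[of 0] by auto
  have "(\<integral>x. (if norm x < 1 then (1 - x \<bullet> x) * D x - 2 * (x \<bullet> e) * V x else 0) \<partial>lborel) = 0"
  proof (rule integral_directional_derivative_eq_0[where g="\<lambda>x. c x * V x" and e=e and R=1 and K="5 * KV + KD"])
    show "continuous_on UNIV (\<lambda>x. c x * V x)"
      unfolding c_def by (intro continuous_intros V)
    show zero: "c x * V x = 0" if "norm x > 1" for x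
      using that by (simp add: c_def dot_square_norm)
    show "\<bar>c (x + h *\<^sub>R e) * V (x + h *\<^sub>R e) - c x * V x\<bar> \<le> (5 * KV + KD) * h"
      if h: "0 < h" "h \<le> 1" for x h
    proof (cases "norm x \<le> 2")
      case True
      have "norm (x + h *\<^sub>R e) \<le> 3" using norm_triangle_ineq[of x "h *\<^sub>R e"] True h e by simp
      then have "\<bar>c (x + h *\<^sub>R e) - c x\<bar> * \<bar>V (x + h *\<^sub>R e)\<bar> \<le> (5 * h) * KV"
        using c_diff[OF True h] KV h by (intro mult_mono) auto
      moreover have "\<bar>c x\<bar> * \<bar>V (x + h *\<^sub>R e) - V x\<bar> \<le> 1 * (KD * h)"
        using V_diff[OF True h] by (intro mult_mono) (auto simp: c_def)
      moreover have "c (x + h *\<^sub>R e) * V (x + h *\<^sub>R e) - c x * V x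
         = (c (x + h *\<^sub>R e) - c x) * V (x + h *\<^sub>R e) + c x * (V (x + h *\<^sub>R e) - V x)"
        by (simp add: algebra_simps)
      ultimately have "\<bar>c (x + h *\<^sub>R e) * V (x + h *\<^sub>R e) - c x * V x\<bar> \<le> (5 * h) * KV + 1 * (KD * h)"
        using abs_triangle_ineq[of "(c (x + h *\<^sub>R e) - c x) * V (x + h *\<^sub>R e)" "c x * (V (x + h *\<^sub>R e) - V x)"]
        unfolding abs_mult[symmetric] by linarith
      also have "\<dots> = (5 * KV + KD) * h" by algebra
      finally show ?thesis .
    next
      case False
      have "norm x \<le> norm (x + h *\<^sub>R e) + h"
        using norm_triangle_ineq4[of "x + h *\<^sub>R e" "h *\<^sub>R e"] h e by simp
      then have "norm (x + h *\<^sub>R e) > 1" "norm x > 1" using False h by linarith+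
      then have "c (x + h *\<^sub>R e) * V (x + h *\<^sub>R e) = 0" "c x * V x = 0" using zero by blast+
      then have "\<bar>c (x + h *\<^sub>R e) * V (x + h *\<^sub>R e) - c x * V x\<bar> = 0" by (simp only: diff_self abs_zero)
      then show ?thesis using KV0 h by (simp only: mult_nonneg_nonneg add_nonneg_nonneg zero_le_numeral less_imp_le)
    qed
    show "AE x in lborel. ((\<lambda>t. c (x + t *\<^sub>R e) * V (x + t *\<^sub>R e)) has_real_derivative
        (if norm x < 1 then (1 - x \<bullet> x) * D x - 2 * (x \<bullet> e) * V x else 0)) (at 0)"
      using AE_norm_neq_1
    proof eventually_elim
      case (elim x)
      show ?case
      proof (cases "norm x < 1")
        case True
        have "((\<lambda>t. (1 - (x + t *\<^sub>R e) \<bullet> (x + t *\<^sub>R e)) * V (x + t *\<^sub>R e)) has_real_derivative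
            (1 - x \<bullet> x) * D x - 2 * (x \<bullet> e) * V x) (at 0)"
          unfolding inner_add inner_scaleR_left inner_scaleR_right
          by (rule derivative_eq_intros der refl)+ (simp add: inner_commute algebra_simps)
        then have "((\<lambda>t. c (x + t *\<^sub>R e) * V (x + t *\<^sub>R e)) has_real_derivative
            (1 - x \<bullet> x) * D x - 2 * (x \<bullet> e) * V x) (at 0)"
        proof (rule has_field_derivative_transform_within_open)
          show "open {t. norm (x + t *\<^sub>R e) < 1}"
            by (intro open_Collect_less continuous_intros)
          show "0 \<in> {t. norm (x + t *\<^sub>R e) < 1}" using True by simp
          fix t assume "t \<in> {t. norm (x + t *\<^sub>R e) < 1}"
          then have "(x + t *\<^sub>R e) \<bullet> (x + t *\<^sub>R e) < 1"
            by (simp add: dot_square_norm abs_square_less_1)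
          then show "(1 - (x + t *\<^sub>R e) \<bullet> (x + t *\<^sub>R e)) * V (x + t *\<^sub>R e) = c (x + t *\<^sub>R e) * V (x + t *\<^sub>R e)"
            by (simp add: c_def)
        qed
        then show ?thesis using True by simp
      next
        case False
        then have x: "norm x > 1" using elim by simp
        have "((\<lambda>t. 0) has_real_derivative 0) (at (0::real))" by simp
        then have "((\<lambda>t. c (x + t *\<^sub>R e) * V (x + t *\<^sub>R e)) has_real_derivative 0) (at 0)"
        proof (rule has_field_derivative_transform_within_open)
          show "open {t. norm (x + t *\<^sub>R e) > 1}"
            by (intro open_Collect_less continuous_intros)
          show "0 \<in> {t. norm (x + t *\<^sub>R e) > 1}" using x by simp
        qed (use zero in auto)
        then show ?thesis using False by simp
      qed
    qed
    show "(\<lambda>x. if norm x < 1 then (1 - x \<bullet> x) * D x - 2 * (x \<bullet> e) * V x else 0) \<in> borel_measurable borel"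
      using borel_measurable_continuous_onI[OF V] borel_measurable_continuous_onI[OF D] by measurable
  qed (use e in auto)
  moreover have "(\<lambda>x. if norm x < 1 then (1 - x \<bullet> x) * D x - 2 * (x \<bullet> e) * V x else 0)
      = (\<lambda>x. indicator (ball 0 1) x * ((1 - x \<bullet> x) * D x - 2 * (x \<bullet> e) * V x))"
    by (auto simp: indicator_def)
  ultimately show ?thesis by simp
qed

lemma integrable_ball_continuous:
  fixes f :: "'a::euclidean_space \<Rightarrow> real"
  assumes "continuous_on UNIV f"
  shows "integrable lborel (\<lambda>x. indicator (ball 0 r) x * f x)"
proof -
  have [measurable]: "f \<in> borel_measurable borel"
    using assms by (rule borel_measurable_continuous_onI)
  have "integrable lborel (\<lambda>x. indicator (cball 0 r) x *\<^sub>R f x)"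
    by (rule borel_integrable_compact) (auto intro: continuous_on_subset[OF assms])
  then show ?thesis
    by (rule Bochner_Integration.integrable_bound) (auto simp: indicator_def)
qed

lemma continuous_on_real_polynomial_function:
  "real_polynomial_function p \<Longrightarrow> continuous_on S p"
  using continuous_on_polymonial_function real_polynomial_function_eq by auto

text \<open>
  Green's identity for the field \<open>p \<nabla>q - q \<nabla>p\<close>: its divergence \<open>p \<Delta>q - q \<Delta>p\<close> vanishes, so only
  the gradient of the cutoff contributes, and Euler's identity evaluates its pairing with the field
  as a multiple of \<open>(m - l) p q\<close>.
\<close>
lemma integral_ball_harmonic_product_eq_0:
  fixes p q :: "'a::euclidean_space \<Rightarrow> real"
  assumes p: "homogeneous_poly l p" "\<And>x. laplacian p x = 0"
    and q: "homogeneous_poly m q" "\<And>x. laplacian q x = 0"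
    and "l \<noteq> m"
  shows "(\<integral>x. indicator (ball 0 1) x * (p x * q x) \<partial>lborel) = 0"
proof -
  have p': "real_polynomial_function p" and q': "real_polynomial_function q"
    using p q by (auto simp: homogeneous_poly_def)
  from real_polynomial_function_gradient[OF p'] obtain P where
    P: "\<And>b. real_polynomial_function (P b)"
      "\<And>x. (p has_derivative (\<lambda>v. \<Sum>b\<in>Basis. (v \<bullet> b) * P b x)) (at x)" by blast
  from real_polynomial_function_gradient[OF q'] obtain Q where
    Q: "\<And>b. real_polynomial_function (Q b)"
      "\<And>x. (q has_derivative (\<lambda>v. \<Sum>b\<in>Basis. (v \<bullet> b) * Q b x)) (at x)" by blast
  have "\<forall>e. \<exists>PP. (\<forall>b. real_polynomial_function (PP b)) \<and>
      (\<forall>x. (P e has_derivative (\<lambda>v. \<Sum>b\<in>Basis. (v \<bullet> b) * PP b x)) (at x))"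
    using real_polynomial_function_gradient[OF P(1)] by blast
  then obtain PP where PP: "\<And>e b. real_polynomial_function (PP e b)"
      "\<And>e x. (P e has_derivative (\<lambda>v. \<Sum>b\<in>Basis. (v \<bullet> b) * PP e b x)) (at x)" by metis
  have "\<forall>e. \<exists>QQ. (\<forall>b. real_polynomial_function (QQ b)) \<and>
      (\<forall>x. (Q e has_derivative (\<lambda>v. \<Sum>b\<in>Basis. (v \<bullet> b) * QQ b x)) (at x))"
    using real_polynomial_function_gradient[OF Q(1)] by blast
  then obtain QQ where QQ: "\<And>e b. real_polynomial_function (QQ e b)"
      "\<And>e x. (Q e has_derivative (\<lambda>v. \<Sum>b\<in>Basis. (v \<bullet> b) * QQ e b x)) (at x)" by metis
  define V where "V b x = p x * Q b x - q x * P b x" for b x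
  define D where "D b x = p x * QQ b b x - q x * PP b b x" for b x
  note rp = continuous_on_real_polynomial_function[OF p'] continuous_on_real_polynomial_function[OF q']
    continuous_on_real_polynomial_function[OF P(1)] continuous_on_real_polynomial_function[OF Q(1)]
    continuous_on_real_polynomial_function[OF PP(1)] continuous_on_real_polynomial_function[OF QQ(1)]
  have contV: "continuous_on UNIV (V b)" and contD: "continuous_on UNIV (D b)" for b
    unfolding V_def D_def by (intro continuous_intros rp)+
  let ?F = "\<lambda>b x. (1 - x \<bullet> x) * D b x - 2 * (x \<bullet> b) * V b x"
  have zero: "(\<integral>x. indicator (ball 0 1) x * ?F b x \<partial>lborel) = 0" if b: "b \<in> Basis" for b
  proof (rule integral_cutoff_derivative[OF contV contD])
    fix x t
    show "((\<lambda>t. V b (x + t *\<^sub>R b)) has_real_derivative D b (x + t *\<^sub>R b)) (at t)"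
      unfolding V_def D_def
      by (rule derivative_eq_intros has_derivative_line_poly[OF P(2) b]
          has_derivative_line_poly[OF Q(2) b] has_derivative_line_poly[of _ "PP b", OF PP(2) b]
          has_derivative_line_poly[of _ "QQ b", OF QQ(2) b] refl)+ simp
  qed (use b in auto)
  have int: "integrable lborel (\<lambda>x. indicator (ball 0 1) x * ?F b x)" for b
    by (intro integrable_ball_continuous continuous_intros contV contD)
  (* the terms with \<open>D\<close> sum to the divergence of the field, which is 0; those with \<open>V\<close>
     are evaluated by Euler's identity *)
  have "(\<Sum>b\<in>Basis. ?F b x) = 2 * (real l - real m) * (p x * q x)" for x
  proof -
    have "(\<Sum>b\<in>Basis. D b x) = p x * laplacian q x - q x * laplacian p x"
      by (simp add: D_def laplacian_eq_sum[of p P PP, OF P(2) PP(2)]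
          laplacian_eq_sum[of q Q QQ, OF Q(2) QQ(2)] sum_subtractf sum_distrib_left)
    then have D0: "(\<Sum>b\<in>Basis. D b x) = 0" using p q by simp
    have "(\<Sum>b\<in>Basis. (x \<bullet> b) * V b x) =
      p x * (\<Sum>b\<in>Basis. (x \<bullet> b) * Q b x) - q x * (\<Sum>b\<in>Basis. (x \<bullet> b) * P b x)"
      by (simp add: V_def sum_subtractf sum_distrib_left algebra_simps)
    also have "\<dots> = (real m - real l) * (p x * q x)"
      by (simp add: homogeneous_poly_Euler[OF p(1) P(2)] homogeneous_poly_Euler[OF q(1) Q(2)] algebra_simps)
    finally have V0: "(\<Sum>b\<in>Basis. (x \<bullet> b) * V b x) = (real m - real l) * (p x * q x)" .
    have "(\<Sum>b\<in>Basis. ?F b x) = (1 - x \<bullet> x) * (\<Sum>b\<in>Basis. D b x) - 2 * (\<Sum>b\<in>Basis. (x \<bullet> b) * V b x)"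
      by (simp add: sum_subtractf sum_distrib_left mult.assoc)
    then show ?thesis using D0 V0 by (simp add: algebra_simps)
  qed
  then have "(\<lambda>x. 2 * (real l - real m) * (indicator (ball 0 1) x * (p x * q x)))
      = (\<lambda>x. \<Sum>b\<in>Basis. indicator (ball 0 1) x * ?F b x)"
    by (simp add: sum_distrib_left[symmetric] mult_ac)
  then have "(\<integral>x. 2 * (real l - real m) * (indicator (ball 0 1) x * (p x * q x)) \<partial>lborel)
      = (\<integral>x. (\<Sum>b\<in>Basis. indicator (ball 0 1) x * ?F b x) \<partial>lborel)"
    by (simp only:)
  also have "\<dots> = (\<Sum>b\<in>Basis. \<integral>x. indicator (ball 0 1) x * ?F b x \<partial>lborel)"
    by (rule Bochner_Integration.integral_sum) (rule int)
  also have "\<dots> = 0" using zero by (intro sum.neutral ballI)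
  finally have "(\<integral>x. 2 * (real l - real m) * (indicator (ball 0 1) x * (p x * q x)) \<partial>lborel) = 0" .
  then show ?thesis using \<open>l \<noteq> m\<close> by simp
qed

lemma integral_ball_scale:
  fixes f :: "'a::euclidean_space \<Rightarrow> real"
  assumes f: "f \<in> borel_measurable borel" and "\<rho> > 0"
    and hom: "\<And>t x. t > 0 \<Longrightarrow> f (t *\<^sub>R x) = t ^ k * f x"
  shows "(\<integral>x. indicator (ball 0 \<rho>) x * f x \<partial>lborel)
    = \<rho> ^ (k + DIM('a)) * (\<integral>x. indicator (ball 0 1) x * f x \<partial>lborel)"
proof -
  note [measurable] = f
  have "(\<integral>x. indicator (ball 0 \<rho>) x * f x \<partial>lborel)
     = (\<integral>x. indicator (ball 0 \<rho>) x * f x \<partial>density (distr lborel borel (\<lambda>x::'a. 0 + \<rho> *\<^sub>R x)) (\<lambda>_. \<bar>\<rho>\<bar>^DIM('a)))"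
    using lborel_affine[of \<rho> "0::'a"] \<open>\<rho> > 0\<close> by simp
  also have "\<dots> = (\<integral>x. \<rho> ^ DIM('a) * (indicator (ball 0 \<rho>) x * f x) \<partial>distr lborel borel (\<lambda>x::'a. 0 + \<rho> *\<^sub>R x))"
    using \<open>\<rho> > 0\<close> by (subst integral_density) (measurable, simp_all)
  also have "\<dots> = (\<integral>x. \<rho> ^ DIM('a) * (indicator (ball 0 \<rho>) (\<rho> *\<^sub>R x) * f (\<rho> *\<^sub>R x)) \<partial>lborel)"
    by (subst integral_distr) (measurable, simp_all)
  also have "\<dots> = (\<integral>x. \<rho> ^ (k + DIM('a)) * (indicator (ball 0 1) x * f x) \<partial>lborel)"
    using \<open>\<rho> > 0\<close> hom by (intro Bochner_Integration.integral_cong)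
      (auto simp: indicator_def power_add)
  finally show ?thesis by simp
qed

text \<open>
  Passage from the ball to the sphere.  On the thin shell \<open>\<rho> \<le> norm x < 1\<close> the function \<open>f\<close> differs
  from its radial projection \<open>f (sgn x)\<close> by a factor within \<open>1 - \<rho> ^ k\<close> of \<open>1\<close>.  By scaling, the
  integral of \<open>f\<close> over the shell is \<open>0\<close> and that of the projection is the fraction
  \<open>1 - \<rho> ^ DIM('a)\<close> of its integral over the ball, the same fraction as the volume of the shell.
  After division by this fraction, \<open>\<rho>\<close> tends to \<open>1\<close>.
\<close>
lemma integral_ball_sgn_eq_0:
  fixes f :: "'a::euclidean_space \<Rightarrow> real"
  assumes f: "continuous_on UNIV f" and hom: "\<And>t x. f (t *\<^sub>R x) = t ^ k * f x"
    and zero: "(\<integral>x. indicator (ball 0 1) x * f x \<partial>lborel) = 0"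
  shows "(\<integral>x. indicator (ball 0 1) x * f (sgn x) \<partial>lborel) = 0"
proof -
  have [measurable]: "f \<in> borel_measurable borel"
    using f by (rule borel_measurable_continuous_onI)
  have [measurable]: "(sgn :: 'a \<Rightarrow> 'a) \<in> borel_measurable borel"
    by (simp add: sgn_div_norm[abs_def])
  have [measurable]: "(\<lambda>x. f (sgn x)) \<in> borel_measurable borel"
    by (rule measurable_compose[where N=borel]) measurable
  let ?V = "measure lborel (ball (0::'a) 1)" and ?n = "DIM('a)"
  define \<Psi> where "\<Psi> = (\<integral>x. indicator (ball 0 1) x * f (sgn x) \<partial>lborel)"
  have "bounded (f ` cball 0 1)"
    by (intro compact_imp_bounded compact_continuous_image continuous_on_subset[OF f]) auto
  then obtain C where C': "\<forall>y\<in>f ` cball 0 1. norm y \<le> C" unfolding bounded_iff by blast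
  have C: "\<bar>f x\<bar> \<le> C" if "norm x \<le> 1" for x using C' that by auto
  have sgn1: "\<bar>f (sgn x)\<bar> \<le> C" for x by (rule C) (simp add: norm_sgn)
  have fin: "emeasure lborel (ball (0::'a) r) < \<infinity>" for r by (intro emeasure_bounded_finite) auto
  have int_ind: "integrable lborel (indicator (ball (0::'a) r) :: _ \<Rightarrow> real)" for r
    using fin by (intro integrable_real_indicator) auto
  have int_sgn: "integrable lborel (\<lambda>x. indicator (ball 0 r) x * f (sgn x))" for r
  proof (rule Bochner_Integration.integrable_bound)
    show "integrable lborel (\<lambda>x. C * indicator (ball (0::'a) r) x)"
      by (intro integrable_mult_right int_ind)
    show "AE x in lborel. norm (indicator (ball 0 r) x * f (sgn x)) \<le> norm (C * indicator (ball 0 r) x)"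
      by (rule AE_I2) (use sgn1 in \<open>auto simp: indicator_def intro: order_trans[OF _ abs_ge_self]\<close>)
    have "(\<lambda>x. indicator (ball 0 r) x * f (sgn x)) \<in> borel_measurable borel"
      by (intro borel_measurable_times borel_measurable_indicator \<open>(\<lambda>x. f (sgn x)) \<in> _\<close>) simp
    then show "(\<lambda>x. indicator (ball 0 r) x * f (sgn x)) \<in> borel_measurable lborel" by simp
  qed
  note int_f = integrable_ball_continuous[OF f]
  have f_sgn: "f x = norm x ^ k * f (sgn x)" if "x \<noteq> 0" for x
  proof -
    have "x = norm x *\<^sub>R sgn x" using that by (simp add: sgn_div_norm)
    then show ?thesis using hom[of "norm x" "sgn x"] by simp
  qed
  (* comparison over the shell between the radii \<open>\<rho>\<close> and 1, whose indicator is \<open>?A\<close> *)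
  have key: "\<bar>\<Psi>\<bar> \<le> C * ?V * (1 - \<rho> ^ k)" if \<rho>: "0 < \<rho>" "\<rho> < 1" for \<rho>
  proof -
    have sc_f: "(\<integral>x. indicator (ball 0 \<rho>) x * f x \<partial>lborel) = 0"
      using integral_ball_scale[of f \<rho> k] hom zero \<rho> by simp
    have sc_s: "(\<integral>x. indicator (ball 0 \<rho>) x * f (sgn x) \<partial>lborel) = \<rho> ^ ?n * \<Psi>"
      using integral_ball_scale[of "\<lambda>x. f (sgn x)" \<rho> 0] \<rho> by (simp add: \<Psi>_def sgn_scaleR)
    have sc_v: "(\<integral>x. indicator (ball (0::'a) \<rho>) x \<partial>lborel) = \<rho> ^ ?n * ?V"
      using integral_ball_scale[of "\<lambda>x::'a. 1" \<rho> 0] \<rho> by simp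
    let ?A = "\<lambda>x::'a. indicator (ball 0 1) x - indicator (ball 0 \<rho>) x :: real"
    have A: "?A x = (if \<rho> \<le> norm x \<and> norm x < 1 then 1 else 0)" for x
      using \<rho> by (auto simp: indicator_def)
    have "(1 - \<rho> ^ ?n) * \<Psi> = (\<integral>x. ?A x * (f (sgn x) - f x) \<partial>lborel)"
      using sc_f sc_s zero int_sgn int_f by (simp add: algebra_simps \<Psi>_def)
    also have "\<bar>\<dots>\<bar> \<le> (\<integral>x. C * (1 - \<rho> ^ k) * ?A x \<partial>lborel)"
    proof (rule order_trans[OF integral_abs_bound], rule integral_mono)
      show "integrable lborel (\<lambda>x. \<bar>?A x * (f (sgn x) - f x)\<bar>)"
        using int_sgn int_f by (intro integrable_abs) (simp add: algebra_simps)
      show "integrable lborel (\<lambda>x. C * (1 - \<rho> ^ k) * ?A x)"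
        by (intro integrable_mult_right Bochner_Integration.integrable_diff int_ind)
      fix x :: 'a
      show "\<bar>?A x * (f (sgn x) - f x)\<bar> \<le> C * (1 - \<rho> ^ k) * ?A x"
      proof (cases "\<rho> \<le> norm x \<and> norm x < 1")
        case True
        then have "x \<noteq> 0" using \<rho> by auto
        have "\<rho> ^ k \<le> norm x ^ k" "norm x ^ k \<le> 1"
          using True \<rho> by (auto intro: power_mono power_le_one)
        moreover have "f (sgn x) - f x = f (sgn x) * (1 - norm x ^ k)"
          using f_sgn[OF \<open>x \<noteq> 0\<close>] by (simp add: algebra_simps)
        ultimately have "\<bar>f (sgn x) - f x\<bar> \<le> C * (1 - \<rho> ^ k)"
          using sgn1[of x] by (simp add: abs_mult mult_mono)
        then show ?thesis using True A by simp
      next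
        case False
        then have "?A x = 0" by (simp only: A if_False)
        then show ?thesis by simp
      qed
    qed
    also have "\<dots> = C * (1 - \<rho> ^ k) * (?V * (1 - \<rho> ^ ?n))"
      using int_ind sc_v by (simp add: algebra_simps)
    finally have "\<bar>1 - \<rho> ^ ?n\<bar> * \<bar>\<Psi>\<bar> \<le> C * ?V * (1 - \<rho> ^ k) * (1 - \<rho> ^ ?n)"
      by (simp add: abs_mult mult_ac)
    moreover have "\<rho> ^ ?n < 1" using \<rho> by (simp add: power_less_one_iff)
    ultimately show ?thesis by (simp add: mult.commute)
  qed
  have "((\<lambda>\<rho>. C * ?V * (1 - \<rho> ^ k)) \<longlongrightarrow> C * ?V * (1 - 1 ^ k)) (at_left 1)"
    by (intro tendsto_intros)
  moreover have "\<forall>\<^sub>F \<rho> in at_left 1. \<bar>\<Psi>\<bar> \<le> C * ?V * (1 - \<rho> ^ k)"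
    by (rule eventually_mono[OF eventually_at_left_real[of 0 1]]) (use key in auto)
  ultimately have "\<bar>\<Psi>\<bar> \<le> C * ?V * (1 - 1 ^ k)"
    by (intro tendsto_lowerbound[of _ _ "at_left 1"]) auto
  then show ?thesis by (simp add: \<Psi>_def)
qed

section \<open>Integration over the sphere\<close>

lemma integral_sphere_measure:
  fixes f :: "'a::euclidean_space \<Rightarrow> real"
  assumes [measurable]: "f \<in> borel_measurable borel"
  shows "(\<integral>x. f x \<partial>sphere_measure) = real DIM('a) * (\<integral>x. indicator (ball 0 1) x * f (sgn x) \<partial>lborel)"
proof -
  let ?D = "distr (restrict_space lborel (ball 0 1 - {0})) (restrict_space borel (sphere 0 1)) (sgn :: 'a \<Rightarrow> 'a)"
  have [measurable]: "(sgn :: 'a \<Rightarrow> 'a) \<in> borel_measurable borel"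
    by (simp add: sgn_div_norm[abs_def])
  have [measurable]: "(\<lambda>x. f (sgn x)) \<in> borel_measurable borel"
    by (rule measurable_compose[where N=borel]) measurable
  have fS: "f \<in> borel_measurable (restrict_space borel (sphere 0 1))"
    by (rule measurable_restrict_space1) measurable
  have eq: "sphere_measure = density ?D (\<lambda>_. ennreal (real DIM('a)))"
    by (rule measure_eqI)
      (auto simp: sphere_measure_def emeasure_density nn_integral_cmult_indicator ennreal_of_nat_eq_real_of_nat)
  have "(\<integral>x. f x \<partial>sphere_measure) = (\<integral>x. real DIM('a) *\<^sub>R f x \<partial>?D)"
    unfolding eq by (rule integral_density) (use fS in auto)
  also have "\<dots> = real DIM('a) * (\<integral>x. f x \<partial>?D)" by simp
  also have "(\<integral>x. f x \<partial>?D) = (\<integral>x. f (sgn x) \<partial>restrict_space lborel (ball 0 1 - {0}))"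
    by (rule integral_distr[OF measurable_sgn_ball fS])
  also have "\<dots> = (\<integral>x. indicator (ball 0 1 - {0}) x *\<^sub>R f (sgn x) \<partial>lborel)"
    by (rule integral_restrict_space) simp
  also have "\<dots> = (\<integral>x. indicator (ball 0 1) x * f (sgn x) \<partial>lborel)"
  proof (rule integral_cong_AE)
    have "AE x in lborel. x \<noteq> (0::'a)" by (rule AE_lborel_singleton)
    then show "AE x in lborel. indicator (ball 0 1 - {0}) x *\<^sub>R f (sgn x) = indicator (ball 0 1) x * f (sgn x)"
      by eventually_elim (auto simp: indicator_def)
  qed (simp, measurable)+
  finally show ?thesis .
qed

definition sphere_area :: "'a::euclidean_space itself \<Rightarrow> real" where
  "sphere_area _ = real DIM('a) * unit_ball_vol (real DIM('a))"

lemma sphere_area_pos: "sphere_area TYPE('a::euclidean_space) > 0"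
  by (simp add: sphere_area_def unit_ball_vol_pos)

lemma finite_measure_sphere: "finite_measure (sphere_measure :: 'a::euclidean_space measure)"
  by (rule finite_measureI) (simp add: emeasure_sphere_measure_space)

interpretation sphere: finite_measure "sphere_measure :: 'a::euclidean_space measure"
  by (rule finite_measure_sphere)

lemma measure_sphere_space [simp]:
  "measure sphere_measure (sphere (0::'a::euclidean_space) 1) = sphere_area TYPE('a)"
  using emeasure_sphere_measure_space[where 'a='a] sphere_area_pos[where 'a='a]
  by (simp add: measure_def sphere_area_def)

lemma borel_imp_sphere_measurable:
  "f \<in> borel_measurable borel \<Longrightarrow> f \<in> borel_measurable (sphere_measure :: 'a::euclidean_space measure)"
  by (subst measurable_cong_sets[OF sets_sphere_measure refl]) (rule measurable_restrict_space1)

lemma continuous_imp_sphere_measurable: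
  fixes f :: "'a::euclidean_space \<Rightarrow> real"
  shows "continuous_on UNIV f \<Longrightarrow> f \<in> borel_measurable sphere_measure"
  by (intro borel_imp_sphere_measurable borel_measurable_continuous_onI)

lemma integrable_sphere_continuous:
  fixes f :: "'a::euclidean_space \<Rightarrow> real"
  assumes "continuous_on UNIV f"
  shows "integrable sphere_measure f"
proof -
  have "bounded (f ` sphere 0 1)"
    by (intro compact_imp_bounded compact_continuous_image continuous_on_subset[OF assms]) auto
  then obtain C where "\<forall>y\<in>f ` sphere 0 1. norm y \<le> C" unfolding bounded_iff by blast
  then show ?thesis
    by (intro sphere.integrable_const_bound[of _ C] AE_I2 continuous_imp_sphere_measurable assms) auto
qed

text \<open>
  Nonempty relatively open subsets of the sphere have positive measure, because the cone over
  them is open.  This upgrades equality in mean square to equality at every point.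
\<close>
lemma continuous_eq_0_on_sphere:
  fixes f :: "'a::euclidean_space \<Rightarrow> real"
  assumes f: "continuous_on UNIV f" and zero: "(\<integral>x. (f x)\<^sup>2 \<partial>sphere_measure) = 0"
    and x0: "x0 \<in> sphere 0 1"
  shows "f x0 = 0"
proof (rule ccontr)
  assume "f x0 \<noteq> 0"
  have f_meas [measurable]: "f \<in> borel_measurable borel"
    using f by (rule borel_measurable_continuous_onI)
  have [measurable]: "(sgn :: 'a \<Rightarrow> 'a) \<in> borel_measurable borel"
    by (simp add: sgn_div_norm[abs_def])
  have [measurable]: "(\<lambda>x. f (sgn x)) \<in> borel_measurable borel"
    by (rule measurable_compose[where N=borel]) measurable
  have "(\<integral>\<^sup>+x. ennreal ((f x)\<^sup>2) \<partial>sphere_measure) = 0"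
    using zero by (subst nn_integral_eq_integral)
      (simp_all add: integrable_sphere_continuous continuous_on_power[OF f])
  moreover have m: "(\<lambda>x. ennreal ((f x)\<^sup>2)) \<in> borel_measurable sphere_measure"
    by (intro borel_imp_sphere_measurable) measurable
  ultimately have "AE x in sphere_measure. f x = 0"
    by (subst (asm) nn_integral_0_iff_AE) auto
  then have "emeasure sphere_measure {x \<in> sphere (0::'a) 1. f x \<noteq> 0} = 0"
    by (subst (asm) AE_iff_measurable[OF _ refl])
      (use measurable_sets[OF continuous_imp_sphere_measurable[OF f], of "- {0}"] in
        \<open>auto simp: vimage_def Int_def conj_commute\<close>)
  moreover have "{x \<in> sphere (0::'a) 1. f x \<noteq> 0} \<in> sets sphere_measure"
    using measurable_sets[OF continuous_imp_sphere_measurable[OF f], of "- {0}"]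
    by (auto simp: vimage_def Int_def conj_commute)
  ultimately have null: "emeasure lborel {x \<in> ball (0::'a) 1 - {0}. sgn x \<in> {x \<in> sphere 0 1. f x \<noteq> 0}} = 0"
    by (simp add: emeasure_sphere_measure)
  let ?U = "{x \<in> ball (0::'a) 1 - {0}. f (sgn x) \<noteq> 0}"
  have "?U = {x \<in> ball (0::'a) 1 - {0}. sgn x \<in> {x \<in> sphere 0 1. f x \<noteq> 0}}"
    by (auto simp: norm_sgn)
  then have U0: "emeasure lborel ?U = 0" by (simp only: null)
  have U: "open ?U"
  proof -
    have "continuous_on (ball (0::'a) 1 - {0}) (\<lambda>x. f (sgn x))"
      by (rule continuous_on_compose2[OF f]) (auto intro!: continuous_intros)
    from continuous_open_preimage[OF this, of "- {0}"] show ?thesis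
      by (auto simp: vimage_def Int_def conj_commute open_Diff)
  qed
  have "(1/2) *\<^sub>R x0 \<in> ?U"
    using x0 \<open>f x0 \<noteq> 0\<close> by (auto simp: sgn_scaleR) (simp add: sgn_div_norm)
  then obtain e where e: "e > 0" "ball ((1/2) *\<^sub>R x0) e \<subseteq> ?U"
    using U unfolding open_contains_ball by blast
  have "emeasure lborel (ball ((1/2) *\<^sub>R x0) e) \<le> emeasure lborel ?U"
    using e(2) by (rule emeasure_mono) (simp add: U borel_open)
  then have "emeasure lborel (ball ((1/2) *\<^sub>R x0) e) \<le> 0" by (simp only: U0)
  then show False
    using e(1) by (simp add: emeasure_ball ennreal_eq_0_iff mult_le_0_iff unit_ball_vol_pos)
       (use zero_less_power[OF e(1), of "DIM('a)"] unit_ball_vol_pos[of "real DIM('a)"] in linarith)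
qed

section \<open>Spherical harmonics and zonal kernels\<close>

lemma spherical_harmonic_polynomial:
  assumes "spherical_harmonic l h"
  shows "\<exists>p. homogeneous_poly l p \<and> (\<forall>x. laplacian p x = 0) \<and> (\<forall>x\<in>sphere 0 1. h x = p x) \<and>
    continuous_on UNIV p"
  using assms continuous_on_real_polynomial_function
  unfolding spherical_harmonic_def homogeneous_poly_def by blast

lemma integral_spherical_harmonics_eq_0:
  fixes h k :: "'a::euclidean_space \<Rightarrow> real"
  assumes "spherical_harmonic l h" "spherical_harmonic m k" "l \<noteq> m"
  shows "(\<integral>x. h x * k x \<partial>sphere_measure) = 0"
proof -
  obtain p where p: "homogeneous_poly l p" "\<And>x. laplacian p x = 0" "\<And>x. x \<in> sphere 0 1 \<Longrightarrow> h x = p x"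
     "continuous_on UNIV p"
    using spherical_harmonic_polynomial[OF assms(1)] by metis
  obtain q where q: "homogeneous_poly m q" "\<And>x. laplacian q x = 0" "\<And>x. x \<in> sphere 0 1 \<Longrightarrow> k x = q x"
     "continuous_on UNIV q"
    using spherical_harmonic_polynomial[OF assms(2)] by metis
  have cont: "continuous_on UNIV (\<lambda>x. p x * q x)" by (intro continuous_intros p q)
  have "(\<integral>x. h x * k x \<partial>sphere_measure) = (\<integral>x. p x * q x \<partial>sphere_measure)"
    by (intro Bochner_Integration.integral_cong) (auto simp: p(3) q(3))
  also have "\<dots> = real DIM('a) * (\<integral>x. indicator (ball 0 1) x * (p (sgn x) * q (sgn x)) \<partial>lborel)"
    by (rule integral_sphere_measure) (rule borel_measurable_continuous_onI[OF cont])
  also have "(\<integral>x. indicator (ball 0 1) x * (p (sgn x) * q (sgn x)) \<partial>lborel) = 0"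
  proof (rule integral_ball_sgn_eq_0[of "\<lambda>x. p x * q x" "l + m"])
    show "p (t *\<^sub>R x) * q (t *\<^sub>R x) = t ^ (l + m) * (p x * q x)" for t x
      using p(1) q(1) by (simp add: homogeneous_poly_def power_add)
    show "(\<integral>x. indicator (ball 0 1) x * (p x * q x) \<partial>lborel) = 0"
      using p(1,2) q(1,2) assms(3) by (rule integral_ball_harmonic_product_eq_0)
  qed (rule cont)
  finally show ?thesis by simp
qed

lemma spherical_harmonic_sphere_measurable:
  fixes h :: "'a::euclidean_space \<Rightarrow> real"
  assumes "spherical_harmonic l h"
  shows "h \<in> borel_measurable sphere_measure"
proof -
  obtain p where "\<And>x. x \<in> sphere 0 1 \<Longrightarrow> h x = p x" "continuous_on UNIV p"
    using spherical_harmonic_polynomial[OF assms] by metis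
  then show ?thesis
    using continuous_imp_sphere_measurable[of p] by (subst measurable_cong[of _ h p]) auto
qed

lemma spherical_harmonic_sphere_L2:
  fixes h :: "'a::euclidean_space \<Rightarrow> real"
  assumes "spherical_harmonic l h"
  shows "h \<in> sphere_L2"
proof -
  obtain p where p: "\<And>x. x \<in> sphere 0 1 \<Longrightarrow> h x = p x" "continuous_on UNIV p"
    using spherical_harmonic_polynomial[OF assms] by metis
  have "integrable sphere_measure (\<lambda>x. (h x)\<^sup>2) \<longleftrightarrow> integrable sphere_measure (\<lambda>x. (p x)\<^sup>2)"
    by (intro Bochner_Integration.integrable_cong) (auto simp: p)
  then show ?thesis
    using spherical_harmonic_sphere_measurable[OF assms]
      integrable_sphere_continuous[OF continuous_on_power[OF p(2), of 2]]
    by (auto simp: sphere_L2_def)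
qed

lemma continuous_on_poly_inner [continuous_intros]:
  fixes y :: "'a::euclidean_space"
  shows "continuous_on S (\<lambda>x. poly P (x \<bullet> y))"
  by (intro continuous_intros)

lemma continuous_imp_sphere_L2:
  fixes f :: "'a::euclidean_space \<Rightarrow> real"
  shows "continuous_on UNIV f \<Longrightarrow> f \<in> sphere_L2"
  by (auto simp: sphere_L2_def intro!: continuous_imp_sphere_measurable integrable_sphere_continuous continuous_intros)

text \<open>
  The difference between \<open>k\<close> and its projection is orthogonal to both of them, hence to itself.
\<close>
lemma zonal_operator_harmonic_id:
  fixes k :: "'a::euclidean_space \<Rightarrow> real"
  assumes P: "harmonic_projection_kernel TYPE('a) l P" and k: "spherical_harmonic l k"
    and x: "x \<in> sphere 0 1"
  shows "zonal_operator TYPE('a) P k x = k x"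
proof -
  let ?T = "zonal_operator TYPE('a) P k"
  have T: "spherical_harmonic l ?T"
    and orth: "\<And>h. spherical_harmonic l h \<Longrightarrow> (\<integral>x. (k x - ?T x) * h x \<partial>sphere_measure) = 0"
    using P spherical_harmonic_sphere_L2[OF k] by (auto simp: harmonic_projection_kernel_def)
  obtain p where p: "\<And>x. x \<in> sphere 0 1 \<Longrightarrow> k x = p x" "continuous_on UNIV p"
    using spherical_harmonic_polynomial[OF k] by metis
  obtain q where q: "\<And>x. x \<in> sphere 0 1 \<Longrightarrow> ?T x = q x" "continuous_on UNIV q"
    using spherical_harmonic_polynomial[OF T] by metis
  have "(\<integral>x. (k x - ?T x) * h x \<partial>sphere_measure) = (\<integral>x. (p x - q x) * h x \<partial>sphere_measure)" for h
    by (intro Bochner_Integration.integral_cong) (auto simp: p q)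
  moreover have "(\<integral>x. (p x - q x) * k x \<partial>sphere_measure) = (\<integral>x. (p x - q x) * p x \<partial>sphere_measure)"
    "(\<integral>x. (p x - q x) * ?T x \<partial>sphere_measure) = (\<integral>x. (p x - q x) * q x \<partial>sphere_measure)"
    by (intro Bochner_Integration.integral_cong; auto simp: p q)+
  ultimately have "(\<integral>x. (p x - q x) * p x \<partial>sphere_measure) = 0" "(\<integral>x. (p x - q x) * q x \<partial>sphere_measure) = 0"
    using orth[OF k] orth[OF T] by simp_all
  moreover have "(\<integral>x. (p x - q x) * p x - (p x - q x) * q x \<partial>sphere_measure)
     = (\<integral>x. (p x - q x) * p x \<partial>sphere_measure) - (\<integral>x. (p x - q x) * q x \<partial>sphere_measure)"
    by (intro Bochner_Integration.integral_diff integrable_sphere_continuous continuous_intros p q)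
  ultimately have "(\<integral>x. (p x - q x)\<^sup>2 \<partial>sphere_measure) = 0"
    by (simp add: power2_eq_square algebra_simps)
  then have "p x - q x = 0"
    using continuous_eq_0_on_sphere[of "\<lambda>x. p x - q x"] x p q by (auto intro!: continuous_intros)
  then show ?thesis using p q x by simp
qed

text \<open>
  Write \<open>T\<close> for the projection and \<open>k\<close> for \<open>T g\<close>.  Integrating against \<open>g\<close> is evaluating \<open>T\<close> at
  \<open>y\<close>, so the integral of \<open>(g - k)\<^sup>2\<close>, which is that of \<open>(g - k) g\<close>, equals \<open>k y - T k y = 0\<close>.
  Thus the section \<open>g\<close> of the kernel is itself a harmonic of degree \<open>l\<close>; in particular it agrees
  on the sphere with a homogeneous polynomial of degree \<open>l\<close>, which bounds the degree seen by the
  cubature formula.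
\<close>
lemma zonal_eq_projection:
  fixes y :: "'a::euclidean_space"
  assumes P: "harmonic_projection_kernel TYPE('a) l P" and y: "y \<in> sphere 0 1"
  defines "g \<equiv> \<lambda>x. poly P (x \<bullet> y)"
  shows "spherical_harmonic l g" and "(\<integral>x. (g x)\<^sup>2 \<partial>sphere_measure) = poly P 1"
proof -
  let ?k = "zonal_operator TYPE('a) P g"
  have gc: "continuous_on UNIV g" unfolding g_def by (rule continuous_on_poly_inner)
  have k: "spherical_harmonic l ?k"
    and orth: "\<And>h. spherical_harmonic l h \<Longrightarrow> (\<integral>x. (g x - ?k x) * h x \<partial>sphere_measure) = 0"
    using P continuous_imp_sphere_L2[OF gc] by (auto simp: harmonic_projection_kernel_def)
  obtain q where q: "\<And>x. x \<in> sphere 0 1 \<Longrightarrow> ?k x = q x" "continuous_on UNIV q"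
    using spherical_harmonic_polynomial[OF k] by metis
  have Z: "zonal_operator TYPE('a) P f y = (\<integral>x. g x * f x \<partial>sphere_measure)" for f
    by (simp add: zonal_operator_def g_def inner_commute)
  have gg: "(\<integral>x. g x * g x \<partial>sphere_measure) = ?k y"
    by (simp add: zonal_operator_def g_def inner_commute)
  have "(\<integral>x. g x * q x \<partial>sphere_measure) = (\<integral>x. g x * ?k x \<partial>sphere_measure)"
    by (intro Bochner_Integration.integral_cong) (auto simp: q)
  also have "\<dots> = zonal_operator TYPE('a) P ?k y"
    by (simp only: Z)
  also have "\<dots> = ?k y" by (rule zonal_operator_harmonic_id[OF P k y])
  finally have gq: "(\<integral>x. g x * q x \<partial>sphere_measure) = ?k y" .
  have "(\<integral>x. (g x - ?k x) * ?k x \<partial>sphere_measure) = (\<integral>x. (g x - q x) * q x \<partial>sphere_measure)"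
    by (intro Bochner_Integration.integral_cong) (auto simp: q)
  with orth[OF k] have gqq: "(\<integral>x. (g x - q x) * q x \<partial>sphere_measure) = 0" by simp
  have "(\<integral>x. (g x - q x)\<^sup>2 \<partial>sphere_measure)
    = (\<integral>x. (g x * g x - g x * q x) - (g x - q x) * q x \<partial>sphere_measure)"
    by (intro Bochner_Integration.integral_cong) (auto simp: power2_eq_square algebra_simps)
  also have "\<dots> = ((\<integral>x. g x * g x \<partial>sphere_measure) - (\<integral>x. g x * q x \<partial>sphere_measure))
      - (\<integral>x. (g x - q x) * q x \<partial>sphere_measure)"
    by (subst Bochner_Integration.integral_diff Bochner_Integration.integral_diff;
        (intro integrable_sphere_continuous continuous_intros gc q(2))?)+ (rule refl)
  also have "\<dots> = 0" using gg gq gqq by simp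
  finally have "g x - q x = 0" if "x \<in> sphere 0 1" for x
    using continuous_eq_0_on_sphere[of "\<lambda>x. g x - q x"] that gc q(2) by (auto intro!: continuous_intros)
  then have eq: "g x = ?k x" if "x \<in> sphere 0 1" for x using q that by simp
  show "spherical_harmonic l g"
    using k eq by (auto simp: spherical_harmonic_def)
  show "(\<integral>x. (g x)\<^sup>2 \<partial>sphere_measure) = poly P 1"
    using gg eq[OF y] y by (simp add: power2_eq_square g_def dot_square_norm)
qed

section \<open>Degrees of products of polynomials\<close>

lemma homogeneous_poly_0: "homogeneous_poly k (\<lambda>x. 0)"
  by (auto simp: homogeneous_poly_def)

lemma homogeneous_poly_add:
  "homogeneous_poly k f \<Longrightarrow> homogeneous_poly k g \<Longrightarrow> homogeneous_poly k (\<lambda>x. f x + g x)"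
  by (auto simp: homogeneous_poly_def algebra_simps)

lemma homogeneous_poly_cmult:
  "homogeneous_poly k f \<Longrightarrow> homogeneous_poly k (\<lambda>x. c * f x)"
  by (auto simp: homogeneous_poly_def algebra_simps)

lemma homogeneous_poly_mult:
  "homogeneous_poly k f \<Longrightarrow> homogeneous_poly l g \<Longrightarrow> homogeneous_poly (k + l) (\<lambda>x. f x * g x)"
  by (auto simp: homogeneous_poly_def power_add)

lemma homogeneous_poly_sum:
  "(\<And>i. i \<in> I \<Longrightarrow> homogeneous_poly k (f i)) \<Longrightarrow> homogeneous_poly k (\<lambda>x. \<Sum>i\<in>I. f i x)"
  by (induction I rule: infinite_finite_induct) (auto intro: homogeneous_poly_0 homogeneous_poly_add)

lemma poly_degree_le_mult:
  assumes "poly_degree_le A p" "poly_degree_le B q"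
  shows "poly_degree_le (A + B) (\<lambda>x. p x * q x)"
proof -
  obtain f where f: "\<And>k. k \<le> A \<Longrightarrow> homogeneous_poly k (f k)" "p = (\<lambda>x. \<Sum>k\<le>A. f k x)"
    using assms(1) unfolding poly_degree_le_def by blast
  obtain g where g: "\<And>k. k \<le> B \<Longrightarrow> homogeneous_poly k (g k)" "q = (\<lambda>x. \<Sum>k\<le>B. g k x)"
    using assms(2) unfolding poly_degree_le_def by blast
  let ?h = "\<lambda>k x. \<Sum>a\<le>A. \<Sum>b\<le>B. if a + b = k then f a x * g b x else 0"
  have "homogeneous_poly k (?h k)" for k
  proof (intro homogeneous_poly_sum)
    fix a b assume ab: "a \<in> {..A}" "b \<in> {..B}"
    show "homogeneous_poly k (\<lambda>x. if a + b = k then f a x * g b x else 0)"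
      using ab homogeneous_poly_mult[OF f(1) g(1), of a b] homogeneous_poly_0[of k]
      by (cases "a + b = k") auto
  qed
  moreover have "p x * q x = (\<Sum>k\<le>A + B. ?h k x)" for x
  proof -
    have "p x * q x = (\<Sum>a\<le>A. \<Sum>b\<le>B. f a x * g b x)"
      by (simp add: f(2) g(2) sum_product)
    also have "\<dots> = (\<Sum>a\<le>A. \<Sum>b\<le>B. \<Sum>k\<le>A + B. if a + b = k then f a x * g b x else 0)"
      by (intro sum.cong refl) (simp add: sum.delta)
    also have "\<dots> = (\<Sum>a\<le>A. \<Sum>k\<le>A + B. \<Sum>b\<le>B. if a + b = k then f a x * g b x else 0)"
      by (intro sum.cong refl sum.swap)
    also have "\<dots> = (\<Sum>k\<le>A + B. ?h k x)" by (rule sum.swap)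
    finally show ?thesis .
  qed
  ultimately show ?thesis unfolding poly_degree_le_def by (intro exI[of _ ?h]) auto
qed

section \<open>Measure of caps\<close>

lemma sphere_ball_measurable:
  "{y \<in> sphere 0 1. norm (x - y) \<le> \<rho>} \<in> sets (sphere_measure :: 'a::euclidean_space measure)"
proof -
  have "(\<lambda>y. norm (x - y)) \<in> borel_measurable (sphere_measure :: 'a measure)"
    by (intro borel_imp_sphere_measurable) measurable
  from measurable_sets[OF this, of "{..\<rho>}"] show ?thesis
    by (auto simp: vimage_def Int_def conj_commute)
qed

text \<open>
  The cone over a cap of radius \<open>\<rho>\<close> lies in the \<open>\<rho>\<close>-neighbourhood of a unit segment, which is
  covered by about \<open>1 / \<rho>\<close> balls of radius \<open>2 * \<rho>\<close>.
\<close>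
lemma sphere_cap_bound:
  assumes dim: "DIM('a::euclidean_space) = d + 1"
  shows "\<exists>C>0. \<forall>x\<in>sphere (0::'a) 1. \<forall>\<rho>>0.
    emeasure sphere_measure {y \<in> sphere 0 1. norm (x - y) \<le> \<rho>} \<le> ennreal (C * \<rho> ^ d)"
proof -
  let ?v = "unit_ball_vol (real DIM('a))" and ?A = "sphere_area TYPE('a)"
  define C where "C = ?A + real DIM('a) * 3 * ?v * 2 ^ DIM('a)"
  have v: "?v > 0" by (simp add: unit_ball_vol_pos)
  have "C > 0" using sphere_area_pos[where 'a='a] v unfolding C_def by (intro add_pos_nonneg) auto
  moreover have "emeasure sphere_measure {y \<in> sphere 0 1. norm (x - y) \<le> \<rho>} \<le> ennreal (C * \<rho> ^ d)"
    if x: "x \<in> sphere (0::'a) 1" and \<rho>: "\<rho> > 0" for x \<rho>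
  proof (cases "\<rho> \<le> 1")
    case False
    have "emeasure sphere_measure {y \<in> sphere 0 1. norm (x - y) \<le> \<rho>} \<le> emeasure sphere_measure (sphere (0::'a) 1)"
      using sets.top[of "sphere_measure :: 'a measure"] by (intro emeasure_mono) auto
    also have "\<dots> = ennreal ?A" by (simp add: emeasure_sphere_measure_space sphere_area_def)
    also have "\<dots> \<le> ennreal (C * \<rho> ^ d)"
    proof (rule ennreal_leI)
      have "1 \<le> \<rho> ^ d" using False by simp
      moreover have "?A \<le> C" using v by (simp add: C_def)
      ultimately show "?A \<le> C * \<rho> ^ d"
        using mult_mono[of ?A C 1 "\<rho> ^ d"] sphere_area_pos[where 'a='a] \<open>C > 0\<close> by simp
    qed
    finally show ?thesis .
  next
    case True
    (* the segment from 0 to x is subdivided into N pieces of length at most \<open>\<rho>\<close> *)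
    define N where "N = nat \<lceil>1 / \<rho>\<rceil>"
    have N: "1 / \<rho> \<le> real N" "real N \<le> 1 / \<rho> + 1" "N > 0"
      using \<rho> unfolding N_def by (simp_all add: of_nat_ceiling)
    let ?B = "\<lambda>i. cball ((real i / real N) *\<^sub>R x) (2 * \<rho>)"
    have sub: "{z \<in> ball 0 1 - {0}. sgn z \<in> {y \<in> sphere 0 1. norm (x - y) \<le> \<rho>}} \<subseteq> (\<Union>i\<in>{..N}. ?B i)"
    proof
      fix z :: 'a assume "z \<in> {z \<in> ball 0 1 - {0}. sgn z \<in> {y \<in> sphere 0 1. norm (x - y) \<le> \<rho>}}"
      then have z: "z \<in> ball 0 1" "z \<noteq> 0" and zx: "norm (x - sgn z) \<le> \<rho>" by auto
      define t where "t = norm z"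
      have t: "0 < t" "t < 1" "z = t *\<^sub>R sgn z" using z by (auto simp: t_def sgn_div_norm)
      define i where "i = nat \<lfloor>t * real N\<rfloor>"
      have i: "real i \<le> t * real N" "t * real N < real i + 1"
        using t unfolding i_def by (simp_all add: of_nat_floor)
      have "real i \<le> real N" using i t N mult_right_mono[of t 1 "real N"] by linarith
      then have iN: "i \<le> N" by simp
      have "real i / real N \<le> t" "t \<le> (real i + 1) / real N"
        using i N by (simp_all add: pos_divide_le_eq pos_le_divide_eq)
      then have "\<bar>t - real i / real N\<bar> \<le> 1 / real N"
        by (simp add: add_divide_distrib)
      also have "\<dots> \<le> \<rho>" using N \<rho> by (simp add: field_simps)
      finally have ti: "\<bar>t - real i / real N\<bar> \<le> \<rho>" .
      have "(real i / real N) *\<^sub>R x - z = t *\<^sub>R (x - sgn z) - (t - real i / real N) *\<^sub>R x"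
        using t(3) by (simp add: algebra_simps)
      also have "norm \<dots> \<le> t * norm (x - sgn z) + \<bar>t - real i / real N\<bar> * norm x"
        using norm_triangle_ineq4 t by (metis abs_of_pos norm_scaleR)
      also have "\<dots> \<le> 1 * \<rho> + \<rho> * 1" using t zx ti x \<rho> by (intro add_mono mult_mono) auto
      finally show "z \<in> (\<Union>i\<in>{..N}. ?B i)"
        using iN by (auto simp: dist_norm intro!: bexI[of _ i])
    qed
    have "emeasure lborel {z \<in> ball 0 1 - {0}. sgn z \<in> {y \<in> sphere 0 1. norm (x - y) \<le> \<rho>}}
        \<le> emeasure lborel (\<Union>i\<in>{..N}. ?B i)"
      using sub by (rule emeasure_mono) auto
    also have "\<dots> \<le> (\<Sum>i\<le>N. emeasure lborel (?B i))"
      by (rule emeasure_subadditive_finite) auto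
    also have "\<dots> = (\<Sum>i\<le>N. ennreal (?v * (2 * \<rho>) ^ DIM('a)))"
      using \<rho> by (intro sum.cong refl emeasure_cball) auto
    also have "\<dots> = ennreal (real (N + 1) * (?v * (2 * \<rho>) ^ DIM('a)))"
      using v \<rho> by (simp add: ennreal_mult ennreal_of_nat_eq_real_of_nat)
    finally have *: "emeasure lborel {z \<in> ball 0 1 - {0}. sgn z \<in> {y \<in> sphere 0 1. norm (x - y) \<le> \<rho>}}
       \<le> ennreal (real (N + 1) * (?v * (2 * \<rho>) ^ DIM('a)))" .
    have "emeasure sphere_measure {y \<in> sphere 0 1. norm (x - y) \<le> \<rho>}
        \<le> of_nat DIM('a) * ennreal (real (N + 1) * (?v * (2 * \<rho>) ^ DIM('a)))"
      unfolding emeasure_sphere_measure[OF sphere_ball_measurable] by (rule mult_left_mono[OF *]) simp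
    also have "\<dots> = ennreal (real DIM('a) * (real (N + 1) * (?v * (2 * \<rho>) ^ DIM('a))))"
      using v \<rho> by (simp add: ennreal_mult ennreal_of_nat_eq_real_of_nat)
    also have "\<dots> \<le> ennreal (C * \<rho> ^ d)"
    proof (rule ennreal_leI)
      have "real (N + 1) * \<rho> \<le> 3" using N(2) True \<rho> by (simp add: field_simps)
      then have "real (N + 1) * \<rho> * (real DIM('a) * ?v * 2 ^ DIM('a) * \<rho> ^ d)
          \<le> 3 * (real DIM('a) * ?v * 2 ^ DIM('a) * \<rho> ^ d)"
        using v \<rho> by (intro mult_right_mono) auto
      moreover have "3 * (real DIM('a) * ?v * 2 ^ DIM('a) * \<rho> ^ d) \<le> C * \<rho> ^ d"
        using sphere_area_pos[where 'a='a] \<rho> by (simp add: C_def algebra_simps)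
      ultimately show "real DIM('a) * (real (N + 1) * (?v * (2 * \<rho>) ^ DIM('a))) \<le> C * \<rho> ^ d"
        by (simp add: dim power_mult_distrib algebra_simps)
    qed
    finally show ?thesis .
  qed
  ultimately show ?thesis by blast
qed

text \<open>
  Split the sphere into the dyadic shells \<open>a * norm (x - y) \<approx> 2 ^ m\<close>; the cap bound turns the
  integral into a geometric series.
\<close>
lemma sphere_decay_integral:
  assumes dim: "DIM('a::euclidean_space) = d + 1"
  shows "\<exists>C>0. \<forall>x\<in>sphere (0::'a) 1. \<forall>a>0.
    (\<integral>\<^sup>+y. ennreal (1 / (1 + a * norm (x - y)) ^ (d + 1)) \<partial>sphere_measure) \<le> ennreal (C / a ^ d)"
proof -
  obtain C where C: "C > 0" "\<And>x \<rho>. x \<in> sphere (0::'a) 1 \<Longrightarrow> \<rho> > 0 \<Longrightarrow>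
    emeasure sphere_measure {y \<in> sphere 0 1. norm (x - y) \<le> \<rho>} \<le> ennreal (C * \<rho> ^ d)"
    using sphere_cap_bound[OF dim] by blast
  have "(\<integral>\<^sup>+y. ennreal (1 / (1 + a * norm (x - y)) ^ (d + 1)) \<partial>sphere_measure)
      \<le> ennreal (2 * C * 2 ^ d / a ^ d)" if x: "x \<in> sphere (0::'a) 1" and a: "a > 0" for x a
  proof -
    let ?B = "\<lambda>m::nat. {y \<in> sphere 0 1. norm (x - y) \<le> 2 ^ (m + 1) / a}"
    have "(\<integral>\<^sup>+y. ennreal (1 / (1 + a * norm (x - y)) ^ (d + 1)) \<partial>sphere_measure)
      \<le> (\<integral>\<^sup>+y. (\<Sum>m. ennreal (1 / 2 ^ (m * (d + 1))) * indicator (?B m) y) \<partial>sphere_measure)"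
    proof (rule nn_integral_mono)
      fix y :: 'a assume "y \<in> space sphere_measure"
      then have y: "y \<in> sphere 0 1" by simp
      define u where "u = 1 + a * norm (x - y)"
      have u: "u \<ge> 1" using a by (simp add: u_def)
      define m where "m = nat \<lfloor>log 2 u\<rfloor>"
      have lu: "log 2 u \<ge> 0" using u by simp
      have m: "real m \<le> log 2 u" "log 2 u < real m + 1"
        using lu unfolding m_def by (simp_all add: of_nat_floor)
      have m1: "2 ^ m \<le> u"
        using m(1) u le_log_iff[of 2 u "real m"] by (simp add: powr_realpow)
      have "u < 2 powr (real m + 1)"
        using m(2) u log_less_iff[of 2 u "real m + 1"] by simp
      then have m2: "u < 2 ^ (m + 1)" by (simp add: powr_add powr_realpow)
      have "norm (x - y) \<le> 2 ^ (m + 1) / a" using m2 a by (simp add: u_def field_simps)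
      then have yB: "y \<in> ?B m" using y by simp
      have "2 ^ (m * (d + 1)) \<le> u ^ (d + 1)"
        unfolding power_mult using m1 by (rule power_mono) simp
      then have "ennreal (1 / u ^ (d + 1)) \<le> ennreal (1 / 2 ^ (m * (d + 1)))"
        using u by (intro ennreal_leI divide_left_mono) auto
      also have "\<dots> = (\<Sum>k\<in>{m}. ennreal (1 / 2 ^ (k * (d + 1))) * indicator (?B k) y)"
        using yB by simp
      also have "\<dots> \<le> (\<Sum>k. ennreal (1 / 2 ^ (k * (d + 1))) * indicator (?B k) y)"
        by (rule sum_le_suminf) auto
      finally show "ennreal (1 / (1 + a * norm (x - y)) ^ (d + 1))
        \<le> (\<Sum>m. ennreal (1 / 2 ^ (m * (d + 1))) * indicator (?B m) y)" by (simp add: u_def)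
    qed
    also have "\<dots> = (\<Sum>m. \<integral>\<^sup>+y. ennreal (1 / 2 ^ (m * (d + 1))) * indicator (?B m) y \<partial>sphere_measure)"
      by (rule nn_integral_suminf) (intro borel_measurable_times_ennreal borel_measurable_const
          borel_measurable_indicator sphere_ball_measurable)
    also have "\<dots> = (\<Sum>m. ennreal (1 / 2 ^ (m * (d + 1))) * emeasure sphere_measure (?B m))"
      by (intro suminf_cong nn_integral_cmult_indicator sphere_ball_measurable)
    also have "\<dots> \<le> (\<Sum>m. ennreal (C * 2 ^ d / a ^ d * (1 / 2) ^ m))"
    proof (rule suminf_le)
      fix m
      have "ennreal (1 / 2 ^ (m * (d + 1))) * emeasure sphere_measure (?B m)
        \<le> ennreal (1 / 2 ^ (m * (d + 1))) * ennreal (C * (2 ^ (m + 1) / a) ^ d)"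
        using C(2)[OF x, of "2 ^ (m + 1) / a"] a by (intro mult_left_mono) auto
      also have "\<dots> = ennreal (1 / 2 ^ (m * (d + 1)) * (C * (2 ^ (m + 1) / a) ^ d))"
        using C(1) a by (intro ennreal_mult[symmetric]) auto
      also have "1 / 2 ^ (m * (d + 1)) * (C * (2 ^ (m + 1) / a) ^ d) = C * 2 ^ d / a ^ d * (1 / 2) ^ m"
        by (simp add: power_add power_mult_distrib power_divide field_simps power_mult[symmetric])
      finally show "ennreal (1 / 2 ^ (m * (d + 1))) * emeasure sphere_measure (?B m)
         \<le> ennreal (C * 2 ^ d / a ^ d * (1 / 2) ^ m)" .
    qed auto
    also have "\<dots> = ennreal (\<Sum>m. C * 2 ^ d / a ^ d * (1 / 2) ^ m)"
      using C(1) a by (intro suminf_ennreal2) (auto intro!: summable_mult summable_geometric)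
    also have "(\<Sum>m. C * 2 ^ d / a ^ d * (1 / 2) ^ m) = 2 * C * 2 ^ d / a ^ d"
      by (subst suminf_mult) (auto simp: suminf_geometric summable_geometric)
    finally show ?thesis .
  qed
  then show ?thesis using C(1) by (intro exI[of _ "2 * C * 2 ^ d"]) auto
qed

section \<open>Needlets and their kernels\<close>

text \<open>
  The chord is shorter than the arc.  All localization estimates are used in terms of the chord,
  for which the triangle inequality is immediate.
\<close>
lemma geodesic_dist_ge_norm:
  fixes x y :: "'a::euclidean_space"
  assumes "x \<in> sphere 0 1" "y \<in> sphere 0 1"
  shows "norm (x - y) \<le> geodesic_dist x y"
proof -
  define t where "t = geodesic_dist x y"
  have xy: "\<bar>x \<bullet> y\<bar> \<le> 1" using Cauchy_Schwarz_ineq2[of x y] assms by simp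
  then have t: "t \<ge> 0" "cos t = x \<bullet> y"
    unfolding t_def geodesic_dist_def by (auto simp: abs_le_iff intro!: arccos_lbound cos_arccos)
  have "(norm (x - y))\<^sup>2 = 2 - 2 * cos (2 * (t / 2))"
    using assms by (simp add: power2_norm_eq_inner inner_diff algebra_simps t norm_eq_1 inner_commute)
  also have "\<dots> = (2 * sin (t / 2))\<^sup>2"
    by (subst cos_double_sin) (simp add: power2_eq_square)
  also have "\<dots> \<le> t\<^sup>2"
    using abs_sin_x_le_abs_x[of "t / 2"] t by (intro power2_le_iff_abs_le[THEN iffD2]) auto
  finally show ?thesis using t(1) unfolding t_def by (rule power2_le_imp_le)
qed

lemma reciprocal_le:
  fixes a b t :: real
  shows "a \<le> t * b \<Longrightarrow> 0 < a \<Longrightarrow> 0 < b \<Longrightarrow> 1 / b \<le> t / a"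
  by (simp add: field_simps)

text \<open>
  The height \<open>2\<^bsup>jd/2\<^esup>\<close> of an \<open>L\<^sup>2\<close>-normalized bump of width \<open>2\<^bsup>-j\<^esup>\<close> in dimension \<open>d\<close>.
\<close>
definition amp :: "nat \<Rightarrow> nat \<Rightarrow> real" where
  "amp d j = 2 powr (real j * real d / 2)"

lemma amp_pos [simp]: "amp d j > 0"
  by (simp add: amp_def)

lemma amp_nonneg [simp]: "amp d j \<ge> 0"
  by (simp add: amp_def)

lemma amp_neq_0 [simp]: "amp d j \<noteq> 0"
  by (simp add: amp_def)

lemma amp_square: "amp d j * amp d j = (2 ^ j) ^ d"
proof -
  have "amp d j * amp d j = 2 powr (real (j * d))"
    by (simp add: amp_def powr_add[symmetric] field_simps)
  also have "\<dots> = 2 ^ (j * d)" by (rule powr_realpow) simp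
  also have "\<dots> = (2 ^ j) ^ d" by (rule power_mult)
  finally show ?thesis .
qed

lemma amp_near: "j \<le> j' + 1 \<Longrightarrow> amp d j \<le> 2 powr (real d / 2) * amp d j'"
proof -
  assume "j \<le> j' + 1"
  then have "real j * real d \<le> (real j' + 1) * real d" by (intro mult_right_mono) auto
  then show ?thesis by (simp add: amp_def powr_add[symmetric] field_simps)
qed

lemma sphere_norm_continuous:
  fixes f :: "'a::euclidean_space \<Rightarrow> real"
  assumes f: "continuous_on UNIV f" and p: "p > 0"
  shows "sphere_norm (ennreal p) f = ennreal ((\<integral>x. \<bar>f x\<bar> powr p \<partial>sphere_measure) powr (1 / p))"
proof -
  have "continuous_on UNIV (\<lambda>x. \<bar>f x\<bar> powr p)"
    using p by (intro continuous_on_powr' continuous_intros f) auto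
  then have int: "integrable sphere_measure (\<lambda>x. \<bar>f x\<bar> powr p)"
    by (rule integrable_sphere_continuous)
  have "(\<integral>\<^sup>+x. enn_powr (ennreal \<bar>f x\<bar>) (enn2real (ennreal p)) \<partial>sphere_measure)
     = ennreal (\<integral>x. \<bar>f x\<bar> powr p \<partial>sphere_measure)"
    using p int by (simp add: enn_powr_def nn_integral_eq_integral)
  then show ?thesis
    using p by (simp add: sphere_norm_def eLp_norm_def enn_powr_def)
qed

locale needlet_frame =
  fixes d :: nat and \<phi> :: "real \<Rightarrow> real" and L :: "nat \<Rightarrow> real poly"
    and Z :: "nat \<Rightarrow> 'a::euclidean_space set" and w :: "nat \<Rightarrow> 'a \<Rightarrow> real"
  assumes dim: "DIM('a) = d + 1"
    and kernel: "\<And>l. harmonic_projection_kernel TYPE('a) l (L l)"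
    and cutoff: "needlet_cutoff \<phi>"
    and cubature: "needlet_cubature d Z w"
    and localized: "needlets_localized d Z (needlet \<phi> L w)"
    and norm_bounds: "needlets_norm_bounds d Z (needlet \<phi> L w)"
begin

abbreviation \<psi> :: "nat \<Rightarrow> 'a \<Rightarrow> 'a \<Rightarrow> real" where "\<psi> \<equiv> needlet \<phi> L w"

abbreviation ker :: "nat \<Rightarrow> 'a \<Rightarrow> 'a \<Rightarrow> real" where "ker \<equiv> needlet_kernel \<phi> L"

abbreviation win :: "nat \<Rightarrow> nat \<Rightarrow> real" where "win j l \<equiv> needlet_window \<phi> (real l / 2 ^ j)"

abbreviation zonal :: "nat \<Rightarrow> 'a \<Rightarrow> 'a \<Rightarrow> real" where "zonal l y x \<equiv> poly (L l) (x \<bullet> y)"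

lemma finite_Z [simp]: "finite (Z j)"
  and Z_sphere: "\<eta> \<in> Z j \<Longrightarrow> \<eta> \<in> sphere 0 1"
  and weight_pos: "\<eta> \<in> Z j \<Longrightarrow> w j \<eta> > 0"
  using cubature unfolding needlet_cubature_def by blast+

text \<open>
  The window of level \<open>j\<close> charges only the degrees \<open>2\<^bsup>j-1\<^esup> < l \<le> 2\<^bsup>j+1\<^esup>\<close>.  The half-open form keeps
  the windows of levels \<open>j\<close> and \<open>j + 2\<close> disjoint at their common end point.
\<close>
lemma window_support:
  assumes "win j l \<noteq> 0"
  shows "2 ^ j < 2 * l" and "l \<le> 2 ^ (j + 1)"
proof -
  define \<xi> where "\<xi> = real l / 2 ^ j"
  have \<phi>: "\<bar>x\<bar> > 1 \<Longrightarrow> \<phi> x = 0" "\<bar>x\<bar> \<le> 1/2 \<Longrightarrow> \<phi> x = 1" for x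
    using cutoff by (auto simp: needlet_cutoff_def)
  have \<xi>0: "\<xi> \<ge> 0" by (simp add: \<xi>_def)
  have "\<xi> > 1/2"
  proof (rule ccontr)
    assume "\<not> \<xi> > 1/2"
    then have "\<phi> \<xi> = 1" "\<phi> (\<xi> / 2) = 1" using \<xi>0 by (intro \<phi>(2); simp)+
    then show False using assms by (simp add: needlet_window_def \<xi>_def[symmetric])
  qed
  then have "real (2 ^ j) < real (2 * l)" by (simp add: \<xi>_def field_simps)
  then show "2 ^ j < 2 * l" by (simp only: of_nat_less_iff)
  have "\<xi> \<le> 2"
  proof (rule ccontr)
    assume "\<not> \<xi> \<le> 2"
    then have "\<phi> \<xi> = 0" "\<phi> (\<xi> / 2) = 0" using \<xi>0 by (intro \<phi>(1); simp)+
    then show False using assms by (simp add: needlet_window_def \<xi>_def[symmetric])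
  qed
  then have "real l \<le> real (2 ^ (j + 1))" by (simp add: \<xi>_def field_simps)
  then show "l \<le> 2 ^ (j + 1)" by (simp only: of_nat_le_iff)
qed

lemma needlet_kernel_finite_sum:
  "ker j x y = (\<Sum>l\<le>2 ^ (j + 1). win j l * zonal l y x)"
  unfolding needlet_kernel_def by (rule suminf_finite) (use window_support(2) in force)+

lemma continuous_on_needlet_kernel: "continuous_on S (\<lambda>x. ker j x y)"
  unfolding needlet_kernel_finite_sum by (intro continuous_intros)

lemma continuous_on_needlet: "continuous_on S (\<psi> j \<eta>)"
proof -
  have "\<psi> j \<eta> = (\<lambda>x. sqrt (w j \<eta>) * ker j x \<eta>)" by (auto simp: needlet_def)
  then show ?thesis by (auto intro!: continuous_intros continuous_on_needlet_kernel)
qed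

lemma integral_needlet_kernel_mult:
  assumes h: "continuous_on UNIV h"
  shows "(\<integral>x. ker j x y * h x \<partial>sphere_measure)
    = (\<Sum>l\<le>2 ^ (j + 1). win j l * (\<integral>x. zonal l y x * h x \<partial>sphere_measure))"
proof -
  have "(\<integral>x. ker j x y * h x \<partial>sphere_measure)
    = (\<integral>x. (\<Sum>l\<le>2 ^ (j + 1). win j l * (zonal l y x * h x)) \<partial>sphere_measure)"
    by (simp add: needlet_kernel_finite_sum sum_distrib_right mult.assoc)
  also have "\<dots> = (\<Sum>l\<le>2 ^ (j + 1). \<integral>x. win j l * (zonal l y x * h x) \<partial>sphere_measure)"
    by (intro Bochner_Integration.integral_sum integrable_sphere_continuous continuous_intros h)
  finally show ?thesis by simp
qed

lemma zonal_orthogonal: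
  assumes "y \<in> sphere 0 1" "y' \<in> sphere 0 1" "l \<noteq> m"
  shows "(\<integral>x. zonal l y x * zonal m y' x \<partial>sphere_measure) = 0"
  using integral_spherical_harmonics_eq_0 zonal_eq_projection(1)[OF kernel] assms by blast

lemma needlet_kernel_orthogonal:
  assumes "y \<in> sphere 0 1" "y' \<in> sphere 0 1" "j + 2 \<le> j'"
  shows "(\<integral>x. ker j x y * ker j' x y' \<partial>sphere_measure) = 0"
proof -
  have zero: "win j l * (win j' m * (\<integral>x. zonal m y' x * zonal l y x \<partial>sphere_measure)) = 0" for l m
  proof (cases "win j l = 0 \<or> win j' m = 0")
    case False
    then have "l \<le> 2 ^ (j + 1)" "2 ^ j' < 2 * m" using window_support by auto
    moreover have "(2::nat) ^ (j + 2) \<le> 2 ^ j'" using assms(3) by (intro power_increasing) auto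
    ultimately have "m \<noteq> l" by auto
    then show ?thesis using zonal_orthogonal[OF assms(2,1)] by simp
  qed auto
  have expand: "(\<integral>x. zonal l y x * ker j' x y' \<partial>sphere_measure)
     = (\<Sum>m\<le>2 ^ (j' + 1). win j' m * (\<integral>x. zonal m y' x * zonal l y x \<partial>sphere_measure))" for l
    by (subst integral_needlet_kernel_mult[symmetric]) (auto simp: mult.commute intro!: continuous_intros)
  show ?thesis
    by (subst integral_needlet_kernel_mult[OF continuous_on_needlet_kernel])
      (simp only: expand sum_distrib_left zero sum.neutral_const)
qed

text \<open>
  The value is the same for all \<open>y\<close>; so the \<open>L\<^sup>2\<close> bound known at the cubature points holds for
  kernels centred anywhere.
\<close>
lemma needlet_kernel_square_integral:
  assumes "y \<in> sphere 0 1"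
  shows "(\<integral>x. (ker j x y)\<^sup>2 \<partial>sphere_measure)
    = (\<Sum>l\<le>2 ^ (j + 1). (win j l)\<^sup>2 * poly (L l) 1)"
proof -
  have "(\<integral>x. zonal l y x * ker j x y \<partial>sphere_measure) = win j l * poly (L l) 1"
    if "l \<le> 2 ^ (j + 1)" for l
  proof -
    have "(\<integral>x. zonal l y x * ker j x y \<partial>sphere_measure)
       = (\<Sum>m\<le>2 ^ (j + 1). win j m * (\<integral>x. zonal m y x * zonal l y x \<partial>sphere_measure))"
      by (subst integral_needlet_kernel_mult[symmetric]) (auto simp: mult.commute intro!: continuous_intros)
    also have "\<dots> = (\<Sum>m\<le>2 ^ (j + 1). if m = l then win j l * poly (L l) 1 else 0)"
      using zonal_orthogonal[OF assms assms] zonal_eq_projection(2)[OF kernel assms]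
      by (intro sum.cong) (auto simp: power2_eq_square)
    also have "\<dots> = win j l * poly (L l) 1" using that by simp
    finally show ?thesis .
  qed
  then show ?thesis
    by (subst power2_eq_square, subst integral_needlet_kernel_mult[OF continuous_on_needlet_kernel])
      (auto simp: power2_eq_square mult.assoc intro!: sum.cong)
qed

lemma needlet_orthogonal:
  assumes "\<eta> \<in> Z j" "\<eta>' \<in> Z j'" "j + 2 \<le> j' \<or> j' + 2 \<le> j"
  shows "(\<integral>x. \<psi> j \<eta> x * \<psi> j' \<eta>' x \<partial>sphere_measure) = 0"
proof -
  have "(\<integral>x. ker j x \<eta> * ker j' x \<eta>' \<partial>sphere_measure) = 0"
    using needlet_kernel_orthogonal[of \<eta> \<eta>' j j'] needlet_kernel_orthogonal[of \<eta>' \<eta> j' j]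
      assms Z_sphere by (auto simp: mult.commute)
  moreover have "(\<lambda>x. \<psi> j \<eta> x * \<psi> j' \<eta>' x)
     = (\<lambda>x. (sqrt (w j \<eta>) * sqrt (w j' \<eta>')) * (ker j x \<eta> * ker j' x \<eta>'))"
    by (auto simp: needlet_def)
  ultimately show ?thesis by simp
qed

text \<open>
  The window vanishes at degree \<open>0\<close>, and harmonics of positive degree are orthogonal to constants.
\<close>
lemma needlet_mean_zero:
  assumes "\<eta> \<in> Z j"
  shows "(\<integral>x. \<psi> j \<eta> x \<partial>sphere_measure) = 0"
proof -
  have one: "spherical_harmonic 0 (\<lambda>x::'a. 1)"
    unfolding spherical_harmonic_def
    by (intro exI[of _ "\<lambda>x. 1"]) (auto simp: homogeneous_poly_def laplacian_def numeral_2_eq_2)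
  have "win j l * (\<integral>x. zonal l \<eta> x * 1 \<partial>sphere_measure) = 0" for l
  proof (cases "win j l = 0")
    case False
    then have "l \<noteq> 0" using window_support(1)[OF False] by (cases l) auto
    then have "(\<integral>x. zonal l \<eta> x * 1 \<partial>sphere_measure) = 0"
      using integral_spherical_harmonics_eq_0[OF zonal_eq_projection(1)[OF kernel] one]
        Z_sphere[OF assms] by blast
    then show ?thesis by (simp only: mult_zero_right)
  qed simp
  then have "(\<integral>x. ker j x \<eta> * 1 \<partial>sphere_measure) = 0"
    by (subst integral_needlet_kernel_mult) (simp_all only: sum.neutral_const continuous_on_const)
  then show ?thesis by (simp add: needlet_def)
qed

text \<open>
  The kernel has degree at most \<open>2 ^ (j + 1)\<close>, so its square is exactly within the reach
  \<open>2 ^ (j + 2)\<close> of the cubature formula.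
\<close>
lemma needlet_kernel_square_cubature:
  assumes y: "y \<in> sphere 0 1"
  shows "(\<Sum>\<eta>\<in>Z j. w j \<eta> * (ker j \<eta> y)\<^sup>2)
    = (\<integral>x. (ker j x y)\<^sup>2 \<partial>sphere_measure)"
proof -
  have "\<forall>l. \<exists>p. homogeneous_poly l p \<and> (\<forall>x\<in>sphere 0 1. zonal l y x = p x)"
    using zonal_eq_projection(1)[OF kernel y] by (auto simp: spherical_harmonic_def) blast
  then obtain p where p: "\<And>l. homogeneous_poly l (p l)"
     "\<And>l x. x \<in> sphere 0 1 \<Longrightarrow> zonal l y x = p l x" by metis
  (* a polynomial that agrees with the kernel on the sphere, hence at all cubature points *)
  define q where "q x = (\<Sum>l\<le>2 ^ (j + 1). win j l * p l x)" for x
  have "poly_degree_le (2 ^ (j + 1)) q"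
    unfolding poly_degree_le_def q_def
    by (intro exI[of _ "\<lambda>l x. win j l * p l x"]) (auto intro: homogeneous_poly_cmult p)
  from poly_degree_le_mult[OF this this] have "poly_degree_le (2 ^ (j + 2)) (\<lambda>x. (q x)\<^sup>2)"
    by (simp add: power2_eq_square)
  then have "(\<integral>x. (q x)\<^sup>2 \<partial>sphere_measure) = (\<Sum>\<eta>\<in>Z j. w j \<eta> * (q \<eta>)\<^sup>2)"
    using cubature by (auto simp: needlet_cubature_def)
  moreover have eq: "ker j x y = q x" if "x \<in> sphere 0 1" for x
    unfolding needlet_kernel_finite_sum q_def using that p(2) by auto
  moreover have "(\<integral>x. (ker j x y)\<^sup>2 \<partial>sphere_measure) = (\<integral>x. (q x)\<^sup>2 \<partial>sphere_measure)"
    by (intro Bochner_Integration.integral_cong) (auto simp: eq)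
  ultimately show ?thesis
    using Z_sphere eq by (auto intro!: sum.cong)
qed

section \<open>Size of needlets\<close>

lemma needlet_pointwise_bound:
  "\<exists>C>0. \<forall>j. \<forall>\<eta>\<in>Z j. \<forall>x\<in>sphere 0 1. \<bar>\<psi> j \<eta> x\<bar> \<le> C * amp d j / (1 + 2 ^ j * norm (x - \<eta>)) ^ k"
proof -
  obtain c where c: "\<And>j \<eta> x. \<eta> \<in> Z j \<Longrightarrow> x \<in> sphere 0 1 \<Longrightarrow>
      \<bar>\<psi> j \<eta> x\<bar> \<le> c * amp d j / (1 + 2 ^ j * geodesic_dist \<eta> x) ^ k"
    using localized unfolding needlets_localized_def amp_def by blast
  have "\<bar>\<psi> j \<eta> x\<bar> \<le> (\<bar>c\<bar> + 1) * amp d j / (1 + 2 ^ j * norm (x - \<eta>)) ^ k"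
    if "\<eta> \<in> Z j" "x \<in> sphere 0 1" for j \<eta> x
  proof -
    have "norm (x - \<eta>) \<le> geodesic_dist \<eta> x"
      using geodesic_dist_ge_norm[OF Z_sphere[OF that(1)] that(2)] by (simp add: norm_minus_commute)
    then have pw: "(1 + 2 ^ j * norm (x - \<eta>)) ^ k \<le> (1 + 2 ^ j * geodesic_dist \<eta> x) ^ k"
      by (intro power_mono add_left_mono mult_left_mono) auto
    have pos: "(1 + 2 ^ j * norm (x - \<eta>)) ^ k > 0"
      by (intro zero_less_power add_pos_nonneg) auto
    have "c * amp d j / (1 + 2 ^ j * geodesic_dist \<eta> x) ^ k \<le> (\<bar>c\<bar> + 1) * amp d j / (1 + 2 ^ j * norm (x - \<eta>)) ^ k"
      by (rule frac_le) (use pos pw less_imp_le[OF amp_pos] in \<open>auto intro: mult_mono mult_nonneg_nonneg\<close>)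
    then show ?thesis using c[OF that] by linarith
  qed
  then show ?thesis by (intro exI[of _ "\<bar>c\<bar> + 1"]) auto
qed

lemma needlet_L1_bound:
  "\<exists>C>0. \<forall>j. \<forall>\<eta>\<in>Z j. (\<integral>x. \<bar>\<psi> j \<eta> x\<bar> \<partial>sphere_measure) \<le> C / amp d j"
proof -
  obtain C where C: "C > 0" "\<And>j \<eta>. \<eta> \<in> Z j \<Longrightarrow>
      sphere_norm 1 (\<psi> j \<eta>) \<le> ennreal (C * 2 powr (real j * real d * (1/2 - recip 1)))"
    using norm_bounds unfolding needlets_norm_bounds_def by (meson order_refl)
  have "(\<integral>x. \<bar>\<psi> j \<eta> x\<bar> \<partial>sphere_measure) \<le> C / amp d j" if "\<eta> \<in> Z j" for j \<eta>
  proof -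
    have "sphere_norm 1 (\<psi> j \<eta>) = ennreal (\<integral>x. \<bar>\<psi> j \<eta> x\<bar> \<partial>sphere_measure)"
      using sphere_norm_continuous[OF continuous_on_needlet, of 1 j \<eta>] by simp
    with C(2)[OF that] C(1) show ?thesis
      by (simp add: recip_def amp_def powr_minus_divide)
  qed
  then show ?thesis using C(1) by blast
qed

lemma needlet_L2_bounds:
  "\<exists>c>0. \<exists>C>0. \<forall>j. \<forall>\<eta>\<in>Z j. c \<le> (\<integral>x. (\<psi> j \<eta> x)\<^sup>2 \<partial>sphere_measure) \<and>
     (\<integral>x. (\<psi> j \<eta> x)\<^sup>2 \<partial>sphere_measure) \<le> C"
proof -
  have r2: "recip 2 = 1 / 2"
  proof -
    have "recip 2 = enn2real (inverse (ennreal 2))" by (simp add: recip_def)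
    also have "\<dots> = enn2real (ennreal (inverse 2))" by (subst inverse_ennreal) simp_all
    also have "\<dots> = 1 / 2" by (subst enn2real_ennreal) simp_all
    finally show ?thesis .
  qed
  obtain c C where C: "c > 0" "C > 0" "\<And>j \<eta>. \<eta> \<in> Z j \<Longrightarrow> ennreal c \<le> sphere_norm 2 (\<psi> j \<eta>)"
    "\<And>j \<eta>. \<eta> \<in> Z j \<Longrightarrow> sphere_norm 2 (\<psi> j \<eta>) \<le> ennreal C"
    using norm_bounds[unfolded needlets_norm_bounds_def, rule_format, of 2] by (auto simp: r2)
  have "c\<^sup>2 \<le> (\<integral>x. (\<psi> j \<eta> x)\<^sup>2 \<partial>sphere_measure) \<and> (\<integral>x. (\<psi> j \<eta> x)\<^sup>2 \<partial>sphere_measure) \<le> C\<^sup>2"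
    if "\<eta> \<in> Z j" for j \<eta>
  proof -
    define I where "I = (\<integral>x. (\<psi> j \<eta> x)\<^sup>2 \<partial>sphere_measure)"
    have I: "I \<ge> 0" unfolding I_def by simp
    have "sphere_norm 2 (\<psi> j \<eta>) = ennreal (sqrt I)"
      using sphere_norm_continuous[OF continuous_on_needlet, of 2 j \<eta>] I
      by (simp add: I_def powr_half_sqrt powr_numeral)
    then have "c \<le> sqrt I" "sqrt I \<le> C" using C(3,4)[OF that] C(1,2) I by (auto simp: ennreal_le_iff2)
    then have "c\<^sup>2 \<le> (sqrt I)\<^sup>2" "(sqrt I)\<^sup>2 \<le> C\<^sup>2"
      using power_mono[of c "sqrt I" 2] power_mono[of "sqrt I" C 2] C I by simp_all
    then show ?thesis using I by (simp add: I_def)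
  qed
  then show ?thesis using C(1,2) by (intro exI[of _ "c\<^sup>2"] conjI exI[of _ "C\<^sup>2"]) auto
qed

section \<open>Peak sets\<close>

text \<open>
  Peak sets play the role of caps of radius \<open>2\<^bsup>-j\<^esup>\<close> about \<open>\<eta>\<close>; their measure is bounded below by
  means of the norms of the needlet.
\<close>
definition peak :: "real \<Rightarrow> nat \<Rightarrow> 'a \<Rightarrow> 'a set" where
  "peak \<delta> j \<eta> = {y \<in> sphere 0 1. \<delta> * amp d j \<le> \<bar>\<psi> j \<eta> y\<bar>}"

lemma peak_measurable [measurable]: "peak \<delta> j \<eta> \<in> sets sphere_measure"
proof -
  have "(\<lambda>y. \<bar>\<psi> j \<eta> y\<bar>) \<in> borel_measurable sphere_measure"
    by (intro continuous_imp_sphere_measurable continuous_intros continuous_on_needlet)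
  from measurable_sets[OF this, of "{\<delta> * amp d j..}"] show ?thesis
    by (auto simp: peak_def vimage_def Int_def conj_commute)
qed

lemma peak_Int_sphere [simp]: "peak \<delta> j \<eta> \<inter> sphere 0 1 = peak \<delta> j \<eta>"
  by (auto simp: peak_def)

lemma integrable_mult_indicator_peak:
  fixes h :: "'a \<Rightarrow> real"
  assumes "continuous_on UNIV h"
  shows "integrable sphere_measure (\<lambda>y. h y * indicator (peak \<delta> j \<eta>) y)"
  using integrable_mult_indicator[OF peak_measurable integrable_sphere_continuous[OF assms], of \<delta> j \<eta>]
  by (simp add: mult.commute)

text \<open>
  Off the peak set the square of the needlet is at most \<open>\<delta> * amp d j\<close> times its absolute value,
  and the \<open>L\<^sup>1\<close> bound makes this contribution to the \<open>L\<^sup>2\<close> norm small.  The rest of the \<open>L\<^sup>2\<close> norm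
  sits on the peak set, where the needlet is bounded by a multiple of \<open>amp d j\<close>.
\<close>
lemma peak_measure_bound:
  "\<exists>\<delta>>0. \<exists>c>0. \<forall>j. \<forall>\<eta>\<in>Z j. c / (2 ^ j) ^ d \<le> measure sphere_measure (peak \<delta> j \<eta>)"
proof -
  obtain C0 where C0: "C0 > 0" "\<And>j \<eta> x. \<eta> \<in> Z j \<Longrightarrow> x \<in> sphere 0 1 \<Longrightarrow> \<bar>\<psi> j \<eta> x\<bar> \<le> C0 * amp d j"
    using needlet_pointwise_bound[of 0] by auto
  obtain C1 where C1: "C1 > 0" "\<And>j \<eta>. \<eta> \<in> Z j \<Longrightarrow> (\<integral>x. \<bar>\<psi> j \<eta> x\<bar> \<partial>sphere_measure) \<le> C1 / amp d j"
    using needlet_L1_bound by blast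
  obtain c2 where c2: "c2 > 0" "\<And>j \<eta>. \<eta> \<in> Z j \<Longrightarrow> c2 \<le> (\<integral>x. (\<psi> j \<eta> x)\<^sup>2 \<partial>sphere_measure)"
    using needlet_L2_bounds by blast
  (* half of the lower bound for the square integral is left for the peak set *)
  define \<delta> where "\<delta> = c2 / (2 * C1)"
  have \<delta>: "\<delta> > 0" using c2 C1 by (simp add: \<delta>_def)
  have "c2 / (2 * C0\<^sup>2) / (2 ^ j) ^ d \<le> measure sphere_measure (peak \<delta> j \<eta>)" if \<eta>: "\<eta> \<in> Z j" for j \<eta>
  proof -
    let ?D = "peak \<delta> j \<eta>" and ?a = "amp d j"
    have int: "integrable sphere_measure (\<lambda>x. (C0 * ?a)\<^sup>2 * indicator ?D x)"
      "integrable sphere_measure (\<lambda>x. \<delta> * ?a * \<bar>\<psi> j \<eta> x\<bar>)"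
      by (intro integrable_mult_indicator_peak integrable_sphere_continuous continuous_intros continuous_on_needlet)+
    have "c2 \<le> (\<integral>x. (\<psi> j \<eta> x)\<^sup>2 \<partial>sphere_measure)" by (rule c2(2)[OF \<eta>])
    also have "\<dots> \<le> (\<integral>x. (C0 * ?a)\<^sup>2 * indicator ?D x + \<delta> * ?a * \<bar>\<psi> j \<eta> x\<bar> \<partial>sphere_measure)"
    proof (rule integral_mono)
      show "integrable sphere_measure (\<lambda>x. (\<psi> j \<eta> x)\<^sup>2)"
        by (intro integrable_sphere_continuous continuous_intros continuous_on_needlet)
      show "integrable sphere_measure (\<lambda>x. (C0 * ?a)\<^sup>2 * indicator ?D x + \<delta> * ?a * \<bar>\<psi> j \<eta> x\<bar>)"
        using int by simp
      fix x assume "x \<in> space (sphere_measure :: 'a measure)"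
      then have x: "x \<in> sphere 0 1" by simp
      show "(\<psi> j \<eta> x)\<^sup>2 \<le> (C0 * ?a)\<^sup>2 * indicator ?D x + \<delta> * ?a * \<bar>\<psi> j \<eta> x\<bar>"
      proof (cases "x \<in> ?D")
        case True
        have "(\<psi> j \<eta> x)\<^sup>2 \<le> (C0 * ?a)\<^sup>2"
          using C0(2)[OF \<eta> x] by (rule power2_le_iff_abs_le[THEN iffD2, rotated]) (use C0 in simp)
        moreover have "0 \<le> \<delta> * ?a * \<bar>\<psi> j \<eta> x\<bar>" using \<delta> by simp
        ultimately show ?thesis using True by simp
      next
        case False
        then have "\<bar>\<psi> j \<eta> x\<bar> \<le> \<delta> * ?a" using x by (auto simp: peak_def)
        then have "\<bar>\<psi> j \<eta> x\<bar> * \<bar>\<psi> j \<eta> x\<bar> \<le> \<delta> * ?a * \<bar>\<psi> j \<eta> x\<bar>" by (intro mult_right_mono) auto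
        then show ?thesis using False by (simp add: power2_eq_square)
      qed
    qed
    also have "\<dots> = (C0 * ?a)\<^sup>2 * measure sphere_measure ?D + \<delta> * ?a * (\<integral>x. \<bar>\<psi> j \<eta> x\<bar> \<partial>sphere_measure)"
      using int by (subst Bochner_Integration.integral_add) auto
    also have "\<dots> \<le> (C0 * ?a)\<^sup>2 * measure sphere_measure ?D + \<delta> * ?a * (C1 / ?a)"
      using C1(2)[OF \<eta>] \<delta> by (intro add_left_mono mult_left_mono) auto
    also have "\<delta> * ?a * (C1 / ?a) = c2 / 2" using C1 by (simp add: \<delta>_def)
    finally have "c2 / 2 \<le> C0\<^sup>2 * (?a * ?a) * measure sphere_measure ?D"
      by (simp add: power_mult_distrib power2_eq_square mult_ac)
    then show ?thesis using C0(1) by (simp add: amp_square field_simps)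
  qed
  then show ?thesis using \<delta> c2 C0 by (intro exI[of _ \<delta>] conjI exI[of _ "c2 / (2 * C0\<^sup>2)"]) auto
qed

text \<open>
  Cubature points may be arbitrarily close to each other; that they do not accumulate follows from
  the cubature formula.  For fixed \<open>y\<close>, every \<open>\<eta>\<close> with \<open>y\<close> in its peak set contributes at least
  \<open>\<delta>\<^sup>2 * 2\<^bsup>jd\<^esup>\<close> to the cubature sum for the square of the kernel centred at \<open>y\<close>, whereas that
  sum equals an integral of order \<open>2\<^bsup>jd\<^esup>\<close>.
\<close>
lemma peak_overlap:
  assumes \<delta>: "\<delta> > 0"
  shows "\<exists>N>0. \<forall>j. \<forall>y\<in>sphere 0 1. real (card {\<eta> \<in> Z j. y \<in> peak \<delta> j \<eta>}) \<le> N"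
proof -
  obtain C where C: "C > 0" "\<And>j \<eta>. \<eta> \<in> Z j \<Longrightarrow> (\<integral>x. (\<psi> j \<eta> x)\<^sup>2 \<partial>sphere_measure) \<le> C"
    using needlet_L2_bounds by blast
  obtain c where c: "c > 0" "\<And>j \<eta>. \<eta> \<in> Z j \<Longrightarrow> inverse c / 2 ^ (d * j) \<le> w j \<eta>"
    using cubature by (auto simp: needlet_cubature_def)
  have "real (card {\<eta> \<in> Z j. y \<in> peak \<delta> j \<eta>}) \<le> C * c / \<delta>\<^sup>2" if y: "y \<in> sphere 0 1" for j y
  proof (cases "{\<eta> \<in> Z j. y \<in> peak \<delta> j \<eta>} = {}")
    case True
    show ?thesis unfolding True using C c \<delta> by simp
  next
    case False
    let ?H = "{\<eta> \<in> Z j. y \<in> peak \<delta> j \<eta>}"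
    obtain \<eta>0 where \<eta>0: "\<eta>0 \<in> Z j" using False by auto
    define I where "I = (\<integral>x. (ker j x y)\<^sup>2 \<partial>sphere_measure)"
    have "I = (\<integral>x. (ker j x \<eta>0)\<^sup>2 \<partial>sphere_measure)"
      using needlet_kernel_square_integral[OF y] needlet_kernel_square_integral[OF Z_sphere[OF \<eta>0]]
      by (simp add: I_def)
    moreover have "(\<integral>x. (\<psi> j \<eta>0 x)\<^sup>2 \<partial>sphere_measure) = w j \<eta>0 * (\<integral>x. (ker j x \<eta>0)\<^sup>2 \<partial>sphere_measure)"
      using weight_pos[OF \<eta>0] by (simp add: needlet_def power_mult_distrib)
    ultimately have "w j \<eta>0 * I \<le> C" using C(2)[OF \<eta>0] by simp
    moreover have "inverse c / 2 ^ (d * j) * I \<le> w j \<eta>0 * I"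
      using c(2)[OF \<eta>0] by (intro mult_right_mono) (auto simp: I_def)
    ultimately have "inverse c / 2 ^ (d * j) * I \<le> C" by linarith
    then have I: "I \<le> C * c * 2 ^ (d * j)" using c(1) by (simp add: field_simps)
    have "real (card ?H) * (\<delta>\<^sup>2 * 2 ^ (d * j)) = (\<Sum>\<eta>\<in>?H. \<delta>\<^sup>2 * 2 ^ (d * j))" by simp
    also have "\<dots> \<le> (\<Sum>\<eta>\<in>?H. w j \<eta> * (ker j \<eta> y)\<^sup>2)"
    proof (rule sum_mono)
      fix \<eta> assume \<eta>: "\<eta> \<in> ?H"
      then have "\<delta> * amp d j \<le> \<bar>\<psi> j \<eta> y\<bar>" by (simp add: peak_def)
      then have "(\<delta> * amp d j)\<^sup>2 \<le> (\<bar>\<psi> j \<eta> y\<bar>)\<^sup>2" using \<delta> by (intro power_mono) auto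
      also have "\<dots> = w j \<eta> * (ker j \<eta> y)\<^sup>2"
        using \<eta> weight_pos[of \<eta> j]
        by (simp add: needlet_def power_mult_distrib needlet_kernel_def inner_commute)
      also have "(\<delta> * amp d j)\<^sup>2 = \<delta>\<^sup>2 * 2 ^ (d * j)"
        using amp_square[of d j] by (simp add: power2_eq_square power_mult[symmetric] mult_ac)
      finally show "\<delta>\<^sup>2 * 2 ^ (d * j) \<le> w j \<eta> * (ker j \<eta> y)\<^sup>2" .
    qed
    also have "\<dots> \<le> (\<Sum>\<eta>\<in>Z j. w j \<eta> * (ker j \<eta> y)\<^sup>2)"
      by (intro sum_mono2) (auto intro!: mult_nonneg_nonneg less_imp_le[OF weight_pos])
    also have "\<dots> = I" unfolding I_def by (rule needlet_kernel_square_cubature[OF y])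
    also note I
    finally show ?thesis using \<delta> by (simp add: field_simps)
  qed
  then show ?thesis using C c \<delta> by (intro exI[of _ "C * c / \<delta>\<^sup>2"]) auto
qed

lemma one_plus_scale_norm_pos: "1 + 2 ^ j * norm (z::'a) > 0"
  by (intro add_pos_nonneg) auto

text \<open>
  The triangle inequality in the multiplicative form in which decay factors are exchanged.
\<close>
lemma one_plus_scale_norm_triangle:
  "1 + 2 ^ j * norm (x - y) \<le> (1 + 2 ^ j * norm (x - z)) * (1 + 2 ^ j * norm ((y::'a) - z))"
proof -
  have "2 ^ j * norm (x - y) \<le> 2 ^ j * (norm (x - z) + norm (y - z))"
    using norm_triangle_ineq4[of "x - z" "y - z"] by (intro mult_left_mono) auto
  moreover have "0 \<le> (2 ^ j * norm (x - z)) * (2 ^ j * norm (y - z))" by simp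
  ultimately show ?thesis unfolding distrib_left distrib_right mult_1 mult_1_right by linarith
qed

lemma continuous_on_decay:
  "continuous_on S (\<lambda>y. 1 / (1 + 2 ^ j * norm ((x::'a) - y)) ^ k)"
  using one_plus_scale_norm_pos by (intro continuous_intros) (auto simp: less_imp_neq[symmetric])

lemma decay_integral_real:
  "\<exists>C>0. \<forall>x\<in>sphere (0::'a) 1. \<forall>j::nat.
    (\<integral>y. 1 / (1 + 2 ^ j * norm (x - y)) ^ (d + 1) \<partial>sphere_measure) \<le> C / (2 ^ j) ^ d"
proof -
  obtain C where C: "C > 0" "\<And>x a. x \<in> sphere (0::'a) 1 \<Longrightarrow> a > 0 \<Longrightarrow>
    (\<integral>\<^sup>+y. ennreal (1 / (1 + a * norm (x - y)) ^ (d + 1)) \<partial>sphere_measure) \<le> ennreal (C / a ^ d)"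
    using sphere_decay_integral[OF dim] by blast
  have "(\<integral>y. 1 / (1 + 2 ^ j * norm (x - y)) ^ (d + 1) \<partial>sphere_measure) \<le> C / (2 ^ j) ^ d"
    if x: "x \<in> sphere (0::'a) 1" for x j
  proof -
    have "integrable sphere_measure (\<lambda>y. 1 / (1 + 2 ^ j * norm (x - y)) ^ (d + 1))"
      by (rule integrable_sphere_continuous) (rule continuous_on_decay)
    then have "ennreal (\<integral>y. 1 / (1 + 2 ^ j * norm (x - y)) ^ (d + 1) \<partial>sphere_measure) \<le> ennreal (C / (2 ^ j) ^ d)"
      using C(2)[OF x, of "2 ^ j"] by (subst nn_integral_eq_integral[symmetric]) auto
    then show ?thesis using C(1) by (subst (asm) ennreal_le_iff) auto
  qed
  then show ?thesis using C(1) by blast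
qed

text \<open>
  The decay function varies by a bounded factor over a peak set, so each term is controlled by an
  average over the peak set of \<open>\<eta>\<close>.  These sets have measure of order \<open>2\<^bsup>-jd\<^esup>\<close> and bounded overlap,
  whence the sum is bounded by the integral of the decay function, rescaled.
\<close>
lemma decay_sum_bound:
  "\<exists>C>0. \<forall>j. \<forall>x\<in>sphere 0 1. (\<Sum>\<eta>\<in>Z j. 1 / (1 + 2 ^ j * norm (x - \<eta>)) ^ (d + 1)) \<le> C"
proof -
  obtain \<delta> c where \<delta>: "\<delta> > 0" and c: "c > 0"
    "\<And>j \<eta>. \<eta> \<in> Z j \<Longrightarrow> c / (2 ^ j) ^ d \<le> measure sphere_measure (peak \<delta> j \<eta>)"
    using peak_measure_bound by blast
  obtain N where N: "N > 0" "\<And>j y. y \<in> sphere 0 1 \<Longrightarrow> real (card {\<eta> \<in> Z j. y \<in> peak \<delta> j \<eta>}) \<le> N"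
    using peak_overlap[OF \<delta>] by blast
  obtain I where I: "I > 0" "\<And>x j. x \<in> sphere (0::'a) 1 \<Longrightarrow>
    (\<integral>y. 1 / (1 + 2 ^ j * norm (x - y)) ^ (d + 1) \<partial>sphere_measure) \<le> I / (2 ^ j) ^ d"
    using decay_integral_real by blast
  obtain C1 where C1: "C1 > 0" "\<And>j \<eta> x. \<eta> \<in> Z j \<Longrightarrow> x \<in> sphere 0 1 \<Longrightarrow>
      \<bar>\<psi> j \<eta> x\<bar> \<le> C1 * amp d j / (1 + 2 ^ j * norm (x - \<eta>)) ^ 1"
    using needlet_pointwise_bound[of 1] by blast
  (* a peak set lies within distance \<open>R / 2 ^ j\<close> of its centre *)
  define R where "R = C1 / \<delta>"
  have R: "R > 0" using C1 \<delta> by (simp add: R_def)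
  have "(\<Sum>\<eta>\<in>Z j. 1 / (1 + 2 ^ j * norm (x - \<eta>)) ^ (d + 1)) \<le> N * R ^ (d + 1) * I / c"
    if x: "x \<in> sphere 0 1" for j x
  proof -
    let ?h = "\<lambda>y. 1 / (1 + 2 ^ j * norm (x - y)) ^ (d + 1)"
    have pos: "1 + 2 ^ j * norm z > 0" for z :: 'a by (intro add_pos_nonneg) auto
    have h_cont: "continuous_on UNIV ?h"
      by (rule continuous_on_decay)
    have h0: "?h y \<ge> 0" for y using pos by (simp add: less_imp_le)
    have each: "c / (2 ^ j) ^ d * ?h \<eta> \<le> (\<integral>y. R ^ (d + 1) * ?h y * indicator (peak \<delta> j \<eta>) y \<partial>sphere_measure)"
      if \<eta>: "\<eta> \<in> Z j" for \<eta>
    proof -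
      have "c / (2 ^ j) ^ d * ?h \<eta> \<le> measure sphere_measure (peak \<delta> j \<eta>) * ?h \<eta>"
        by (intro mult_right_mono c(2) \<eta> h0)
      also have "\<dots> = (\<integral>y. ?h \<eta> * indicator (peak \<delta> j \<eta>) y \<partial>sphere_measure)"
        by simp
      also have "\<dots> \<le> (\<integral>y. R ^ (d + 1) * ?h y * indicator (peak \<delta> j \<eta>) y \<partial>sphere_measure)"
      proof (rule integral_mono)
        show "integrable sphere_measure (\<lambda>y. ?h \<eta> * indicator (peak \<delta> j \<eta>) y)"
          by (intro integrable_mult_indicator_peak continuous_on_const)
        show "integrable sphere_measure (\<lambda>y. R ^ (d + 1) * ?h y * indicator (peak \<delta> j \<eta>) y)"
          by (intro integrable_mult_indicator_peak continuous_on_mult continuous_on_const h_cont)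
        fix y
        show "?h \<eta> * indicator (peak \<delta> j \<eta>) y \<le> R ^ (d + 1) * ?h y * indicator (peak \<delta> j \<eta>) y"
        proof (cases "y \<in> peak \<delta> j \<eta>")
          case True
          then have y: "y \<in> sphere 0 1" "\<delta> * amp d j \<le> \<bar>\<psi> j \<eta> y\<bar>" by (auto simp: peak_def)
          have "\<delta> * amp d j * (1 + 2 ^ j * norm (y - \<eta>)) \<le> \<bar>\<psi> j \<eta> y\<bar> * (1 + 2 ^ j * norm (y - \<eta>))"
            using y(2) pos[of "y - \<eta>"] by (intro mult_right_mono) auto
          also have "\<dots> \<le> C1 * amp d j"
            using C1(2)[OF \<eta> y(1)] pos[of "y - \<eta>"] by (simp add: pos_le_divide_eq)
          finally have "\<delta> * amp d j * (1 + 2 ^ j * norm (y - \<eta>)) \<le> C1 * amp d j" .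
          then have near: "1 + 2 ^ j * norm (y - \<eta>) \<le> R"
            using \<delta> amp_pos[of d j] mult_le_cancel_left_pos[of "amp d j" "\<delta> * (1 + 2 ^ j * norm (y - \<eta>))" C1]
            by (simp add: R_def pos_le_divide_eq mult_ac)
          have "1 + 2 ^ j * norm (x - y) \<le> (1 + 2 ^ j * norm (x - \<eta>)) * (1 + 2 ^ j * norm (y - \<eta>))"
            by (rule one_plus_scale_norm_triangle)
          also have "\<dots> \<le> (1 + 2 ^ j * norm (x - \<eta>)) * R"
            using near pos[of "x - \<eta>"] by (intro mult_left_mono) auto
          finally have "(1 + 2 ^ j * norm (x - y)) ^ (d + 1) \<le> ((1 + 2 ^ j * norm (x - \<eta>)) * R) ^ (d + 1)"
            using pos[of "x - y"] by (intro power_mono) auto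
          then have "?h \<eta> \<le> R ^ (d + 1) * ?h y"
            using zero_less_power[OF pos[of "x - y"], of "d + 1"] zero_less_power[OF pos[of "x - \<eta>"], of "d + 1"]
            unfolding power_mult_distrib by (simp add: field_simps del: power_Suc)
          then show ?thesis using True by simp
        qed simp
      qed
      finally show ?thesis .
    qed
    have "c / (2 ^ j) ^ d * (\<Sum>\<eta>\<in>Z j. ?h \<eta>)
      \<le> (\<Sum>\<eta>\<in>Z j. \<integral>y. R ^ (d + 1) * ?h y * indicator (peak \<delta> j \<eta>) y \<partial>sphere_measure)"
      unfolding sum_distrib_left by (intro sum_mono each)
    also have "\<dots> = (\<integral>y. (\<Sum>\<eta>\<in>Z j. R ^ (d + 1) * ?h y * indicator (peak \<delta> j \<eta>) y) \<partial>sphere_measure)"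
      by (intro Bochner_Integration.integral_sum[symmetric] integrable_mult_indicator_peak
          continuous_on_mult continuous_on_const h_cont)
    also have "\<dots> \<le> (\<integral>y. N * R ^ (d + 1) * ?h y \<partial>sphere_measure)"
    proof (rule integral_mono)
      show "integrable sphere_measure (\<lambda>y. \<Sum>\<eta>\<in>Z j. R ^ (d + 1) * ?h y * indicator (peak \<delta> j \<eta>) y)"
        by (intro Bochner_Integration.integrable_sum integrable_mult_indicator_peak
          continuous_on_mult continuous_on_const h_cont)
      show "integrable sphere_measure (\<lambda>y. N * R ^ (d + 1) * ?h y)"
        by (intro integrable_sphere_continuous continuous_on_mult continuous_on_const h_cont)
      fix y assume "y \<in> space (sphere_measure :: 'a measure)"
      then have y: "y \<in> sphere 0 1" by simp
      have "(\<Sum>\<eta>\<in>Z j. indicator (peak \<delta> j \<eta>) y) = real (card {\<eta> \<in> Z j. y \<in> peak \<delta> j \<eta>})"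
        by (simp add: indicator_def sum.If_cases Int_def)
      also have "\<dots> \<le> N" by (rule N(2)[OF y])
      finally have "(R ^ (d + 1) * ?h y) * (\<Sum>\<eta>\<in>Z j. indicator (peak \<delta> j \<eta>) y) \<le> (R ^ (d + 1) * ?h y) * N"
        using R h0 by (intro mult_left_mono) auto
      then show "(\<Sum>\<eta>\<in>Z j. R ^ (d + 1) * ?h y * indicator (peak \<delta> j \<eta>) y) \<le> N * R ^ (d + 1) * ?h y"
        unfolding sum_distrib_left by (simp only: mult_ac)
    qed
    also have "\<dots> = N * R ^ (d + 1) * (\<integral>y. ?h y \<partial>sphere_measure)"
      by (rule integral_mult_right_zero)
    also have "\<dots> \<le> N * R ^ (d + 1) * (I / (2 ^ j) ^ d)"
      using N R I(2)[OF x, of j] by (intro mult_left_mono) auto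
    finally show ?thesis using c(1) by (simp add: field_simps del: power_Suc)
  qed
  then show ?thesis using N R I c by (intro exI[of _ "N * R ^ (d + 1) * I / c"]) auto
qed

section \<open>Sums of needlets of one level\<close>

definition needlet_sum :: "nat \<Rightarrow> 'a set \<Rightarrow> 'a \<Rightarrow> real" where
  "needlet_sum j E x = (\<Sum>\<eta>\<in>E. \<psi> j \<eta> x)"

lemma continuous_on_needlet_sum: "continuous_on S (needlet_sum j E)"
proof -
  have "needlet_sum j E = (\<lambda>x. \<Sum>\<eta>\<in>E. \<psi> j \<eta> x)" by (auto simp: needlet_sum_def)
  then show ?thesis by (auto intro!: continuous_on_sum continuous_on_needlet)
qed

lemma needlet_sum_bound:
  "\<exists>C>0. \<forall>j. \<forall>E\<subseteq>Z j. \<forall>x\<in>sphere 0 1. \<bar>needlet_sum j E x\<bar> \<le> C * amp d j"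
proof -
  obtain C where C: "C > 0" "\<And>j x. x \<in> sphere 0 1 \<Longrightarrow>
      (\<Sum>\<eta>\<in>Z j. 1 / (1 + 2 ^ j * norm (x - \<eta>)) ^ (d + 1)) \<le> C"
    using decay_sum_bound by blast
  obtain C1 where C1: "C1 > 0" "\<And>j \<eta> x. \<eta> \<in> Z j \<Longrightarrow> x \<in> sphere 0 1 \<Longrightarrow>
      \<bar>\<psi> j \<eta> x\<bar> \<le> C1 * amp d j / (1 + 2 ^ j * norm (x - \<eta>)) ^ (d + 1)"
    using needlet_pointwise_bound[of "d + 1"] by blast
  have "\<bar>needlet_sum j E x\<bar> \<le> C1 * C * amp d j" if E: "E \<subseteq> Z j" and x: "x \<in> sphere 0 1" for j E x
  proof -
    have "\<bar>needlet_sum j E x\<bar> \<le> (\<Sum>\<eta>\<in>E. \<bar>\<psi> j \<eta> x\<bar>)" unfolding needlet_sum_def by (rule sum_abs)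
    also have "\<dots> \<le> (\<Sum>\<eta>\<in>Z j. \<bar>\<psi> j \<eta> x\<bar>)" using E by (intro sum_mono2) auto
    also have "\<dots> \<le> (\<Sum>\<eta>\<in>Z j. C1 * amp d j * (1 / (1 + 2 ^ j * norm (x - \<eta>)) ^ (d + 1)))"
      using C1(2)[OF _ x] by (intro sum_mono) simp
    also have "\<dots> \<le> C1 * amp d j * C"
      unfolding sum_distrib_left[symmetric] using C(2)[OF x] C1 by (intro mult_left_mono) auto
    finally show ?thesis by (simp add: mult_ac)
  qed
  then show ?thesis using C C1 by (intro exI[of _ "C1 * C"]) auto
qed

lemma integral_needlet_sum_mult:
  assumes "continuous_on UNIV h"
  shows "(\<integral>x. needlet_sum j E x * h x \<partial>sphere_measure) = (\<Sum>\<eta>\<in>E. \<integral>x. \<psi> j \<eta> x * h x \<partial>sphere_measure)"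
  unfolding needlet_sum_def sum_distrib_right
  by (intro Bochner_Integration.integral_sum integrable_sphere_continuous continuous_on_mult continuous_on_needlet assms)

lemma integral_needlet_sum:
  assumes "E \<subseteq> Z j"
  shows "(\<integral>x. needlet_sum j E x \<partial>sphere_measure) = 0"
proof -
  have "(\<integral>x. \<psi> j \<eta> x * 1 \<partial>sphere_measure) = 0" if "\<eta> \<in> E" for \<eta>
    using needlet_mean_zero[of \<eta> j] that assms by auto
  then have "(\<integral>x. needlet_sum j E x * 1 \<partial>sphere_measure) = 0"
    by (subst integral_needlet_sum_mult) (simp_all only: continuous_on_const sum.neutral_const cong: sum.cong)
  then show ?thesis by simp
qed

lemma needlet_coeff_sum_far:
  assumes "E \<subseteq> Z j" "\<eta>' \<in> Z j'" "j + 2 \<le> j' \<or> j' + 2 \<le> j"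
  shows "needlet_coeff \<psi> (needlet_sum j E) j' \<eta>' = 0"
  unfolding needlet_coeff_def integral_needlet_sum_mult[OF continuous_on_needlet]
  using needlet_orthogonal assms by (intro sum.neutral) blast

lemma needlet_coeff_sum_bound:
  "\<exists>C>0. \<forall>j j'. \<forall>E\<subseteq>Z j. \<forall>\<eta>'\<in>Z j'. j \<le> j' + 1 \<longrightarrow>
     \<bar>needlet_coeff \<psi> (needlet_sum j E) j' \<eta>'\<bar> \<le> C"
proof -
  obtain C where C: "C > 0" "\<And>j E x. E \<subseteq> Z j \<Longrightarrow> x \<in> sphere 0 1 \<Longrightarrow> \<bar>needlet_sum j E x\<bar> \<le> C * amp d j"
    using needlet_sum_bound by blast
  obtain C1 where C1: "C1 > 0" "\<And>j \<eta>. \<eta> \<in> Z j \<Longrightarrow> (\<integral>x. \<bar>\<psi> j \<eta> x\<bar> \<partial>sphere_measure) \<le> C1 / amp d j"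
    using needlet_L1_bound by blast
  have "\<bar>needlet_coeff \<psi> (needlet_sum j E) j' \<eta>'\<bar> \<le> C * C1 * 2 powr (real d / 2)"
    if E: "E \<subseteq> Z j" and \<eta>': "\<eta>' \<in> Z j'" and jj: "j \<le> j' + 1" for j j' E \<eta>'
  proof -
    have "\<bar>needlet_coeff \<psi> (needlet_sum j E) j' \<eta>'\<bar>
        \<le> (\<integral>x. \<bar>needlet_sum j E x * \<psi> j' \<eta>' x\<bar> \<partial>sphere_measure)"
      unfolding needlet_coeff_def by (rule integral_abs_bound)
    also have "\<dots> \<le> (\<integral>x. C * amp d j * \<bar>\<psi> j' \<eta>' x\<bar> \<partial>sphere_measure)"
    proof (rule integral_mono)
      show "integrable sphere_measure (\<lambda>x. \<bar>needlet_sum j E x * \<psi> j' \<eta>' x\<bar>)"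
        "integrable sphere_measure (\<lambda>x. C * amp d j * \<bar>\<psi> j' \<eta>' x\<bar>)"
        by (intro integrable_sphere_continuous continuous_intros continuous_on_needlet continuous_on_needlet_sum)+
      fix x assume "x \<in> space (sphere_measure :: 'a measure)"
      then show "\<bar>needlet_sum j E x * \<psi> j' \<eta>' x\<bar> \<le> C * amp d j * \<bar>\<psi> j' \<eta>' x\<bar>"
        unfolding abs_mult by (intro mult_right_mono C(2) E) auto
    qed
    also have "\<dots> = C * amp d j * (\<integral>x. \<bar>\<psi> j' \<eta>' x\<bar> \<partial>sphere_measure)" by simp
    also have "\<dots> \<le> C * (2 powr (real d / 2) * amp d j') * (C1 / amp d j')"
      using C(1) C1(2)[OF \<eta>'] amp_near[OF jj, of d] by (intro mult_mono) (auto intro!: mult_nonneg_nonneg)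
    finally show ?thesis by (simp add: mult_ac)
  qed
  then show ?thesis using C C1 by (intro exI[of _ "C * C1 * 2 powr (real d / 2)"]) auto
qed

text \<open>
  Of the decay of the two needlets, \<open>k\<close> factors at each centre are traded by the multiplicative
  triangle inequality for decay in the distance of the centres; \<open>d + 1\<close> further factors remain at
  \<open>\<eta>'\<close> to make the integral converge.
\<close>
lemma needlet_coeff_decay:
  "\<exists>C>0. \<forall>j j'. \<forall>\<eta>\<in>Z j. \<forall>\<eta>'\<in>Z j'. j \<le> j' + 1 \<longrightarrow> j' \<le> j + 1 \<longrightarrow>
     \<bar>needlet_coeff \<psi> (\<psi> j \<eta>) j' \<eta>'\<bar> \<le> C / (1 + 2 ^ j' * norm (\<eta> - \<eta>')) ^ k"
proof -
  obtain A where A: "A > 0" "\<And>j \<eta> x. \<eta> \<in> Z j \<Longrightarrow> x \<in> sphere 0 1 \<Longrightarrow>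
      \<bar>\<psi> j \<eta> x\<bar> \<le> A * amp d j / (1 + 2 ^ j * norm (x - \<eta>)) ^ k"
    using needlet_pointwise_bound[of k] by blast
  obtain B where B: "B > 0" "\<And>j \<eta> x. \<eta> \<in> Z j \<Longrightarrow> x \<in> sphere 0 1 \<Longrightarrow>
      \<bar>\<psi> j \<eta> x\<bar> \<le> B * amp d j / (1 + 2 ^ j * norm (x - \<eta>)) ^ (k + (d + 1))"
    using needlet_pointwise_bound[of "k + (d + 1)"] by blast
  obtain I where I: "I > 0" "\<And>x j. x \<in> sphere (0::'a) 1 \<Longrightarrow>
    (\<integral>y. 1 / (1 + 2 ^ j * norm (x - y)) ^ (d + 1) \<partial>sphere_measure) \<le> I / (2 ^ j) ^ d"
    using decay_integral_real by blast
  define K where "K = A * 2 powr (real d / 2) * 2 ^ k * B"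
  have K: "K > 0" using A B by (simp add: K_def)
  have "\<bar>needlet_coeff \<psi> (\<psi> j \<eta>) j' \<eta>'\<bar> \<le> K * I / (1 + 2 ^ j' * norm (\<eta> - \<eta>')) ^ k"
    if \<eta>: "\<eta> \<in> Z j" and \<eta>': "\<eta>' \<in> Z j'" and jj: "j \<le> j' + 1" "j' \<le> j + 1" for j j' \<eta> \<eta>'
  proof -
    let ?t = "\<lambda>z::'a. 1 + 2 ^ j' * norm z"
    note pos = one_plus_scale_norm_pos
    have "\<bar>needlet_coeff \<psi> (\<psi> j \<eta>) j' \<eta>'\<bar> \<le> (\<integral>x. \<bar>\<psi> j \<eta> x * \<psi> j' \<eta>' x\<bar> \<partial>sphere_measure)"
      unfolding needlet_coeff_def by (rule integral_abs_bound)
    also have "\<dots> \<le> (\<integral>x. K * (2 ^ j') ^ d / ?t (\<eta> - \<eta>') ^ k * (1 / ?t (\<eta>' - x) ^ (d + 1)) \<partial>sphere_measure)"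
    proof (rule integral_mono)
      show "integrable sphere_measure (\<lambda>x. \<bar>\<psi> j \<eta> x * \<psi> j' \<eta>' x\<bar>)"
        by (intro integrable_sphere_continuous continuous_intros continuous_on_needlet)
      show "integrable sphere_measure (\<lambda>x. K * (2 ^ j') ^ d / ?t (\<eta> - \<eta>') ^ k * (1 / ?t (\<eta>' - x) ^ (d + 1)))"
        by (intro integrable_sphere_continuous continuous_on_mult continuous_on_const continuous_on_decay)
      fix x assume "x \<in> space (sphere_measure :: 'a measure)"
      then have x: "x \<in> sphere 0 1" by simp
      have "(2::real) ^ j' \<le> 2 ^ (j + 1)" using jj(2) by (intro power_increasing) auto
      then have "2 ^ j' * norm (x - \<eta>) \<le> 2 ^ (j + 1) * norm (x - \<eta>)" by (intro mult_right_mono) auto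
      then have "?t (x - \<eta>) \<le> 2 * (1 + 2 ^ j * norm (x - \<eta>))" by simp
      then have "?t (x - \<eta>) ^ k \<le> (2 * (1 + 2 ^ j * norm (x - \<eta>))) ^ k"
        using pos[of j' "x - \<eta>"] by (intro power_mono) auto
      then have t1: "1 / (1 + 2 ^ j * norm (x - \<eta>)) ^ k \<le> 2 ^ k / ?t (x - \<eta>) ^ k"
        using zero_less_power[OF pos[of j' "x - \<eta>"], of k] zero_less_power[OF pos[of j "x - \<eta>"], of k]
        unfolding power_mult_distrib by (rule reciprocal_le)
      have "\<bar>\<psi> j \<eta> x\<bar> \<le> A * amp d j * (1 / (1 + 2 ^ j * norm (x - \<eta>)) ^ k)"
        using A(2)[OF \<eta> x] by simp
      also have "\<dots> \<le> A * (2 powr (real d / 2) * amp d j') * (2 ^ k / ?t (x - \<eta>) ^ k)"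
        using A(1) amp_near[OF jj(1), of d] t1 pos[of j "x - \<eta>"]
        by (intro mult_mono) (auto intro!: mult_nonneg_nonneg)
      finally have 1: "\<bar>\<psi> j \<eta> x\<bar> \<le> A * (2 powr (real d / 2) * amp d j') * (2 ^ k / ?t (x - \<eta>) ^ k)" .
      have 2: "\<bar>\<psi> j' \<eta>' x\<bar> \<le> B * amp d j' * (1 / (?t (x - \<eta>') ^ k * ?t (\<eta>' - x) ^ (d + 1)))"
        using B(2)[OF \<eta>' x] unfolding power_add[of _ k "d + 1"]
        by (simp add: norm_minus_commute[of x \<eta>'] del: power_Suc)
      have "\<bar>\<psi> j \<eta> x * \<psi> j' \<eta>' x\<bar> \<le> (A * (2 powr (real d / 2) * amp d j') * (2 ^ k / ?t (x - \<eta>) ^ k)) *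
          (B * amp d j' * (1 / (?t (x - \<eta>') ^ k * ?t (\<eta>' - x) ^ (d + 1))))"
        unfolding abs_mult using 1 2 by (intro mult_mono) auto
      also have "\<dots> = K * (2 ^ j') ^ d * (1 / ?t (\<eta>' - x) ^ (d + 1)) * (1 / (?t (x - \<eta>) * ?t (x - \<eta>')) ^ k)"
        by (simp add: K_def amp_square[symmetric] power_mult_distrib mult_ac)
      also have "\<dots> \<le> K * (2 ^ j') ^ d * (1 / ?t (\<eta>' - x) ^ (d + 1)) * (1 / ?t (\<eta> - \<eta>') ^ k)"
      proof -
        have "?t (\<eta> - \<eta>') \<le> ?t (x - \<eta>) * ?t (x - \<eta>')"
          using one_plus_scale_norm_triangle[of j' \<eta> \<eta>' x] by (simp add: norm_minus_commute)
        then have "?t (\<eta> - \<eta>') ^ k \<le> (?t (x - \<eta>) * ?t (x - \<eta>')) ^ k"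
          using pos[of j' "\<eta> - \<eta>'"] by (intro power_mono) auto
        then have "1 / (?t (x - \<eta>) * ?t (x - \<eta>')) ^ k \<le> 1 / ?t (\<eta> - \<eta>') ^ k"
          using zero_less_power[OF pos[of j' "\<eta> - \<eta>'"], of k] by (intro divide_left_mono) (auto intro!: mult_pos_pos)
        then show ?thesis using K pos[of j' "\<eta>' - x"] by (intro mult_left_mono) auto
      qed
      finally show "\<bar>\<psi> j \<eta> x * \<psi> j' \<eta>' x\<bar> \<le> K * (2 ^ j') ^ d / ?t (\<eta> - \<eta>') ^ k * (1 / ?t (\<eta>' - x) ^ (d + 1))"
        by (simp add: mult_ac)
    qed
    also have "\<dots> = K * (2 ^ j') ^ d / ?t (\<eta> - \<eta>') ^ k * (\<integral>x. 1 / ?t (\<eta>' - x) ^ (d + 1) \<partial>sphere_measure)"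
      by (rule integral_mult_right_zero)
    also have "\<dots> \<le> K * (2 ^ j') ^ d / ?t (\<eta> - \<eta>') ^ k * (I / (2 ^ j') ^ d)"
      using I(2)[OF Z_sphere[OF \<eta>'], of j'] K pos[of j' "\<eta> - \<eta>'"] by (intro mult_left_mono) auto
    finally show ?thesis by simp
  qed
  then show ?thesis using K I by (intro exI[of _ "K * I"]) auto
qed

lemma needlet_coeff_powr_sum_bound:
  assumes \<rho>: "\<rho> > 0"
  shows "\<exists>C>0. \<forall>j j'. \<forall>\<eta>\<in>Z j. j \<le> j' + 1 \<longrightarrow> j' \<le> j + 1 \<longrightarrow>
     (\<Sum>\<eta>'\<in>Z j'. \<bar>needlet_coeff \<psi> (\<psi> j \<eta>) j' \<eta>'\<bar> powr \<rho>) \<le> C"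
proof -
  (* a decay of order k, raised to the power \<open>\<rho>\<close>, is still summable over the cubature points *)
  define k where "k = nat \<lceil>real (d + 1) / \<rho>\<rceil>"
  have "real (d + 1) / \<rho> \<le> real k" using \<rho> unfolding k_def by (simp add: of_nat_ceiling)
  then have k: "real (d + 1) \<le> real k * \<rho>" using \<rho> by (simp add: field_simps)
  obtain C where C: "C > 0" "\<And>j j' \<eta> \<eta>'. \<eta> \<in> Z j \<Longrightarrow> \<eta>' \<in> Z j' \<Longrightarrow> j \<le> j' + 1 \<Longrightarrow> j' \<le> j + 1 \<Longrightarrow>
     \<bar>needlet_coeff \<psi> (\<psi> j \<eta>) j' \<eta>'\<bar> \<le> C / (1 + 2 ^ j' * norm (\<eta> - \<eta>')) ^ k"
    using needlet_coeff_decay[of k] by blast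
  obtain S where S: "S > 0" "\<And>j x. x \<in> sphere 0 1 \<Longrightarrow>
      (\<Sum>\<eta>\<in>Z j. 1 / (1 + 2 ^ j * norm (x - \<eta>)) ^ (d + 1)) \<le> S"
    using decay_sum_bound by blast
  have "(\<Sum>\<eta>'\<in>Z j'. \<bar>needlet_coeff \<psi> (\<psi> j \<eta>) j' \<eta>'\<bar> powr \<rho>) \<le> C powr \<rho> * S"
    if \<eta>: "\<eta> \<in> Z j" and jj: "j \<le> j' + 1" "j' \<le> j + 1" for j j' \<eta>
  proof -
    have "(\<Sum>\<eta>'\<in>Z j'. \<bar>needlet_coeff \<psi> (\<psi> j \<eta>) j' \<eta>'\<bar> powr \<rho>)
       \<le> (\<Sum>\<eta>'\<in>Z j'. C powr \<rho> * (1 / (1 + 2 ^ j' * norm (\<eta> - \<eta>')) ^ (d + 1)))"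
    proof (rule sum_mono)
      fix \<eta>' assume \<eta>': "\<eta>' \<in> Z j'"
      define t where "t = 1 + 2 ^ j' * norm (\<eta> - \<eta>')"
      have t: "t \<ge> 1" by (simp add: t_def)
      have "\<bar>needlet_coeff \<psi> (\<psi> j \<eta>) j' \<eta>'\<bar> powr \<rho> \<le> (C / t ^ k) powr \<rho>"
        using C(2)[OF \<eta> \<eta>' jj] \<rho> by (intro powr_mono2) (auto simp: t_def)
      also have "\<dots> = C powr \<rho> / t powr (real k * \<rho>)"
        using t C(1) by (simp add: powr_divide powr_realpow[symmetric] powr_powr)
      also have "\<dots> \<le> C powr \<rho> / t powr real (d + 1)"
        using t k by (intro divide_left_mono powr_mono) auto
      also have "\<dots> = C powr \<rho> * (1 / t ^ (d + 1))"
        using t by (subst powr_realpow) auto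
      finally show "\<bar>needlet_coeff \<psi> (\<psi> j \<eta>) j' \<eta>'\<bar> powr \<rho>
         \<le> C powr \<rho> * (1 / (1 + 2 ^ j' * norm (\<eta> - \<eta>')) ^ (d + 1))" by (simp add: t_def)
    qed
    also have "\<dots> \<le> C powr \<rho> * S"
      unfolding sum_distrib_left[symmetric] using S(2)[OF Z_sphere[OF \<eta>]] by (intro mult_left_mono) auto
    finally show ?thesis .
  qed
  then show ?thesis using C S by (intro exI[of _ "C powr \<rho> * S"]) auto
qed

end

section \<open>Besov norms of sums of needlets\<close>

lemma enn_powr_mono: "x \<le> y \<Longrightarrow> 0 < a \<Longrightarrow> enn_powr x a \<le> enn_powr y a"
  by (auto simp: enn_powr_def top_unique less_top intro!: ennreal_leI powr_mono2 enn2real_mono)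

lemma enn_powr_ennreal: "0 \<le> x \<Longrightarrow> enn_powr (ennreal x) a = ennreal (x powr a)"
  by (simp add: enn_powr_def)

lemma enn_powr_0 [simp]: "enn_powr 0 a = 0"
  by (simp add: enn_powr_def)

lemma recip_top [simp]: "recip top = 0"
  by (simp add: recip_def)

lemma recip_finite:
  assumes "0 < r" "r \<noteq> \<infinity>"
  shows "enn2real r > 0" "recip r = 1 / enn2real r"
proof -
  obtain \<rho> where \<rho>: "r = ennreal \<rho>" "\<rho> \<ge> 0" using assms(2) by (cases r) auto
  then have "\<rho> > 0" using assms(1) by auto
  then show "enn2real r > 0" "recip r = 1 / enn2real r"
    using \<rho> by (auto simp: recip_def inverse_ennreal inverse_eq_divide)
qed

lemma recip_nonneg: "recip r \<ge> 0"
  by (simp add: recip_def)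

lemma seq_norm_cong:
  assumes "\<And>i. i \<in> I \<Longrightarrow> f i = g i"
  shows "seq_norm r I f = seq_norm r I g"
proof -
  have "esssup (count_space I) f = esssup (count_space I) g"
    using assms by (intro esssup_AE_cong AE_I2) auto
  moreover have "(\<integral>\<^sup>+ i. enn_powr (f i) a \<partial>count_space I) = (\<integral>\<^sup>+ i. enn_powr (g i) a \<partial>count_space I)" for a
    using assms by (intro nn_integral_cong) auto
  ultimately show ?thesis unfolding seq_norm_def eLp_norm_def by simp
qed

lemma seq_norm_le_of_powr_sum:
  assumes "0 < r" "r \<noteq> \<infinity>" and "finite J" "J \<subseteq> I"
    and J: "\<And>i. i \<in> J \<Longrightarrow> b i \<le> ennreal (x i)" "\<And>i. i \<in> J \<Longrightarrow> x i \<ge> 0"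
    and off: "\<And>i. i \<in> I - J \<Longrightarrow> b i = 0"
  shows "seq_norm r I b \<le> ennreal ((\<Sum>i\<in>J. x i powr enn2real r) powr recip r)"
proof -
  note r = recip_finite[OF assms(1,2)]
  have "(\<integral>\<^sup>+ i. enn_powr (b i) (enn2real r) \<partial>count_space I)
    \<le> (\<integral>\<^sup>+ i. ennreal (if i \<in> J then x i powr enn2real r else 0) \<partial>count_space I)"
  proof (rule nn_integral_mono)
    fix i assume "i \<in> space (count_space I)"
    then show "enn_powr (b i) (enn2real r) \<le> ennreal (if i \<in> J then x i powr enn2real r else 0)"
      using off[of i] J[of i] enn_powr_mono[OF J(1) r(1), of i] by (auto simp: enn_powr_ennreal)
  qed
  also have "\<dots> = (\<Sum>i\<in>J. ennreal (if i \<in> J then x i powr enn2real r else 0))"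
    using assms(3,4) by (intro nn_integral_count_space') auto
  also have "\<dots> = ennreal (\<Sum>i\<in>J. x i powr enn2real r)"
    by (subst sum_ennreal[symmetric]) auto
  finally have *: "(\<integral>\<^sup>+ i. enn_powr (b i) (enn2real r) \<partial>count_space I) \<le> ennreal (\<Sum>i\<in>J. x i powr enn2real r)" .
  have "seq_norm r I b \<le> enn_powr (ennreal (\<Sum>i\<in>J. x i powr enn2real r)) (1 / enn2real r)"
    unfolding seq_norm_def eLp_norm_def using assms(2) enn_powr_mono[OF *, of "1 / enn2real r"] r(1) by simp
  also have "\<dots> = ennreal ((\<Sum>i\<in>J. x i powr enn2real r) powr recip r)"
    using r by (simp add: enn_powr_ennreal sum_nonneg)
  finally show ?thesis .
qed

lemma seq_norm_le_of_bound:
  assumes r: "0 < r" and J: "finite J" "J \<subseteq> I" "real (card J) \<le> N" and N: "1 \<le> N" and K: "K \<ge> 0"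
    and b: "\<And>i. i \<in> J \<Longrightarrow> b i \<le> ennreal K" and off: "\<And>i. i \<in> I - J \<Longrightarrow> b i = 0"
  shows "seq_norm r I b \<le> ennreal (K * N powr recip r)"
proof (cases "r = \<infinity>")
  case True
  have "b i \<le> ennreal K" if "i \<in> I" for i using b[of i] off[of i] that by (cases "i \<in> J") auto
  then have "seq_norm r I b \<le> ennreal K"
    unfolding seq_norm_def eLp_norm_def using True by (auto intro!: esssup_I AE_I2)
  then show ?thesis using True N by simp
next
  case False
  note r' = recip_finite[OF r False]
  have "seq_norm r I b \<le> ennreal ((\<Sum>i\<in>J. K powr enn2real r) powr recip r)"
    using r False J b K off by (intro seq_norm_le_of_powr_sum) auto
  also have "\<dots> \<le> ennreal (K * N powr recip r)"
  proof (rule ennreal_leI)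
    have "(\<Sum>i\<in>J. K powr enn2real r) powr recip r \<le> (N * K powr enn2real r) powr recip r"
      using J(3) recip_nonneg by (intro powr_mono2) (auto intro!: mult_right_mono)
    also have "\<dots> = K * N powr recip r"
      using r' K N by (simp add: powr_mult powr_powr)
    finally show "(\<Sum>i\<in>J. K powr enn2real r) powr recip r \<le> K * N powr recip r" .
  qed
  finally show ?thesis .
qed

context needlet_frame
begin

lemma needlet_coeff_affine:
  assumes "\<eta>' \<in> Z j'"
  shows "needlet_coeff \<psi> (\<lambda>x. a + \<gamma> * needlet_sum j E x) j' \<eta>' = \<gamma> * needlet_coeff \<psi> (needlet_sum j E) j' \<eta>'"
proof -
  have "needlet_coeff \<psi> (\<lambda>x. a + \<gamma> * needlet_sum j E x) j' \<eta>'
      = (\<integral>x. a * \<psi> j' \<eta>' x + \<gamma> * (needlet_sum j E x * \<psi> j' \<eta>' x) \<partial>sphere_measure)"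
    by (simp add: needlet_coeff_def algebra_simps)
  also have "\<dots> = (\<integral>x. a * \<psi> j' \<eta>' x \<partial>sphere_measure) + (\<integral>x. \<gamma> * (needlet_sum j E x * \<psi> j' \<eta>' x) \<partial>sphere_measure)"
    by (intro Bochner_Integration.integral_add integrable_sphere_continuous continuous_on_mult
        continuous_on_const continuous_on_needlet continuous_on_needlet_sum)
  also have "\<dots> = \<gamma> * needlet_coeff \<psi> (needlet_sum j E) j' \<eta>'"
    using needlet_mean_zero[OF assms] by (simp add: needlet_coeff_def)
  finally show ?thesis .
qed

text \<open>
  Only the levels \<open>j - 1\<close>, \<open>j\<close> and \<open>j + 1\<close> contribute, whence the factor \<open>3\<close> to the power \<open>1/q\<close>.
\<close>
lemma besov_norm_le_near_levels:
  assumes q: "q > 0" and E: "E \<subseteq> Z j" and K: "K \<ge> 0"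
    and near: "\<And>j'. j \<le> j' + 1 \<Longrightarrow> j' \<le> j + 1 \<Longrightarrow>
      ennreal (2 powr (real j' * (s + real d * (1/2 - recip r)))) *
        seq_norm r (Z j') (\<lambda>\<eta>'. ennreal \<bar>\<gamma> * needlet_coeff \<psi> (needlet_sum j E) j' \<eta>'\<bar>) \<le> ennreal K"
    and r: "r > 0"
  shows "besov_norm d Z \<psi> s r q (\<lambda>x. a + \<gamma> * needlet_sum j E x) \<le> ennreal (K * 3 powr recip q)"
  unfolding besov_norm_def
proof (rule seq_norm_le_of_bound[where J="{j'. j \<le> j' + 1 \<and> j' \<le> j + 1}"])
  let ?J = "{j'. j \<le> j' + 1 \<and> j' \<le> j + 1}"
  have sub: "?J \<subseteq> {j - 1..j + 1}" by auto
  then show "finite ?J" by (rule finite_subset) simp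
  have "card ?J \<le> card {j - 1..j + 1}" using sub by (intro card_mono) auto
  then show "real (card ?J) \<le> 3" by simp
  have cong: "seq_norm r (Z j') (\<lambda>\<eta>. ennreal \<bar>needlet_coeff \<psi> (\<lambda>x. a + \<gamma> * needlet_sum j E x) j' \<eta>\<bar>)
     = seq_norm r (Z j') (\<lambda>\<eta>'. ennreal \<bar>\<gamma> * needlet_coeff \<psi> (needlet_sum j E) j' \<eta>'\<bar>)" for j'
    by (rule seq_norm_cong) (simp add: needlet_coeff_affine)
  show "ennreal (2 powr (real j' * (s + real d * (1/2 - recip r)))) *
      seq_norm r (Z j') (\<lambda>\<eta>. ennreal \<bar>needlet_coeff \<psi> (\<lambda>x. a + \<gamma> * needlet_sum j E x) j' \<eta>\<bar>) \<le> ennreal K"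
    if "j' \<in> ?J" for j'
    unfolding cong using that near by auto
  show "ennreal (2 powr (real j' * (s + real d * (1/2 - recip r)))) *
      seq_norm r (Z j') (\<lambda>\<eta>. ennreal \<bar>needlet_coeff \<psi> (\<lambda>x. a + \<gamma> * needlet_sum j E x) j' \<eta>\<bar>) = 0"
    if "j' \<in> UNIV - ?J" for j'
  proof -
    have "needlet_coeff \<psi> (needlet_sum j E) j' \<eta>' = 0" if "\<eta>' \<in> Z j'" for \<eta>'
      using needlet_coeff_sum_far[OF E that] \<open>j' \<in> UNIV - ?J\<close> by auto
    then have "seq_norm r (Z j') (\<lambda>\<eta>'. ennreal \<bar>\<gamma> * needlet_coeff \<psi> (needlet_sum j E) j' \<eta>'\<bar>) \<le> ennreal (0 * 1 powr recip r)"
      using r by (intro seq_norm_le_of_bound[where J="{}"]) auto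
    then show ?thesis unfolding cong by simp
  qed
qed (use q K in auto)

lemma cubature_card_bounds:
  "\<exists>c\<ge>1. \<forall>j. inverse c * (2 ^ j) ^ d \<le> real (card (Z j)) \<and> real (card (Z j)) \<le> c * (2 ^ j) ^ d"
proof -
  obtain c where c: "c > 0" "\<And>j. inverse c * 2 ^ (d * j) \<le> real (card (Z j))" "\<And>j. real (card (Z j)) \<le> c * 2 ^ (d * j)"
    using cubature by (auto simp: needlet_cubature_def)
  have e: "(2::real) ^ (d * j) = (2 ^ j) ^ d" for j by (simp add: power_mult[symmetric] mult.commute)
  have "inverse (max c 1) * (2 ^ j) ^ d \<le> real (card (Z j)) \<and> real (card (Z j)) \<le> max c 1 * (2 ^ j) ^ d" for j
  proof
    have "inverse (max c 1) * (2 ^ j) ^ d \<le> inverse c * (2 ^ j) ^ d" using c(1) by (intro mult_right_mono le_imp_inverse_le) auto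
    also have "\<dots> \<le> real (card (Z j))" using c(2)[of j] unfolding e .
    finally show "inverse (max c 1) * (2 ^ j) ^ d \<le> real (card (Z j))" .
    have "c * (2 ^ j) ^ d \<le> max c 1 * (2 ^ j) ^ d" by (intro mult_right_mono) auto
    with c(3)[of j] show "real (card (Z j)) \<le> max c 1 * (2 ^ j) ^ d" unfolding e by linarith
  qed
  then show ?thesis by (intro exI[of _ "max c 1"]) auto
qed

lemma Z_nonempty: "Z j \<noteq> {}"
proof -
  obtain c where "c \<ge> 1" "inverse c * (2 ^ j) ^ d \<le> real (card (Z j))" using cubature_card_bounds by blast
  moreover from this have "0 < inverse c * (2 ^ j) ^ d" by simp
  ultimately have "real (card (Z j)) > 0" by linarith
  then show ?thesis by auto
qed

lemma powr_level_le:
  assumes "j' \<le> j + 1" "\<tau> \<ge> 0"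
  shows "2 powr (real j' * \<tau>) \<le> 2 powr \<tau> * 2 powr (real j * \<tau>)"
proof -
  have "real j' * \<tau> \<le> (real j + 1) * \<tau>" using assms by (intro mult_right_mono) auto
  then show ?thesis by (simp add: powr_add[symmetric] algebra_simps)
qed

text \<open>
  All coefficients at a neighbouring level are bounded by a multiple of \<open>\<gamma>\<close>, and there are about
  \<open>2\<^bsup>jd\<^esup>\<close> of them: the \<open>\<ell>\<^sub>r\<close> norm costs \<open>2\<^bsup>jd/r\<^esup>\<close>, which cancels the dependence of the
  Besov weight on \<open>r\<close>.
\<close>
lemma besov_norm_dense:
  assumes s: "s > 0" and r: "r > 0" and q: "q > 0"
  shows "\<exists>C>0. \<forall>a. \<forall>\<gamma>\<ge>0. \<forall>j. \<forall>E\<subseteq>Z j.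
    besov_norm d Z \<psi> s r q (\<lambda>x. a + \<gamma> * needlet_sum j E x)
      \<le> ennreal (C * (\<gamma> * 2 powr (real j * (s + real d / 2))))"
proof -
  obtain c where c: "c \<ge> 1" "\<And>j. real (card (Z j)) \<le> c * (2 ^ j) ^ d" using cubature_card_bounds by blast
  obtain C where "C > 0" and "\<forall>j j'. \<forall>E\<subseteq>Z j. \<forall>\<eta>'\<in>Z j'. j \<le> j' + 1 \<longrightarrow>
     \<bar>needlet_coeff \<psi> (needlet_sum j E) j' \<eta>'\<bar> \<le> C" using needlet_coeff_sum_bound by blast
  then have C: "C > 0" "\<And>j j' E \<eta>'. E \<subseteq> Z j \<Longrightarrow> \<eta>' \<in> Z j' \<Longrightarrow> j \<le> j' + 1 \<Longrightarrow>
     \<bar>needlet_coeff \<psi> (needlet_sum j E) j' \<eta>'\<bar> \<le> C" by simp_all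
  define D where "D = 2 powr (s + real d / 2) * C * c powr recip r"
  have D: "D > 0" using C c by (simp add: D_def)
  have "besov_norm d Z \<psi> s r q (\<lambda>x. a + \<gamma> * needlet_sum j E x)
      \<le> ennreal ((D * (\<gamma> * 2 powr (real j * (s + real d / 2)))) * 3 powr recip q)"
    if \<gamma>: "\<gamma> \<ge> 0" and E: "E \<subseteq> Z j" for a \<gamma> j E
  proof (rule besov_norm_le_near_levels[OF q E _ _ r])
    show "0 \<le> D * (\<gamma> * 2 powr (real j * (s + real d / 2)))" using D \<gamma> by simp
    fix j' assume jj: "j \<le> j' + 1" "j' \<le> j + 1"
    have "seq_norm r (Z j') (\<lambda>\<eta>'. ennreal \<bar>\<gamma> * needlet_coeff \<psi> (needlet_sum j E) j' \<eta>'\<bar>)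
      \<le> ennreal (\<gamma> * C * (c * (2 ^ j') ^ d) powr recip r)"
    proof (rule seq_norm_le_of_bound[where J="Z j'"])
      show "1 \<le> c * (2 ^ j') ^ d" using c(1) mult_mono[of 1 c 1 "(2 ^ j') ^ d"] by simp
      show "ennreal \<bar>\<gamma> * needlet_coeff \<psi> (needlet_sum j E) j' \<eta>'\<bar> \<le> ennreal (\<gamma> * C)" if "\<eta>' \<in> Z j'" for \<eta>'
        using C(2)[OF E that jj(1)] \<gamma> by (auto simp: abs_mult intro!: ennreal_leI mult_left_mono)
    qed (use r c C \<gamma> in auto)
    then have "ennreal (2 powr (real j' * (s + real d * (1/2 - recip r)))) *
        seq_norm r (Z j') (\<lambda>\<eta>'. ennreal \<bar>\<gamma> * needlet_coeff \<psi> (needlet_sum j E) j' \<eta>'\<bar>)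
      \<le> ennreal (2 powr (real j' * (s + real d * (1/2 - recip r)))) * ennreal (\<gamma> * C * (c * (2 ^ j') ^ d) powr recip r)"
      by (rule mult_left_mono) simp
    also have "\<dots> = ennreal (2 powr (real j' * (s + real d * (1/2 - recip r))) * (\<gamma> * C * (c * (2 ^ j') ^ d) powr recip r))"
      using \<gamma> C by (intro ennreal_mult[symmetric]) auto
    also have "\<dots> \<le> ennreal (D * (\<gamma> * 2 powr (real j * (s + real d / 2))))"
    proof (rule ennreal_leI)
      have "((2::real) ^ j') ^ d = 2 powr (real j' * real d)"
        by (simp add: powr_realpow[symmetric] powr_powr)
      then have "(c * (2 ^ j') ^ d) powr recip r = c powr recip r * 2 powr (real j' * real d * recip r)"
        using c(1) by (simp add: powr_mult powr_powr)
      then have "2 powr (real j' * (s + real d * (1/2 - recip r))) * (\<gamma> * C * (c * (2 ^ j') ^ d) powr recip r)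
        = \<gamma> * C * c powr recip r * (2 powr (real j' * (s + real d * (1/2 - recip r))) * 2 powr (real j' * real d * recip r))"
        by (simp add: mult_ac)
      also have "\<dots> = \<gamma> * C * c powr recip r * 2 powr (real j' * (s + real d / 2))"
        by (simp add: powr_add[symmetric] algebra_simps)
      also have "\<dots> \<le> \<gamma> * C * c powr recip r * (2 powr (s + real d / 2) * 2 powr (real j * (s + real d / 2)))"
        using powr_level_le[OF jj(2), of "s + real d / 2"] s \<gamma> C c by (intro mult_left_mono) auto
      finally show "2 powr (real j' * (s + real d * (1/2 - recip r))) * (\<gamma> * C * (c * (2 ^ j') ^ d) powr recip r)
         \<le> D * (\<gamma> * 2 powr (real j * (s + real d / 2)))" by (simp add: D_def mult_ac)
    qed
    finally show "ennreal (2 powr (real j' * (s + real d * (1/2 - recip r)))) *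
        seq_norm r (Z j') (\<lambda>\<eta>'. ennreal \<bar>\<gamma> * needlet_coeff \<psi> (needlet_sum j E) j' \<eta>'\<bar>)
      \<le> ennreal (D * (\<gamma> * 2 powr (real j * (s + real d / 2))))" .
  qed
  note main = this
  show ?thesis
  proof (intro exI[of _ "D * 3 powr recip q"] conjI allI impI)
    show "D * 3 powr recip q > 0" using D by simp
    fix a \<gamma> :: real and j E assume "0 \<le> \<gamma>" "E \<subseteq> Z j"
    from main[OF this, of a] show "besov_norm d Z \<psi> s r q (\<lambda>x. a + \<gamma> * needlet_sum j E x)
      \<le> ennreal ((D * 3 powr recip q) * (\<gamma> * 2 powr (real j * (s + real d / 2))))"
      by (simp add: mult_ac)
  qed
qed

lemma needlet_sum_singleton: "needlet_sum j {\<eta>} = \<psi> j \<eta>"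
  by (auto simp: needlet_sum_def)

lemma seq_norm_single_needlet:
  assumes r: "r > 0"
  shows "\<exists>C>0. \<forall>\<gamma>\<ge>0. \<forall>j j'. \<forall>\<eta>\<in>Z j. j \<le> j' + 1 \<longrightarrow> j' \<le> j + 1 \<longrightarrow>
     seq_norm r (Z j') (\<lambda>\<eta>'. ennreal \<bar>\<gamma> * needlet_coeff \<psi> (\<psi> j \<eta>) j' \<eta>'\<bar>) \<le> ennreal (C * \<gamma>)"
proof (cases "r = \<infinity>")
  case True
  obtain C where "C > 0" and "\<forall>j j'. \<forall>E\<subseteq>Z j. \<forall>\<eta>'\<in>Z j'. j \<le> j' + 1 \<longrightarrow>
     \<bar>needlet_coeff \<psi> (needlet_sum j E) j' \<eta>'\<bar> \<le> C" using needlet_coeff_sum_bound by blast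
  then have C: "C > 0" "\<And>j j' E \<eta>'. E \<subseteq> Z j \<Longrightarrow> \<eta>' \<in> Z j' \<Longrightarrow> j \<le> j' + 1 \<Longrightarrow>
     \<bar>needlet_coeff \<psi> (needlet_sum j E) j' \<eta>'\<bar> \<le> C" by simp_all
  have "seq_norm r (Z j') (\<lambda>\<eta>'. ennreal \<bar>\<gamma> * needlet_coeff \<psi> (\<psi> j \<eta>) j' \<eta>'\<bar>) \<le> ennreal (C * \<gamma>)"
    if \<gamma>: "\<gamma> \<ge> 0" and \<eta>: "\<eta> \<in> Z j" and jj: "j \<le> j' + 1" "j' \<le> j + 1" for \<gamma> j j' \<eta>
  proof -
    have "ennreal \<bar>\<gamma> * needlet_coeff \<psi> (\<psi> j \<eta>) j' \<eta>'\<bar> \<le> ennreal (C * \<gamma>)" if "\<eta>' \<in> Z j'" for \<eta>'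
      using C(2)[of "{\<eta>}" j \<eta>' j'] \<eta> that jj \<gamma>
      by (auto simp: abs_mult needlet_sum_singleton mult.commute[of \<gamma>] intro!: ennreal_leI mult_right_mono)
    then show ?thesis
      unfolding seq_norm_def eLp_norm_def using True by (auto intro!: esssup_I AE_I2)
  qed
  then show ?thesis using C(1) by blast
next
  case False
  note r' = recip_finite[OF r False]
  obtain C where C: "C > 0" "\<And>j j' \<eta>. \<eta> \<in> Z j \<Longrightarrow> j \<le> j' + 1 \<Longrightarrow> j' \<le> j + 1 \<Longrightarrow>
     (\<Sum>\<eta>'\<in>Z j'. \<bar>needlet_coeff \<psi> (\<psi> j \<eta>) j' \<eta>'\<bar> powr enn2real r) \<le> C"
    using needlet_coeff_powr_sum_bound[OF r'(1)] by blast
  have "seq_norm r (Z j') (\<lambda>\<eta>'. ennreal \<bar>\<gamma> * needlet_coeff \<psi> (\<psi> j \<eta>) j' \<eta>'\<bar>) \<le> ennreal (C powr recip r * \<gamma>)"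
    if \<gamma>: "\<gamma> \<ge> 0" and \<eta>: "\<eta> \<in> Z j" and jj: "j \<le> j' + 1" "j' \<le> j + 1" for \<gamma> j j' \<eta>
  proof -
    have "seq_norm r (Z j') (\<lambda>\<eta>'. ennreal \<bar>\<gamma> * needlet_coeff \<psi> (\<psi> j \<eta>) j' \<eta>'\<bar>)
      \<le> ennreal ((\<Sum>\<eta>'\<in>Z j'. \<bar>\<gamma> * needlet_coeff \<psi> (\<psi> j \<eta>) j' \<eta>'\<bar> powr enn2real r) powr recip r)"
      using r False by (intro seq_norm_le_of_powr_sum) auto
    also have "(\<Sum>\<eta>'\<in>Z j'. \<bar>\<gamma> * needlet_coeff \<psi> (\<psi> j \<eta>) j' \<eta>'\<bar> powr enn2real r)
      = \<gamma> powr enn2real r * (\<Sum>\<eta>'\<in>Z j'. \<bar>needlet_coeff \<psi> (\<psi> j \<eta>) j' \<eta>'\<bar> powr enn2real r)"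
      using \<gamma> by (simp add: abs_mult powr_mult sum_distrib_left)
    also have "ennreal (\<dots> powr recip r) \<le> ennreal ((\<gamma> powr enn2real r * C) powr recip r)"
      using C(2)[OF \<eta> jj] recip_nonneg
      by (intro ennreal_leI powr_mono2 mult_left_mono mult_nonneg_nonneg sum_nonneg) auto
    also have "(\<gamma> powr enn2real r * C) powr recip r = C powr recip r * \<gamma>"
      using \<gamma> C r' by (simp add: powr_mult powr_powr)
    finally show ?thesis .
  qed
  then show ?thesis using C(1) by (intro exI[of _ "C powr recip r"]) auto
qed

text \<open>
  For a single needlet the \<open>\<ell>\<^sub>r\<close> norm of the coefficients at a neighbouring level is bounded by a
  multiple of \<open>\<gamma>\<close> for every \<open>r\<close>, and the Besov weight keeps its gain \<open>2\<^bsup>-jd/r\<^esup>\<close>.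
\<close>
lemma besov_norm_sparse:
  assumes r: "r > 0" and q: "q > 0" and \<alpha>: "s + real d * (1/2 - recip r) \<ge> 0"
  shows "\<exists>C>0. \<forall>a. \<forall>\<gamma>\<ge>0. \<forall>j. \<forall>\<eta>\<in>Z j. \<forall>E\<subseteq>{\<eta>}.
    besov_norm d Z \<psi> s r q (\<lambda>x. a + \<gamma> * needlet_sum j E x)
      \<le> ennreal (C * (\<gamma> * 2 powr (real j * (s + real d * (1/2 - recip r)))))"
proof -
  let ?\<alpha> = "s + real d * (1/2 - recip r)"
  obtain C where "C > 0" and "\<forall>\<gamma>\<ge>0. \<forall>j j'. \<forall>\<eta>\<in>Z j. j \<le> j' + 1 \<longrightarrow> j' \<le> j + 1 \<longrightarrow>
     seq_norm r (Z j') (\<lambda>\<eta>'. ennreal \<bar>\<gamma> * needlet_coeff \<psi> (\<psi> j \<eta>) j' \<eta>'\<bar>) \<le> ennreal (C * \<gamma>)"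
    using seq_norm_single_needlet[OF r] by blast
  then have C: "C > 0" "\<And>\<gamma> j j' \<eta>. \<gamma> \<ge> 0 \<Longrightarrow> \<eta> \<in> Z j \<Longrightarrow> j \<le> j' + 1 \<Longrightarrow> j' \<le> j + 1 \<Longrightarrow>
     seq_norm r (Z j') (\<lambda>\<eta>'. ennreal \<bar>\<gamma> * needlet_coeff \<psi> (\<psi> j \<eta>) j' \<eta>'\<bar>) \<le> ennreal (C * \<gamma>)"
    by simp_all
  define D where "D = 2 powr ?\<alpha> * C"
  have D: "D > 0" using C by (simp add: D_def)
  have single: "besov_norm d Z \<psi> s r q (\<lambda>x. a + \<gamma> * needlet_sum j {\<eta>} x)
      \<le> ennreal ((D * (\<gamma> * 2 powr (real j * ?\<alpha>))) * 3 powr recip q)"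
    if \<gamma>: "\<gamma> \<ge> 0" and \<eta>: "\<eta> \<in> Z j" for a \<gamma> j \<eta>
  proof (rule besov_norm_le_near_levels[OF q _ _ _ r])
    show "0 \<le> D * (\<gamma> * 2 powr (real j * ?\<alpha>))" using D \<gamma> by simp
    show "{\<eta>} \<subseteq> Z j" using \<eta> by simp
    fix j' assume jj: "j \<le> j' + 1" "j' \<le> j + 1"
    have "ennreal (2 powr (real j' * ?\<alpha>)) *
        seq_norm r (Z j') (\<lambda>\<eta>'. ennreal \<bar>\<gamma> * needlet_coeff \<psi> (needlet_sum j {\<eta>}) j' \<eta>'\<bar>)
      \<le> ennreal (2 powr (real j' * ?\<alpha>)) * ennreal (C * \<gamma>)"
      unfolding needlet_sum_singleton using C(2)[OF \<gamma> \<eta> jj] by (rule mult_left_mono) simp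
    also have "\<dots> = ennreal (2 powr (real j' * ?\<alpha>) * (C * \<gamma>))"
      using C \<gamma> by (intro ennreal_mult[symmetric]) auto
    also have "\<dots> \<le> ennreal (D * (\<gamma> * 2 powr (real j * ?\<alpha>)))"
    proof (rule ennreal_leI)
      have "2 powr (real j' * ?\<alpha>) * (C * \<gamma>) \<le> (2 powr ?\<alpha> * 2 powr (real j * ?\<alpha>)) * (C * \<gamma>)"
        using powr_level_le[OF jj(2) \<alpha>] C \<gamma> by (intro mult_right_mono) auto
      then show "2 powr (real j' * ?\<alpha>) * (C * \<gamma>) \<le> D * (\<gamma> * 2 powr (real j * ?\<alpha>))"
        by (simp add: D_def mult_ac)
    qed
    finally show "ennreal (2 powr (real j' * ?\<alpha>)) *
        seq_norm r (Z j') (\<lambda>\<eta>'. ennreal \<bar>\<gamma> * needlet_coeff \<psi> (needlet_sum j {\<eta>}) j' \<eta>'\<bar>)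
      \<le> ennreal (D * (\<gamma> * 2 powr (real j * ?\<alpha>)))" .
  qed
  have "besov_norm d Z \<psi> s r q (\<lambda>x. a + \<gamma> * needlet_sum j E x)
      \<le> ennreal ((D * 3 powr recip q) * (\<gamma> * 2 powr (real j * ?\<alpha>)))"
    if \<gamma>: "\<gamma> \<ge> 0" and \<eta>: "\<eta> \<in> Z j" and E: "E \<subseteq> {\<eta>}" for a \<gamma> j \<eta> E
  proof (cases "E = {}")
    case True
    have "(\<lambda>x. a + \<gamma> * needlet_sum j E x) = (\<lambda>x. a + 0 * needlet_sum j {\<eta>} x)"
      using True by (auto simp: needlet_sum_def)
    moreover have "besov_norm d Z \<psi> s r q (\<lambda>x. a + 0 * needlet_sum j {\<eta>} x) \<le> 0"
      using single[of 0 \<eta> j a] \<eta> by simp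
    ultimately show ?thesis by simp
  next
    case False
    then have "E = {\<eta>}" using E by auto
    then show ?thesis using single[OF \<gamma> \<eta>, of a] by (simp add: mult_ac)
  qed
  note main = this
  show ?thesis
  proof (intro exI[of _ "D * 3 powr recip q"] conjI allI impI ballI)
    show "D * 3 powr recip q > 0" using D by simp
  qed (rule main)
qed

end

section \<open>Two-point testing and averaging over a cube\<close>

lemma PiM_density_eq:
  fixes \<mu> :: "'b measure" and f :: "'b \<Rightarrow> ennreal"
  assumes \<mu>: "sigma_finite_measure \<mu>" and f [measurable]: "f \<in> borel_measurable \<mu>"
    and one: "(\<integral>\<^sup>+x. f x \<partial>\<mu>) = 1" and I: "finite I"
  shows "(\<Pi>\<^sub>M i\<in>I. density \<mu> f) = density (\<Pi>\<^sub>M i\<in>I. \<mu>) (\<lambda>X. \<Prod>i\<in>I. f (X i))"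
proof -
  interpret \<mu>: sigma_finite_measure \<mu> by fact
  interpret P: product_sigma_finite "\<lambda>i. \<mu>" by standard
  have "prob_space (density \<mu> f)"
    by (rule prob_spaceI) (simp add: emeasure_density one cong: nn_integral_cong)
  then interpret D: prob_space "density \<mu> f" .
  interpret Q: product_sigma_finite "\<lambda>i. density \<mu> f" by standard
  have prod_meas: "(\<lambda>X. \<Prod>i\<in>I. f (X i)) \<in> borel_measurable (\<Pi>\<^sub>M i\<in>I. \<mu>)"
    by measurable
  show ?thesis
  proof (rule Q.PiM_eqI[OF I, symmetric])
    show "sets (density (\<Pi>\<^sub>M i\<in>I. \<mu>) (\<lambda>X. \<Prod>i\<in>I. f (X i))) = sets (\<Pi>\<^sub>M i\<in>I. density \<mu> f)"
      by (simp cong: sets_PiM_cong)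
    fix A assume "\<And>i. i \<in> I \<Longrightarrow> A i \<in> sets (density \<mu> f)"
    then have A: "\<And>i. i \<in> I \<Longrightarrow> A i \<in> sets \<mu>" by simp
    have "emeasure (density (\<Pi>\<^sub>M i\<in>I. \<mu>) (\<lambda>X. \<Prod>i\<in>I. f (X i))) (Pi\<^sub>E I A)
      = (\<integral>\<^sup>+X. (\<Prod>i\<in>I. f (X i)) * indicator (Pi\<^sub>E I A) X \<partial>(\<Pi>\<^sub>M i\<in>I. \<mu>))"
      using prod_meas sets_PiM_I_finite[OF I A] by (rule emeasure_density)
    also have "\<dots> = (\<integral>\<^sup>+X. (\<Prod>i\<in>I. f (X i) * indicator (A i) (X i)) \<partial>(\<Pi>\<^sub>M i\<in>I. \<mu>))"
    proof (rule nn_integral_cong)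
      fix X assume "X \<in> space (\<Pi>\<^sub>M i\<in>I. \<mu>)"
      then have "indicator (Pi\<^sub>E I A) X = (\<Prod>i\<in>I. indicator (A i) (X i) :: ennreal)"
        using I by (auto simp: indicator_def space_PiM PiE_iff prod_zero_iff)
      then show "(\<Prod>i\<in>I. f (X i)) * indicator (Pi\<^sub>E I A) X = (\<Prod>i\<in>I. f (X i) * indicator (A i) (X i))"
        by (simp add: prod.distrib)
    qed
    also have "\<dots> = (\<Prod>i\<in>I. \<integral>\<^sup>+x. f x * indicator (A i) x \<partial>\<mu>)"
      by (rule P.product_nn_integral_prod[OF I]) (use A in measurable)
    also have "\<dots> = (\<Prod>i\<in>I. emeasure (density \<mu> f) (A i))"
      using A by (intro prod.cong refl) (simp add: emeasure_density)
    finally show "emeasure (density (\<Pi>\<^sub>M i\<in>I. \<mu>) (\<lambda>X. \<Prod>i\<in>I. f (X i))) (Pi\<^sub>E I A)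
      = (\<Prod>i\<in>I. emeasure (density \<mu> f) (A i))" .
  qed
qed

text \<open>
  The Hellinger integrand dominates the mean of \<open>a\<close> and \<open>b\<close> up to the square of their difference;
  \<open>(sqrt a - sqrt b)\<^sup>2 = (a - b)\<^sup>2 / (sqrt a + sqrt b)\<^sup>2\<close> and the denominator is at least \<open>4 * m\<close>.
\<close>
lemma sqrt_mult_ge:
  fixes a b m :: real
  assumes m: "m > 0" and a: "a \<ge> m" and b: "b \<ge> m"
  shows "(a + b) / 2 - (a - b)\<^sup>2 / (8 * m) \<le> sqrt (a * b)"
proof -
  define u v where "u = sqrt a" and "v = sqrt b"
  have uv: "u \<ge> 0" "v \<ge> 0" "u\<^sup>2 = a" "v\<^sup>2 = b" using assms by (auto simp: u_def v_def)
  have "m = sqrt m * sqrt m" using m by simp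
  also have "\<dots> \<le> u * v" unfolding u_def v_def using assms by (intro mult_mono) auto
  finally have "4 * m \<le> (u + v)\<^sup>2" using uv a b by (simp add: power2_sum)
  then have "(u - v)\<^sup>2 * (4 * m) \<le> (u - v)\<^sup>2 * (u + v)\<^sup>2" by (intro mult_left_mono) auto
  also have "\<dots> = (a - b)\<^sup>2" using uv by (simp add: power_mult_distrib[symmetric] square_diff_square_factored[symmetric] power2_eq_square algebra_simps)
  finally have "(u - v)\<^sup>2 \<le> (a - b)\<^sup>2 / (4 * m)" using m by (simp add: field_simps)
  moreover have "sqrt (a * b) = u * v" by (simp add: u_def v_def real_sqrt_mult)
  moreover have "(u - v)\<^sup>2 = a + b - 2 * (u * v)" using uv by (simp add: power2_diff)
  ultimately show ?thesis by (simp add: field_simps)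
qed

lemma sqrt_mult_le_min:
  fixes p q :: real
  assumes "p \<ge> 0" "q \<ge> 0"
  shows "sqrt (p * q) \<le> 2 * min p q + (p + q) / 8"
proof -
  (* the weights in the inequality of means are chosen so that \<open>1/2 \<le> 2 * m + 2/8\<close> leaves a
     positive lower bound for the shared mass m *)
  have "sqrt (p * q) \<le> 2 * p + q / 8" if "p \<ge> 0" "q \<ge> 0" for p q :: real
  proof -
    have "0 \<le> (2 * p - q / 8)\<^sup>2" by simp
    then have "p * q \<le> (2 * p + q / 8)\<^sup>2" by (simp add: power2_eq_square algebra_simps)
    then have "sqrt (p * q) \<le> sqrt ((2 * p + q / 8)\<^sup>2)" by (rule real_sqrt_le_mono)
    then show ?thesis using that by simp
  qed
  from this[of p q] this[of q p] assms show ?thesis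
    by (cases "p \<le> q") (auto simp: min_def mult.commute add_divide_distrib)
qed

text \<open>
  Two-point testing.  Hellinger affinities multiply over independent samples, and the affinity of
  a single observation is at least \<open>1 - 1 / (2 * n)\<close>; by Bernoulli's inequality that of the samples
  is at least \<open>1/2\<close>.  Hence the two sample laws share a mass of at least \<open>1/8\<close>, and on the shared
  mass both losses are paid.
\<close>
lemma two_point_bound:
  fixes \<mu> :: "'b measure" and f g :: "'b \<Rightarrow> real"
  assumes \<mu>: "finite_measure \<mu>"
    and f [measurable]: "f \<in> borel_measurable \<mu>" and g [measurable]: "g \<in> borel_measurable \<mu>"
    and m: "m > 0" "\<And>x. x \<in> space \<mu> \<Longrightarrow> m \<le> f x" "\<And>x. x \<in> space \<mu> \<Longrightarrow> m \<le> g x"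
    and int: "integrable \<mu> f" "integrable \<mu> g" "integrable \<mu> (\<lambda>x. (f x - g x)\<^sup>2)"
    and one: "(\<integral>x. f x \<partial>\<mu>) = 1" "(\<integral>x. g x \<partial>\<mu>) = 1"
    and n: "n \<ge> 1" and close: "real n * (\<integral>x. (f x - g x)\<^sup>2 \<partial>\<mu>) \<le> 4 * m"
    and L1 [measurable]: "L1 \<in> borel_measurable (\<Pi>\<^sub>M i\<in>{..<n}. \<mu>)"
    and L2 [measurable]: "L2 \<in> borel_measurable (\<Pi>\<^sub>M i\<in>{..<n}. \<mu>)"
    and sep: "\<And>X. X \<in> space (\<Pi>\<^sub>M i\<in>{..<n}. \<mu>) \<Longrightarrow> \<Delta> \<le> L1 X + L2 X"
  shows "\<Delta> \<le> 8 * ((\<integral>\<^sup>+X. L1 X \<partial>(\<Pi>\<^sub>M i\<in>{..<n}. density \<mu> (\<lambda>x. ennreal (f x)))) +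
                   (\<integral>\<^sup>+X. L2 X \<partial>(\<Pi>\<^sub>M i\<in>{..<n}. density \<mu> (\<lambda>x. ennreal (g x)))))"
proof -
  interpret finite_measure \<mu> by fact
  interpret P: product_sigma_finite "\<lambda>i. \<mu>" by standard
  let ?M = "\<Pi>\<^sub>M i\<in>{..<n}. \<mu>"
  have f0: "x \<in> space \<mu> \<Longrightarrow> f x \<ge> 0" and g0: "x \<in> space \<mu> \<Longrightarrow> g x \<ge> 0" for x
    using m by (meson less_imp_le order_trans)+
  have f1: "(\<integral>\<^sup>+x. ennreal (f x) \<partial>\<mu>) = 1" and g1: "(\<integral>\<^sup>+x. ennreal (g x) \<partial>\<mu>) = 1"
    using int one f0 g0 by (simp_all add: nn_integral_eq_integral)
  (* p and q are the densities of the two sample laws with respect to the product measure *)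
  define p q where "p X = (\<Prod>i<n. f (X i))" and "q X = (\<Prod>i<n. g (X i))" for X
  have [measurable]: "p \<in> borel_measurable ?M" "q \<in> borel_measurable ?M"
    unfolding p_def q_def by measurable
  have X: "X i \<in> space \<mu>" if "X \<in> space ?M" "i < n" for X i
    using that by (auto simp: space_PiM PiE_iff)
  have p0: "p X \<ge> 0" and q0: "q X \<ge> 0" if "X \<in> space ?M" for X
    unfolding p_def q_def using X[OF that] f0 g0 by (auto intro!: prod_nonneg)
  have prod_ennreal_f: "(\<Prod>i<n. ennreal (f (X i))) = ennreal (p X)"
    and prod_ennreal_g: "(\<Prod>i<n. ennreal (g (X i))) = ennreal (q X)" if "X \<in> space ?M" for X
    unfolding p_def q_def using X[OF that] f0 g0 by (auto intro!: prod_ennreal)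
  have E1: "(\<integral>\<^sup>+X. L1 X \<partial>(\<Pi>\<^sub>M i\<in>{..<n}. density \<mu> (\<lambda>x. ennreal (f x)))) = (\<integral>\<^sup>+X. ennreal (p X) * L1 X \<partial>?M)"
    by (subst PiM_density_eq[OF sigma_finite_measure_axioms _ f1], simp, simp, subst nn_integral_density)
      (auto intro!: nn_integral_cong simp: prod_ennreal_f)
  have E2: "(\<integral>\<^sup>+X. L2 X \<partial>(\<Pi>\<^sub>M i\<in>{..<n}. density \<mu> (\<lambda>x. ennreal (g x)))) = (\<integral>\<^sup>+X. ennreal (q X) * L2 X \<partial>?M)"
    by (subst PiM_density_eq[OF sigma_finite_measure_axioms _ g1], simp, simp, subst nn_integral_density)
      (auto intro!: nn_integral_cong simp: prod_ennreal_g)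
  have tot: "(\<integral>\<^sup>+X. ennreal (p X) \<partial>?M) = 1" "(\<integral>\<^sup>+X. ennreal (q X) \<partial>?M) = 1"
  proof -
    have "(\<integral>\<^sup>+X. ennreal (p X) \<partial>?M) = (\<integral>\<^sup>+X. (\<Prod>i<n. ennreal (f (X i))) \<partial>?M)"
      by (intro nn_integral_cong) (simp add: prod_ennreal_f)
    also have "\<dots> = 1" by (subst P.product_nn_integral_prod) (auto simp: f1)
    finally show "(\<integral>\<^sup>+X. ennreal (p X) \<partial>?M) = 1" .
    have "(\<integral>\<^sup>+X. ennreal (q X) \<partial>?M) = (\<integral>\<^sup>+X. (\<Prod>i<n. ennreal (g (X i))) \<partial>?M)"
      by (intro nn_integral_cong) (simp add: prod_ennreal_g)
    also have "\<dots> = 1" by (subst P.product_nn_integral_prod) (auto simp: g1)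
    finally show "(\<integral>\<^sup>+X. ennreal (q X) \<partial>?M) = 1" .
  qed
  (* a bound for half the squared Hellinger distance of f and g *)
  define H where "H = (\<integral>x. (f x - g x)\<^sup>2 \<partial>\<mu>) / (8 * m)"
  have H: "real n * H \<le> 1 / 2" "H \<ge> 0" using close m(1) by (auto simp: H_def field_simps)
  have H1: "H \<le> 1 / 2"
    using H mult_right_mono[of 1 "real n" H] n by simp
  have int_sqrt: "integrable \<mu> (\<lambda>x. sqrt (f x * g x))"
  proof (rule Bochner_Integration.integrable_bound)
    show "integrable \<mu> (\<lambda>x. (f x + g x) / 2)" using int by simp
    show "AE x in \<mu>. norm (sqrt (f x * g x)) \<le> norm ((f x + g x) / 2)"
      using f0 g0 arith_geo_mean_sqrt by (intro AE_I2) (auto simp: abs_mult)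
  qed measurable
  have aff: "ennreal (1 - H) \<le> (\<integral>\<^sup>+x. ennreal (sqrt (f x * g x)) \<partial>\<mu>)"
  proof -
    have "1 - H = (\<integral>x. (f x + g x) / 2 - (f x - g x)\<^sup>2 / (8 * m) \<partial>\<mu>)"
      using int one by (simp add: H_def)
    also have "\<dots> \<le> (\<integral>x. sqrt (f x * g x) \<partial>\<mu>)"
      using m int int_sqrt by (intro integral_mono sqrt_mult_ge) auto
    also have "ennreal \<dots> = (\<integral>\<^sup>+x. ennreal (sqrt (f x * g x)) \<partial>\<mu>)"
      using f0 g0 by (intro nn_integral_eq_integral[symmetric] int_sqrt AE_I2) auto
    finally show ?thesis by (simp add: ennreal_leI)
  qed
  have "1 / 2 \<le> 1 + real n * (- H)" using H by simp
  also have "\<dots> \<le> (1 - H) ^ n" using Bernoulli_inequality[of "- H" n] H1 by simp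
  finally have "ennreal (1 / 2) \<le> ennreal ((1 - H) ^ n)" by (rule ennreal_leI)
  also have "\<dots> = (\<Prod>i<n. ennreal (1 - H))" using H1 by (simp add: ennreal_power)
  also have "\<dots> \<le> (\<Prod>i<n. \<integral>\<^sup>+x. ennreal (sqrt (f x * g x)) \<partial>\<mu>)"
    using aff by (simp add: power_mono)
  also have "\<dots> = (\<integral>\<^sup>+X. (\<Prod>i<n. ennreal (sqrt (f (X i) * g (X i)))) \<partial>?M)"
    by (rule P.product_nn_integral_prod[symmetric]) auto
  also have "\<dots> = (\<integral>\<^sup>+X. ennreal (sqrt (p X * q X)) \<partial>?M)"
  proof (rule nn_integral_cong)
    fix X assume "X \<in> space ?M"
    then have "(\<Prod>i<n. ennreal (sqrt (f (X i) * g (X i)))) = ennreal (\<Prod>i<n. sqrt (f (X i) * g (X i)))"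
      using X f0 g0 by (intro prod_ennreal) auto
    also have "(\<Prod>i<n. sqrt (f (X i) * g (X i))) = sqrt (p X * q X)"
      by (simp add: p_def q_def prod.distrib real_sqrt_mult) (induction n; simp add: real_sqrt_mult)
    finally show "(\<Prod>i<n. ennreal (sqrt (f (X i) * g (X i)))) = ennreal (sqrt (p X * q X))" .
  qed
  also have "\<dots> \<le> (\<integral>\<^sup>+X. 2 * ennreal (min (p X) (q X)) + (ennreal (p X) + ennreal (q X)) * ennreal (1 / 8) \<partial>?M)"
  proof (rule nn_integral_mono)
    fix X assume X: "X \<in> space ?M"
    have "ennreal (sqrt (p X * q X)) \<le> ennreal (2 * min (p X) (q X) + (p X + q X) * (1 / 8))"
      using sqrt_mult_le_min[OF p0[OF X] q0[OF X]] by (intro ennreal_leI) simp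
    also have "\<dots> = 2 * ennreal (min (p X) (q X)) + (ennreal (p X) + ennreal (q X)) * ennreal (1 / 8)"
    proof -
      have "ennreal (2 * min (p X) (q X)) = 2 * ennreal (min (p X) (q X))"
        by (subst ennreal_mult') simp_all
      moreover have "ennreal ((p X + q X) * (1 / 8)) = (ennreal (p X) + ennreal (q X)) * ennreal (1 / 8)"
        using p0[OF X] q0[OF X] by (subst ennreal_mult) simp_all
      ultimately show ?thesis using p0[OF X] q0[OF X] by (subst ennreal_plus) simp_all
    qed
    finally show "ennreal (sqrt (p X * q X)) \<le> 2 * ennreal (min (p X) (q X)) + (ennreal (p X) + ennreal (q X)) * ennreal (1 / 8)" .
  qed
  also have "\<dots> = 2 * (\<integral>\<^sup>+X. ennreal (min (p X) (q X)) \<partial>?M) + (1 + 1) * ennreal (1 / 8)"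
    by (simp add: nn_integral_add nn_integral_cmult nn_integral_multc tot)
  finally have half: "ennreal (1 / 2) \<le> 2 * (\<integral>\<^sup>+X. ennreal (min (p X) (q X)) \<partial>?M) + (1 + 1) * ennreal (1 / 8)" .
  (* min p q is the density of the mass shared by the two laws *)
  have min8: "1 \<le> 8 * (\<integral>\<^sup>+X. ennreal (min (p X) (q X)) \<partial>?M)"
  proof (cases "(\<integral>\<^sup>+X. ennreal (min (p X) (q X)) \<partial>?M)")
    case (real t)
    have "ennreal (1 / 2) \<le> ennreal (2 * t + 2 * (1 / 8))"
    proof -
      have "ennreal (2 * t + 2 * e) = (1 + 1) * ennreal e + 2 * ennreal t" if "e \<ge> 0" for e
        using that real(1) by (simp add: ennreal_mult add.commute)
      from this[of "1 / 8"] half real show ?thesis by (simp only: add.commute zero_le_divide_1_iff zero_le_numeral)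
    qed
    then have "1 \<le> 8 * t" using real(1) by (subst (asm) ennreal_le_iff) auto
    then have "ennreal 1 \<le> ennreal (8 * t)" by (rule ennreal_leI)
    then show ?thesis using real by (simp add: ennreal_mult)
  qed (simp add: ennreal_mult_top)
  have "\<Delta> = \<Delta> * 1" by simp
  also have "\<dots> \<le> \<Delta> * (8 * (\<integral>\<^sup>+X. ennreal (min (p X) (q X)) \<partial>?M))" using min8 by (rule mult_left_mono) simp
  also have "\<dots> = 8 * (\<integral>\<^sup>+X. ennreal (min (p X) (q X)) * \<Delta> \<partial>?M)"
    by (subst nn_integral_multc) (simp_all add: mult_ac)
  also have "\<dots> \<le> 8 * (\<integral>\<^sup>+X. ennreal (p X) * L1 X + ennreal (q X) * L2 X \<partial>?M)"
  proof (intro mult_left_mono nn_integral_mono)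
    fix X assume X: "X \<in> space ?M"
    have "ennreal (min (p X) (q X)) * \<Delta> \<le> ennreal (min (p X) (q X)) * (L1 X + L2 X)"
      using sep[OF X] by (rule mult_left_mono) simp
    also have "\<dots> = ennreal (min (p X) (q X)) * L1 X + ennreal (min (p X) (q X)) * L2 X"
      by (rule distrib_left)
    also have "\<dots> \<le> ennreal (p X) * L1 X + ennreal (q X) * L2 X"
      by (intro add_mono mult_right_mono ennreal_leI) auto
    finally show "ennreal (min (p X) (q X)) * \<Delta> \<le> ennreal (p X) * L1 X + ennreal (q X) * L2 X" .
  qed simp
  also have "(\<integral>\<^sup>+X. ennreal (p X) * L1 X + ennreal (q X) * L2 X \<partial>?M)
     = (\<integral>\<^sup>+X. ennreal (p X) * L1 X \<partial>?M) + (\<integral>\<^sup>+X. ennreal (q X) * L2 X \<partial>?M)"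
    by (rule nn_integral_add) measurable
  finally show ?thesis unfolding E1 E2 .
qed

text \<open>
  Averaging over all subsets \<open>E\<close> of \<open>A\<close> (Assouad's argument): for each coordinate \<open>a\<close> the subsets
  fall into pairs that differ only by \<open>a\<close>, and each pair pays \<open>\<delta> a\<close>.  A subset with the largest total
  pays at least the average.
\<close>
lemma hypercube_average:
  fixes R :: "'i \<Rightarrow> 'i set \<Rightarrow> ennreal"
  assumes A: "finite A"
    and pair: "\<And>a E. a \<in> A \<Longrightarrow> E \<subseteq> A - {a} \<Longrightarrow> \<delta> a \<le> R a E + R a (insert a E)"
  shows "\<exists>E\<subseteq>A. (\<Sum>a\<in>A. \<delta> a) \<le> 2 * (\<Sum>a\<in>A. R a E)"
proof -
  let ?S = "\<lambda>E. \<Sum>a\<in>A. R a E"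
  have fin: "finite (Pow A)" "Pow A \<noteq> {}" using A by auto
  obtain E where E: "E \<in> Pow A" "\<And>E'. E' \<in> Pow A \<Longrightarrow> ?S E' \<le> ?S E"
    using Max_in[of "?S ` Pow A"] Max_ge[of "?S ` Pow A"] fin
    by (smt (verit, best) finite_imageI image_iff image_is_empty)
  have half: "2 ^ card A * \<delta> a \<le> 2 * (\<Sum>E\<in>Pow A. R a E)" if a: "a \<in> A" for a
  proof -
    have Pow: "Pow A = Pow (A - {a}) \<union> insert a ` Pow (A - {a})"
      using a by (metis insert_Diff Pow_insert)
    have inj: "inj_on (insert a) (Pow (A - {a}))" by (auto simp: inj_on_def)
    have "(\<Sum>E\<in>Pow A. R a E) = (\<Sum>E\<in>Pow (A - {a}). R a E) + (\<Sum>E\<in>insert a ` Pow (A - {a}). R a E)"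
      unfolding Pow using A by (intro sum.union_disjoint) auto
    also have "\<dots> = (\<Sum>E\<in>Pow (A - {a}). R a E + R a (insert a E))"
      by (simp add: sum.reindex[OF inj] sum.distrib)
    also have "(\<Sum>E\<in>Pow (A - {a}). \<delta> a) \<le> \<dots>"
      using pair[OF a] by (intro sum_mono) auto
    finally have "of_nat (card (Pow (A - {a}))) * \<delta> a \<le> (\<Sum>E\<in>Pow A. R a E)" by simp
    then have "2 * (of_nat (card (Pow (A - {a}))) * \<delta> a) \<le> 2 * (\<Sum>E\<in>Pow A. R a E)"
      by (intro mult_left_mono) auto
    moreover have "card A = Suc (card (A - {a}))" using A a by (metis card_Suc_Diff1)
    ultimately show ?thesis using A by (simp add: card_Pow mult.assoc)
  qed
  have "2 ^ card A * (\<Sum>a\<in>A. \<delta> a) \<le> (\<Sum>a\<in>A. 2 * (\<Sum>E\<in>Pow A. R a E))"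
    unfolding sum_distrib_left by (intro sum_mono) (simp add: half flip: sum_distrib_left)
  also have "\<dots> = 2 * (\<Sum>E\<in>Pow A. ?S E)"
    unfolding sum_distrib_left[symmetric] by (rule arg_cong[OF sum.swap])
  also have "\<dots> \<le> 2 * (of_nat (card (Pow A)) * ?S E)"
    by (intro mult_left_mono sum_bounded_above E(2)) auto
  also have "\<dots> = 2 ^ card A * (2 * ?S E)" using A by (simp add: card_Pow mult_ac)
  finally have "(\<Sum>a\<in>A. \<delta> a) \<le> 2 * ?S E"
    by (subst (asm) ennreal_mult_le_mult_iff) (auto simp: power_eq_top_ennreal)
  then show ?thesis using E(1) by auto
qed

section \<open>Local losses\<close>

text \<open>
  The part on \<open>D\<close> of the \<open>p\<close>-th power of the \<open>L\<^sup>p\<close> loss.  It is a measurable function of the sample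
  and additive in \<open>D\<close>, so it can be compared coordinate by coordinate on the peak sets.
\<close>
definition local_loss ::
    "real \<Rightarrow> 'a::euclidean_space set \<Rightarrow> ((nat \<Rightarrow> 'a) \<Rightarrow> 'a \<Rightarrow> real) \<Rightarrow> ('a \<Rightarrow> real) \<Rightarrow> (nat \<Rightarrow> 'a) \<Rightarrow> ennreal" where
  "local_loss p D fhat f X = (\<integral>\<^sup>+x. ennreal (\<bar>fhat X x - f x\<bar> powr p) * indicator D x \<partial>sphere_measure)"

lemma estimator_section_measurable:
  assumes "estimator n fhat" "X \<in> space (\<Pi>\<^sub>M i\<in>{..<n}. sphere_measure)"
  shows "fhat X \<in> borel_measurable (sphere_measure :: 'a::euclidean_space measure)"
  using measurable_Pair2[OF assms(1)[unfolded estimator_def] assms(2)] by simp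

lemma local_loss_measurable:
  fixes f :: "'a::euclidean_space \<Rightarrow> real"
  assumes est: "estimator n fhat" and f [measurable]: "f \<in> borel_measurable sphere_measure"
    and D [measurable]: "D \<in> sets sphere_measure"
  shows "local_loss p D fhat f \<in> borel_measurable (\<Pi>\<^sub>M i\<in>{..<n}. sphere_measure)"
proof -
  have [measurable]: "(\<lambda>z. fhat (fst z) (snd z)) \<in>
      borel_measurable ((\<Pi>\<^sub>M i\<in>{..<n}. sphere_measure) \<Otimes>\<^sub>M sphere_measure)"
    using est by (simp add: estimator_def split_beta')
  have "(\<lambda>X. \<integral>\<^sup>+x. ennreal (\<bar>fhat X x - f x\<bar> powr p) * indicator D x \<partial>sphere_measure)
      \<in> borel_measurable (\<Pi>\<^sub>M i\<in>{..<n}. sphere_measure)"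
  proof (rule sphere.borel_measurable_nn_integral)
    have "(\<lambda>z. ennreal (\<bar>fhat (fst z) (snd z) - f (snd z)\<bar> powr p) * indicator D (snd z)) \<in>
      borel_measurable ((\<Pi>\<^sub>M i\<in>{..<n}. sphere_measure) \<Otimes>\<^sub>M sphere_measure)"
      by measurable
    then show "(\<lambda>(X, x). ennreal (\<bar>fhat X x - f x\<bar> powr p) * indicator D x) \<in>
      borel_measurable ((\<Pi>\<^sub>M i\<in>{..<n}. sphere_measure) \<Otimes>\<^sub>M sphere_measure)"
      by (simp add: split_beta')
  qed
  then show ?thesis by (simp add: local_loss_def[abs_def])
qed

text \<open>
  No estimate is closer than \<open>t / 2\<close> to both \<open>f x\<close> and \<open>g x\<close> when these differ by \<open>t\<close>.
\<close>
lemma local_loss_separation: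
  fixes f g :: "'a::euclidean_space \<Rightarrow> real"
  assumes est: "estimator n fhat" and X: "X \<in> space (\<Pi>\<^sub>M i\<in>{..<n}. sphere_measure)"
    and f [measurable]: "f \<in> borel_measurable sphere_measure"
    and g [measurable]: "g \<in> borel_measurable sphere_measure"
    and D [measurable]: "D \<in> sets sphere_measure" and p: "p > 0" and t: "t \<ge> 0"
    and sep: "\<And>x. x \<in> D \<Longrightarrow> t \<le> \<bar>f x - g x\<bar>"
  shows "ennreal ((t / 2) powr p * measure sphere_measure D) \<le> local_loss p D fhat f X + local_loss p D fhat g X"
proof -
  note [measurable] = estimator_section_measurable[OF est X]
  have "ennreal ((t / 2) powr p * measure sphere_measure D) = (\<integral>\<^sup>+x. ennreal ((t / 2) powr p) * indicator D x \<partial>sphere_measure)"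
    using D by (simp add: nn_integral_cmult_indicator sphere.emeasure_eq_measure ennreal_mult)
  also have "\<dots> \<le> (\<integral>\<^sup>+x. ennreal (\<bar>fhat X x - f x\<bar> powr p) * indicator D x + ennreal (\<bar>fhat X x - g x\<bar> powr p) * indicator D x \<partial>sphere_measure)"
  proof (rule nn_integral_mono)
    fix x
    show "ennreal ((t / 2) powr p) * indicator D x
      \<le> ennreal (\<bar>fhat X x - f x\<bar> powr p) * indicator D x + ennreal (\<bar>fhat X x - g x\<bar> powr p) * indicator D x"
    proof (cases "x \<in> D")
      case True
      have "t / 2 \<le> \<bar>fhat X x - f x\<bar> \<or> t / 2 \<le> \<bar>fhat X x - g x\<bar>" using sep[OF True] by linarith
      then have "(t / 2) powr p \<le> \<bar>fhat X x - f x\<bar> powr p \<or> (t / 2) powr p \<le> \<bar>fhat X x - g x\<bar> powr p"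
        using p t by (auto intro: powr_mono2)
      then have "(t / 2) powr p \<le> \<bar>fhat X x - f x\<bar> powr p + \<bar>fhat X x - g x\<bar> powr p"
        by (auto intro: add_increasing add_increasing2)
      then have "ennreal ((t / 2) powr p) \<le> ennreal (\<bar>fhat X x - f x\<bar> powr p + \<bar>fhat X x - g x\<bar> powr p)"
        by (rule ennreal_leI)
      then show ?thesis using True by simp
    qed simp
  qed
  also have "\<dots> = local_loss p D fhat f X + local_loss p D fhat g X"
    unfolding local_loss_def by (rule nn_integral_add) measurable
  finally show ?thesis .
qed

context needlet_frame
begin

definition perturbed :: "real \<Rightarrow> nat \<Rightarrow> 'a set \<Rightarrow> 'a \<Rightarrow> real" where
  "perturbed \<gamma> j E x = 1 / sphere_area TYPE('a) + \<gamma> * needlet_sum j E x"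

lemma continuous_on_perturbed: "continuous_on S (perturbed \<gamma> j E)"
  unfolding perturbed_def[abs_def] by (intro continuous_intros continuous_on_needlet_sum)

lemma perturbed_measurable: "perturbed \<gamma> j E \<in> borel_measurable sphere_measure"
  by (intro continuous_imp_sphere_measurable continuous_on_perturbed)

lemma integral_perturbed:
  assumes "E \<subseteq> Z j"
  shows "(\<integral>x. perturbed \<gamma> j E x \<partial>sphere_measure) = 1"
proof -
  have "(\<integral>x. perturbed \<gamma> j E x \<partial>sphere_measure)
    = (\<integral>x. 1 / sphere_area TYPE('a) \<partial>(sphere_measure :: 'a measure)) + (\<integral>x. \<gamma> * needlet_sum j E x \<partial>sphere_measure)"
    unfolding perturbed_def
    by (intro Bochner_Integration.integral_add integrable_sphere_continuous continuous_intros continuous_on_needlet_sum)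
  then show ?thesis using integral_needlet_sum[OF assms] sphere_area_pos[where 'a='a] by simp
qed

lemma perturbed_density:
  assumes "E \<subseteq> Z j" "\<And>x. x \<in> sphere 0 1 \<Longrightarrow> 0 \<le> perturbed \<gamma> j E x"
  shows "perturbed \<gamma> j E \<in> sphere_densities"
proof -
  have "(\<integral>\<^sup>+x. ennreal (perturbed \<gamma> j E x) \<partial>sphere_measure) = ennreal (\<integral>x. perturbed \<gamma> j E x \<partial>sphere_measure)"
    using assms(2) by (intro nn_integral_eq_integral integrable_sphere_continuous continuous_on_perturbed AE_I2) auto
  then show ?thesis
    using assms(2) by (simp add: sphere_densities_def perturbed_measurable integral_perturbed[OF assms(1)])
qed

text \<open>
  Moving \<open>\<eta>\<close> in or out of \<open>E\<close> changes the density by \<open>\<gamma> * \<psi> j \<eta>\<close>: at least \<open>\<gamma> * (\<delta> * amp d j)\<close> on the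
  peak set, whatever the other members of \<open>E\<close> are, while the mean square of the change stays below
  the threshold of the two-point bound.  The factor \<open>16\<close> is \<open>8\<close> from that bound and \<open>2\<close> from
  the pairing of subsets.
\<close>
lemma perturbed_assouad:
  assumes est: "estimator n fhat" and n: "n \<ge> 1" and A: "A \<subseteq> Z j" and \<gamma>: "\<gamma> \<ge> 0" and \<delta>: "\<delta> > 0" and p: "p > 0"
    and small: "\<And>E x. E \<subseteq> A \<Longrightarrow> x \<in> sphere 0 1 \<Longrightarrow> \<gamma> * \<bar>needlet_sum j E x\<bar> \<le> 1 / (2 * sphere_area TYPE('a))"
    and info: "\<And>\<eta>. \<eta> \<in> A \<Longrightarrow> real n * (\<gamma>\<^sup>2 * (\<integral>x. (\<psi> j \<eta> x)\<^sup>2 \<partial>sphere_measure)) \<le> 2 / sphere_area TYPE('a)"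
  shows "\<exists>E\<subseteq>A. (\<Sum>\<eta>\<in>A. ennreal ((\<gamma> * (\<delta> * amp d j) / 2) powr p * measure sphere_measure (peak \<delta> j \<eta>)))
    \<le> 16 * (\<Sum>\<eta>\<in>A. sample_expectation n (perturbed \<gamma> j E) (local_loss p (peak \<delta> j \<eta>) fhat (perturbed \<gamma> j E)))"
proof -
  let ?f = "perturbed \<gamma> j" and ?a = "sphere_area TYPE('a)"
  let ?t = "\<gamma> * (\<delta> * amp d j)"
  define R where "R \<eta> E = 8 * sample_expectation n (?f E) (local_loss p (peak \<delta> j \<eta>) fhat (?f E))" for \<eta> E
  have lower: "1 / (2 * ?a) \<le> ?f E x" if "E \<subseteq> A" "x \<in> sphere 0 1" for E x
  proof -
    have "- (\<gamma> * needlet_sum j E x) \<le> 1 / (2 * ?a)"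
      using small[OF that] abs_ge_minus_self[of "\<gamma> * needlet_sum j E x"] \<gamma> by (simp add: abs_mult)
    then show ?thesis using sphere_area_pos[where 'a='a] by (simp add: perturbed_def field_simps)
  qed
  have "\<exists>E\<subseteq>A. (\<Sum>\<eta>\<in>A. ennreal ((?t / 2) powr p * measure sphere_measure (peak \<delta> j \<eta>))) \<le> 2 * (\<Sum>\<eta>\<in>A. R \<eta> E)"
  proof (rule hypercube_average)
    show "finite A" using A by (rule finite_subset) simp
    fix \<eta> E assume \<eta>: "\<eta> \<in> A" and E: "E \<subseteq> A - {\<eta>}"
    then have EA: "E \<subseteq> A" "insert \<eta> E \<subseteq> A" "\<eta> \<notin> E" by auto
    have "finite E" by (rule finite_subset[OF subset_trans[OF EA(1) A] finite_Z])
    then have diff: "?f E x - ?f (insert \<eta> E) x = - (\<gamma> * \<psi> j \<eta> x)" for x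
      using EA(3) by (simp add: perturbed_def needlet_sum_def algebra_simps)
    have "ennreal ((?t / 2) powr p * measure sphere_measure (peak \<delta> j \<eta>))
      \<le> 8 * ((\<integral>\<^sup>+X. local_loss p (peak \<delta> j \<eta>) fhat (?f E) X \<partial>(\<Pi>\<^sub>M i\<in>{..<n}. density sphere_measure (\<lambda>x. ennreal (?f E x)))) +
        (\<integral>\<^sup>+X. local_loss p (peak \<delta> j \<eta>) fhat (?f (insert \<eta> E)) X \<partial>(\<Pi>\<^sub>M i\<in>{..<n}. density sphere_measure (\<lambda>x. ennreal (?f (insert \<eta> E) x)))))"
    proof (rule two_point_bound[where m="1 / (2 * ?a)"])
      show "finite_measure (sphere_measure :: 'a measure)" by (rule finite_measure_sphere)
      show "?f E \<in> borel_measurable sphere_measure" "?f (insert \<eta> E) \<in> borel_measurable sphere_measure"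
        by (rule perturbed_measurable)+
      show "integrable sphere_measure (?f E)" "integrable sphere_measure (?f (insert \<eta> E))"
        by (intro integrable_sphere_continuous continuous_on_perturbed)+
      show "integrable sphere_measure (\<lambda>x. (?f E x - ?f (insert \<eta> E) x)\<^sup>2)"
        by (intro integrable_sphere_continuous continuous_intros continuous_on_perturbed)
      show "1 / (2 * ?a) > 0" using sphere_area_pos[where 'a='a] by simp
      show "1 / (2 * ?a) \<le> ?f E x" "1 / (2 * ?a) \<le> ?f (insert \<eta> E) x"
        if "x \<in> space (sphere_measure :: 'a measure)" for x
        using that lower EA by auto
      show "(\<integral>x. ?f E x \<partial>sphere_measure) = 1" "(\<integral>x. ?f (insert \<eta> E) x \<partial>sphere_measure) = 1"
        using EA A by (intro integral_perturbed; blast)+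
      show "n \<ge> 1" by (rule n)
      show "real n * (\<integral>x. (?f E x - ?f (insert \<eta> E) x)\<^sup>2 \<partial>sphere_measure) \<le> 4 * (1 / (2 * ?a))"
        using info[OF \<eta>] by (simp add: diff power_mult_distrib)
      show "local_loss p (peak \<delta> j \<eta>) fhat (?f E) \<in> borel_measurable (\<Pi>\<^sub>M i\<in>{..<n}. sphere_measure)"
        "local_loss p (peak \<delta> j \<eta>) fhat (?f (insert \<eta> E)) \<in> borel_measurable (\<Pi>\<^sub>M i\<in>{..<n}. sphere_measure)"
        by (intro local_loss_measurable est perturbed_measurable peak_measurable)+
      fix X :: "nat \<Rightarrow> 'a" assume X: "X \<in> space (\<Pi>\<^sub>M i\<in>{..<n}. sphere_measure)"
      show "ennreal ((?t / 2) powr p * measure sphere_measure (peak \<delta> j \<eta>))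
        \<le> local_loss p (peak \<delta> j \<eta>) fhat (?f E) X + local_loss p (peak \<delta> j \<eta>) fhat (?f (insert \<eta> E)) X"
      proof (rule local_loss_separation[OF est X perturbed_measurable perturbed_measurable peak_measurable p])
        show "0 \<le> ?t" using \<gamma> \<delta> by simp
        show "?t \<le> \<bar>?f E x - ?f (insert \<eta> E) x\<bar>" if "x \<in> peak \<delta> j \<eta>" for x
          using that \<gamma> by (auto simp: diff abs_mult peak_def intro!: mult_left_mono)
      qed
    qed
    then show "ennreal ((?t / 2) powr p * measure sphere_measure (peak \<delta> j \<eta>)) \<le> R \<eta> E + R \<eta> (insert \<eta> E)"
      by (simp add: R_def sample_expectation_def distrib_left)
  qed
  then show ?thesis by (simp add: R_def sum_distrib_left[symmetric] mult.assoc[symmetric])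
qed

end

section \<open>Minimax lower bounds\<close>

text \<open>
  The level at which perturbations of size \<open>2\<^bsup>-j\<alpha>\<^esup>\<close> are of the order \<open>n\<^bsup>-1/2\<^esup>\<close>, the threshold of
  what \<open>n\<close> observations can detect.
\<close>
lemma exists_resolution_level:
  fixes n :: nat and \<alpha> :: real
  assumes "\<alpha> > 0" "n \<ge> 1"
  shows "\<exists>j. 2 powr (2 * \<alpha> * real j) \<le> real n \<and> real n \<le> 2 powr (2 * \<alpha> * (real j + 1))"
proof -
  define j where "j = nat \<lfloor>log 2 (real n) / (2 * \<alpha>)\<rfloor>"
  have "log 2 (real n) / (2 * \<alpha>) \<ge> 0" using assms by simp
  then have "real j \<le> log 2 (real n) / (2 * \<alpha>)" "log 2 (real n) / (2 * \<alpha>) < real j + 1"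
    unfolding j_def by (simp_all add: of_nat_floor)
  then have j: "2 * \<alpha> * real j \<le> log 2 (real n)" "log 2 (real n) \<le> 2 * \<alpha> * (real j + 1)"
    using assms by (simp_all add: field_simps)
  have n: "real n = 2 powr log 2 (real n)" using assms by simp
  have "2 powr (2 * \<alpha> * real j) \<le> 2 powr log 2 (real n)" "2 powr log 2 (real n) \<le> 2 powr (2 * \<alpha> * (real j + 1))"
    using j by simp_all
  then show ?thesis unfolding n[symmetric] by blast
qed

lemma rate_le_level:
  fixes \<alpha> \<beta> :: real
  assumes "2 powr (2 * \<alpha> * real j) \<le> real n" "\<alpha> > 0" "\<beta> \<ge> 0"
  shows "real n powr (- (\<beta> / (2 * \<alpha>))) \<le> 2 powr (- (real j * \<beta>))"
proof -
  have "real n powr (- (\<beta> / (2 * \<alpha>))) \<le> (2 powr (2 * \<alpha> * real j)) powr (- (\<beta> / (2 * \<alpha>)))"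
    using assms by (intro powr_mono2') auto
  also have "\<dots> = 2 powr (- (real j * \<beta>))"
    using assms(2) by (simp add: powr_powr)
  finally show ?thesis .
qed

lemma enn_powr_sphere_norm:
  assumes "p > 0"
  shows "enn_powr (sphere_norm (ennreal p) h) p = (\<integral>\<^sup>+x. ennreal (\<bar>h x\<bar> powr p) \<partial>sphere_measure)"
  using assms
  by (simp add: sphere_norm_def eLp_norm_def enn_powr_def powr_powr top_unique ennreal_enn2real_if)

text \<open>
  The \<open>L\<^sup>1\<close> loss on \<open>D\<close> serves as a measurable substitute for the essential supremum.
\<close>
lemma local_loss_le_sphere_norm_infinity:
  fixes f :: "'a::euclidean_space \<Rightarrow> real"
  assumes D: "D \<in> sets sphere_measure"
  shows "local_loss 1 D fhat f X \<le> ennreal (measure sphere_measure D) * sphere_norm \<infinity> (\<lambda>x. fhat X x - f x)"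
proof -
  let ?h = "\<lambda>x. ennreal \<bar>fhat X x - f x\<bar>"
  have "AE x in sphere_measure. ?h x \<le> esssup sphere_measure ?h" by (rule esssup_AE)
  then have "AE x in sphere_measure. ennreal (\<bar>fhat X x - f x\<bar> powr 1) * indicator D x
     \<le> esssup sphere_measure ?h * indicator D x"
    by eventually_elim (auto intro: mult_right_mono)
  then have "local_loss 1 D fhat f X \<le> (\<integral>\<^sup>+x. esssup sphere_measure ?h * indicator D x \<partial>sphere_measure)"
    unfolding local_loss_def by (rule nn_integral_mono_AE)
  also have "\<dots> = esssup sphere_measure ?h * emeasure sphere_measure D"
    using D by (rule nn_integral_cmult_indicator)
  finally show ?thesis
    by (simp add: sphere_norm_def eLp_norm_def sphere.emeasure_eq_measure mult.commute)
qed

text \<open>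
  Bounded overlap allows the losses on the sets \<open>D a\<close> to be charged to the loss on the whole sphere.
\<close>
lemma sum_local_loss_le:
  fixes f :: "'a::euclidean_space \<Rightarrow> real"
  assumes est: "estimator n fhat" and X: "X \<in> space (\<Pi>\<^sub>M i\<in>{..<n}. sphere_measure)"
    and f [measurable]: "f \<in> borel_measurable sphere_measure"
    and D: "\<And>a. a \<in> A \<Longrightarrow> D a \<in> sets sphere_measure" and A: "finite A"
    and N: "N \<ge> 0" "\<And>x. x \<in> sphere 0 1 \<Longrightarrow> real (card {a \<in> A. x \<in> D a}) \<le> N"
  shows "(\<Sum>a\<in>A. local_loss p (D a) fhat f X) \<le> ennreal N * local_loss p (sphere 0 1) fhat f X"
proof -
  note [measurable] = estimator_section_measurable[OF est X]
  have top: "sphere (0::'a) 1 \<in> sets sphere_measure"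
    using sets.top[of "sphere_measure :: 'a measure"] by simp
  have "(\<Sum>a\<in>A. local_loss p (D a) fhat f X)
    = (\<integral>\<^sup>+x. (\<Sum>a\<in>A. ennreal (\<bar>fhat X x - f x\<bar> powr p) * indicator (D a) x) \<partial>sphere_measure)"
    unfolding local_loss_def by (rule nn_integral_sum[symmetric]) (use D in measurable)
  also have "\<dots> \<le> (\<integral>\<^sup>+x. ennreal N * (ennreal (\<bar>fhat X x - f x\<bar> powr p) * indicator (sphere 0 1) x) \<partial>sphere_measure)"
  proof (rule nn_integral_mono)
    fix x assume "x \<in> space (sphere_measure :: 'a measure)"
    then have x: "x \<in> sphere 0 1" by simp
    have "(\<Sum>a\<in>A. indicator (D a) x :: ennreal) = of_nat (card {a \<in> A. x \<in> D a})"
      using A by (simp add: indicator_def sum.If_cases Int_def)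
    also have "\<dots> \<le> ennreal N" using N(2)[OF x] by (simp add: ennreal_of_nat_eq_real_of_nat ennreal_leI)
    finally have "ennreal (\<bar>fhat X x - f x\<bar> powr p) * (\<Sum>a\<in>A. indicator (D a) x) \<le> ennreal (\<bar>fhat X x - f x\<bar> powr p) * ennreal N"
      by (rule mult_left_mono) simp
    then show "(\<Sum>a\<in>A. ennreal (\<bar>fhat X x - f x\<bar> powr p) * indicator (D a) x)
      \<le> ennreal N * (ennreal (\<bar>fhat X x - f x\<bar> powr p) * indicator (sphere 0 1) x)"
      using x by (simp add: sum_distrib_left sum_distrib_right mult.commute)
  qed
  also have "\<dots> = ennreal N * local_loss p (sphere 0 1) fhat f X"
    unfolding local_loss_def
    by (intro nn_integral_cmult borel_measurable_times_ennreal borel_measurable_indicator top) measurable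
  finally show ?thesis .
qed

lemma local_loss_sphere:
  "p > 0 \<Longrightarrow> local_loss p (sphere 0 1) fhat f X = enn_powr (sphere_norm (ennreal p) (\<lambda>x. fhat X x - f x)) p"
  unfolding local_loss_def by (subst enn_powr_sphere_norm) (auto intro!: nn_integral_cong)

lemma space_sample:
  "space (\<Pi>\<^sub>M i\<in>{..<n}. density sphere_measure (\<lambda>x::'a::euclidean_space. ennreal (f x))) = space (\<Pi>\<^sub>M i\<in>{..<n}. sphere_measure)"
  by (simp add: space_PiM)

lemma measurable_sample:
  "borel_measurable (\<Pi>\<^sub>M i\<in>{..<n}. density sphere_measure (\<lambda>x::'a::euclidean_space. ennreal (f x)))
     = borel_measurable (\<Pi>\<^sub>M i\<in>{..<n}. sphere_measure)"
  by (intro measurable_cong_sets sets_PiM_cong) auto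

lemma sample_expectation_mono:
  "(\<And>X. X \<in> space (\<Pi>\<^sub>M i\<in>{..<n}. sphere_measure) \<Longrightarrow> g X \<le> h X) \<Longrightarrow>
    sample_expectation n f g \<le> sample_expectation n f (h :: (nat \<Rightarrow> 'a::euclidean_space) \<Rightarrow> ennreal)"
  unfolding sample_expectation_def by (rule nn_integral_mono) (simp only: space_sample)

lemma sample_expectation_cmult:
  assumes "h \<in> borel_measurable (\<Pi>\<^sub>M i\<in>{..<n}. sphere_measure)"
  shows "sample_expectation n f (\<lambda>X. c * h X) = c * sample_expectation n f h"
  unfolding sample_expectation_def by (rule nn_integral_cmult) (unfold measurable_sample, rule assms)

context needlet_frame
begin

abbreviation besov_densities :: "real \<Rightarrow> ennreal \<Rightarrow> ennreal \<Rightarrow> real \<Rightarrow> ('a \<Rightarrow> real) set" where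
  "besov_densities s r q M \<equiv> sphere_densities \<inter> besov_ball d Z \<psi> s r q M"

text \<open>
  The lower bound is kept proportional to the total measure of the peak sets: summed over a whole
  level it is of order \<open>1\<close>, for a single needlet of order \<open>2\<^bsup>-jd\<^esup>\<close>, and for the supremum norm it
  cancels against the average over the peak set.
\<close>
definition unavoidable_loss ::
    "('a \<Rightarrow> real) set \<Rightarrow> real \<Rightarrow> nat \<Rightarrow> real \<Rightarrow> nat \<Rightarrow> 'a set \<Rightarrow> real \<Rightarrow> bool" where
  "unavoidable_loss F p n \<delta> j A b \<longleftrightarrow> (\<forall>fhat. estimator n fhat \<longrightarrow>
     (\<exists>f\<in>F. ennreal (b * (\<Sum>\<eta>\<in>A. measure sphere_measure (peak \<delta> j \<eta>)))
        \<le> (\<Sum>\<eta>\<in>A. sample_expectation n f (local_loss p (peak \<delta> j \<eta>) fhat f))))"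

text \<open>
  The two families of densities are treated at once: \<open>\<alpha>\<close> is the exponent with which the Besov norm
  of the perturbations grows in \<open>j\<close>.  With \<open>\<gamma>\<close> proportional to \<open>2\<^bsup>-j\<alpha>\<^esup>\<close> they stay in the Besov ball;
  \<open>\<alpha> \<ge> d/2\<close> keeps the densities positive; and \<open>n * \<gamma>\<^sup>2\<close> is bounded by the choice of the level.
\<close>
lemma minimax_local_bound:
  assumes d: "d \<ge> 1" and \<alpha>: "\<alpha> \<ge> real d / 2" and A: "\<And>j. A j \<subseteq> Z j" and M: "M > 0" and \<delta>: "\<delta> > 0" and p: "p > 0"
    and besov: "\<exists>C>0. \<forall>a. \<forall>\<gamma>\<ge>0. \<forall>j. \<forall>E\<subseteq>A j.
       besov_norm d Z \<psi> s r q (\<lambda>x. a + \<gamma> * needlet_sum j E x) \<le> ennreal (C * (\<gamma> * 2 powr (real j * \<alpha>)))"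
  shows "\<exists>c>0. \<forall>n\<ge>1. \<exists>j. 2 powr (2 * \<alpha> * real j) \<le> real n \<and>
    unavoidable_loss (besov_densities s r q M) p n \<delta> j (A j) (c * 2 powr (- (real j * ((\<alpha> - real d / 2) * p))))"
proof -
  let ?a = "sphere_area TYPE('a)"
  have a: "?a > 0" by (rule sphere_area_pos)
  have \<alpha>0: "\<alpha> > 0" using \<alpha> d by simp
  obtain CB where "CB > 0" and "\<forall>a. \<forall>\<gamma>\<ge>0. \<forall>j. \<forall>E\<subseteq>A j.
       besov_norm d Z \<psi> s r q (\<lambda>x. a + \<gamma> * needlet_sum j E x) \<le> ennreal (CB * (\<gamma> * 2 powr (real j * \<alpha>)))"
    using besov by blast
  then have CB: "CB > 0" "\<And>a \<gamma> j E. \<gamma> \<ge> 0 \<Longrightarrow> E \<subseteq> A j \<Longrightarrow>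
       besov_norm d Z \<psi> s r q (\<lambda>x. a + \<gamma> * needlet_sum j E x) \<le> ennreal (CB * (\<gamma> * 2 powr (real j * \<alpha>)))"
    by simp_all
  obtain CS where "CS > 0" and "\<forall>j. \<forall>E\<subseteq>Z j. \<forall>x\<in>sphere 0 1. \<bar>needlet_sum j E x\<bar> \<le> CS * amp d j"
    using needlet_sum_bound by blast
  then have CS: "CS > 0" "\<And>j E x. E \<subseteq> Z j \<Longrightarrow> x \<in> sphere 0 1 \<Longrightarrow> \<bar>needlet_sum j E x\<bar> \<le> CS * amp d j"
    by simp_all
  obtain C2 where C2: "C2 > 0" "\<And>j \<eta>. \<eta> \<in> Z j \<Longrightarrow> (\<integral>x. (\<psi> j \<eta> x)\<^sup>2 \<partial>sphere_measure) \<le> C2"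
    using needlet_L2_bounds by blast
  (* the three constraints: radius of the Besov ball, lower bound for the densities, and
     indistinguishability of neighbours by n observations; the factor \<open>2 powr (2 * \<alpha>)\<close> pays for
     rounding the level to an integer *)
  define \<kappa> where "\<kappa> = min (M / CB) (min (1 / (2 * ?a * CS)) (sqrt (2 / (?a * C2 * 2 powr (2 * \<alpha>)))))"
  have \<kappa>0: "\<kappa> > 0" using M CB CS C2 a by (simp add: \<kappa>_def)
  have \<kappa>1: "CB * \<kappa> \<le> M"
  proof -
    have "\<kappa> \<le> M / CB" by (simp add: \<kappa>_def)
    then show ?thesis using CB(1) by (simp add: pos_le_divide_eq mult.commute)
  qed
  have \<kappa>2: "\<kappa> * CS \<le> 1 / (2 * ?a)"
  proof -
    have "\<kappa> \<le> 1 / (2 * ?a * CS)" by (simp add: \<kappa>_def)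
    then have "\<kappa> * CS \<le> 1 / (2 * ?a * CS) * CS" using CS by (intro mult_right_mono) auto
    then show ?thesis using CS by simp
  qed
  have \<kappa>3: "\<kappa>\<^sup>2 * C2 * 2 powr (2 * \<alpha>) \<le> 2 / ?a"
  proof -
    have "\<kappa> \<le> sqrt (2 / (?a * C2 * 2 powr (2 * \<alpha>)))" by (simp add: \<kappa>_def)
    then have "\<kappa>\<^sup>2 \<le> (sqrt (2 / (?a * C2 * 2 powr (2 * \<alpha>))))\<^sup>2" using \<kappa>0 by (intro power_mono) auto
    also have "\<dots> = 2 / (?a * C2 * 2 powr (2 * \<alpha>))" using a C2 by simp
    finally have "\<kappa>\<^sup>2 * (C2 * 2 powr (2 * \<alpha>)) \<le> 2 / (?a * C2 * 2 powr (2 * \<alpha>)) * (C2 * 2 powr (2 * \<alpha>))"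
      using C2 by (intro mult_right_mono) auto
    then show ?thesis using C2 by (simp add: mult_ac)
  qed
  define c where "c = (\<kappa> * \<delta> / 2) powr p / 16"
  have c: "c > 0" using \<kappa>0 \<delta> by (simp add: c_def)
  have "\<exists>j. 2 powr (2 * \<alpha> * real j) \<le> real n \<and>
    unavoidable_loss (besov_densities s r q M) p n \<delta> j (A j) (c * 2 powr (- (real j * ((\<alpha> - real d / 2) * p))))"
    if n: "n \<ge> 1" for n
  proof -
    obtain j where j: "2 powr (2 * \<alpha> * real j) \<le> real n" "real n \<le> 2 powr (2 * \<alpha> * (real j + 1))"
      using exists_resolution_level[OF \<alpha>0 n] by blast
    define \<gamma> where "\<gamma> = \<kappa> * 2 powr (- (real j * \<alpha>))"
    have \<gamma>0: "\<gamma> > 0" using \<kappa>0 by (simp add: \<gamma>_def)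
    have \<gamma>amp: "\<gamma> * amp d j = \<kappa> * 2 powr (- (real j * (\<alpha> - real d / 2)))"
      by (simp add: \<gamma>_def amp_def powr_add[symmetric] algebra_simps)
    have "2 powr (- (real j * (\<alpha> - real d / 2))) \<le> 2 powr 0" using \<alpha> by (intro powr_mono) auto
    then have \<gamma>amp_le: "\<gamma> * amp d j \<le> \<kappa>" unfolding \<gamma>amp using \<kappa>0 by simp
    have small: "\<gamma> * \<bar>needlet_sum j E x\<bar> \<le> 1 / (2 * ?a)" if "E \<subseteq> A j" "x \<in> sphere 0 1" for E x
    proof -
      have "\<gamma> * \<bar>needlet_sum j E x\<bar> \<le> \<gamma> * (CS * amp d j)"
        using CS(2)[of E j x] that A \<gamma>0 by (intro mult_left_mono) auto
      also have "\<dots> = (\<gamma> * amp d j) * CS" by simp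
      also have "\<dots> \<le> \<kappa> * CS" using \<gamma>amp_le CS by (intro mult_right_mono) auto
      finally show ?thesis using \<kappa>2 by linarith
    qed
    have info: "real n * (\<gamma>\<^sup>2 * (\<integral>x. (\<psi> j \<eta> x)\<^sup>2 \<partial>sphere_measure)) \<le> 2 / ?a" if "\<eta> \<in> A j" for \<eta>
    proof -
      have "real n * (\<gamma>\<^sup>2 * (\<integral>x. (\<psi> j \<eta> x)\<^sup>2 \<partial>sphere_measure)) \<le> 2 powr (2 * \<alpha> * (real j + 1)) * (\<gamma>\<^sup>2 * C2)"
        using j(2) C2(2)[of \<eta> j] that A by (intro mult_mono mult_left_mono) auto
      also have "\<dots> = 2 powr (2 * \<alpha> * (real j + 1)) * (\<kappa>\<^sup>2 * 2 powr (- (2 * \<alpha> * real j)) * C2)"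
        by (simp add: \<gamma>_def power_mult_distrib power2_eq_square[of "2 powr _"] powr_add[symmetric] algebra_simps)
      also have "\<dots> = \<kappa>\<^sup>2 * C2 * (2 powr (2 * \<alpha> * (real j + 1)) * 2 powr (- (2 * \<alpha> * real j)))" by (simp add: mult_ac)
      also have "\<dots> = \<kappa>\<^sup>2 * C2 * 2 powr (2 * \<alpha>)" by (simp add: powr_add[symmetric] algebra_simps)
      finally show ?thesis using \<kappa>3 by linarith
    qed
    show ?thesis
      unfolding unavoidable_loss_def
    proof (intro exI[of _ j] conjI allI impI)
      show "2 powr (2 * \<alpha> * real j) \<le> real n" by (rule j(1))
      fix fhat :: "(nat \<Rightarrow> 'a) \<Rightarrow> 'a \<Rightarrow> real" assume est: "estimator n fhat"
      have "\<exists>E\<subseteq>A j. (\<Sum>\<eta>\<in>A j. ennreal ((\<gamma> * (\<delta> * amp d j) / 2) powr p * measure sphere_measure (peak \<delta> j \<eta>)))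
        \<le> 16 * (\<Sum>\<eta>\<in>A j. sample_expectation n (perturbed \<gamma> j E) (local_loss p (peak \<delta> j \<eta>) fhat (perturbed \<gamma> j E)))"
        using \<gamma>0 by (intro perturbed_assouad[OF est n A _ \<delta> p small info]) auto
      then obtain E where E: "E \<subseteq> A j" "(\<Sum>\<eta>\<in>A j. ennreal ((\<gamma> * (\<delta> * amp d j) / 2) powr p * measure sphere_measure (peak \<delta> j \<eta>)))
        \<le> 16 * (\<Sum>\<eta>\<in>A j. sample_expectation n (perturbed \<gamma> j E) (local_loss p (peak \<delta> j \<eta>) fhat (perturbed \<gamma> j E)))"
        by blast
      let ?f = "perturbed \<gamma> j E"
      let ?b = "c * 2 powr (- (real j * ((\<alpha> - real d / 2) * p)))"
      show "\<exists>f\<in>besov_densities s r q M. ennreal (?b * (\<Sum>\<eta>\<in>A j. measure sphere_measure (peak \<delta> j \<eta>)))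
           \<le> (\<Sum>\<eta>\<in>A j. sample_expectation n f (local_loss p (peak \<delta> j \<eta>) fhat f))"
      proof (rule bexI[of _ ?f])
        have "?f \<in> sphere_densities"
        proof (rule perturbed_density)
          show "E \<subseteq> Z j" using E(1) A by blast
          fix x :: 'a assume "x \<in> sphere 0 1"
          then have "- (\<gamma> * needlet_sum j E x) \<le> 1 / (2 * ?a)"
            using small[OF E(1)] abs_ge_minus_self[of "\<gamma> * needlet_sum j E x"] \<gamma>0 by (force simp: abs_mult)
          moreover have "1 / (2 * ?a) \<le> 1 / ?a" using a by (simp add: field_simps)
          ultimately show "0 \<le> ?f x" by (simp add: perturbed_def)
        qed
        moreover have "besov_norm d Z \<psi> s r q ?f \<le> ennreal M"
        proof -
          have "besov_norm d Z \<psi> s r q ?f \<le> ennreal (CB * (\<gamma> * 2 powr (real j * \<alpha>)))"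
            unfolding perturbed_def[abs_def] using CB(2)[of \<gamma> E j] \<gamma>0 E(1) by simp
          also have "CB * (\<gamma> * 2 powr (real j * \<alpha>)) = CB * \<kappa>"
            by (simp add: \<gamma>_def powr_minus field_simps)
          also have "ennreal \<dots> \<le> ennreal M" by (rule ennreal_leI[OF \<kappa>1])
          finally show ?thesis .
        qed
        moreover have "integrable sphere_measure ?f"
          by (intro integrable_sphere_continuous continuous_on_perturbed)
        ultimately show "?f \<in> besov_densities s r q M"
          by (simp add: besov_ball_def)
        have pw: "(\<gamma> * (\<delta> * amp d j) / 2) powr p = 16 * ?b"
        proof -
          have e: "\<gamma> * (\<delta> * amp d j) / 2 = (\<kappa> * \<delta> / 2) * 2 powr (- (real j * (\<alpha> - real d / 2)))"
            using \<gamma>amp by (simp add: mult_ac)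
          have "((\<kappa> * \<delta> / 2) * u) powr p = (\<kappa> * \<delta> / 2) powr p * u powr p" if "u \<ge> 0" for u
            using that \<kappa>0 \<delta> by (intro powr_mult)
          then show ?thesis unfolding e by (simp add: c_def powr_powr mult.assoc)
        qed
        have "16 * ennreal (?b * (\<Sum>\<eta>\<in>A j. measure sphere_measure (peak \<delta> j \<eta>)))
          = ennreal (\<Sum>\<eta>\<in>A j. (\<gamma> * (\<delta> * amp d j) / 2) powr p * measure sphere_measure (peak \<delta> j \<eta>))"
          unfolding pw sum_distrib_left[symmetric] mult.assoc by (simp add: ennreal_mult')
        also have "\<dots> = (\<Sum>\<eta>\<in>A j. ennreal ((\<gamma> * (\<delta> * amp d j) / 2) powr p * measure sphere_measure (peak \<delta> j \<eta>)))"
          by (rule sum_ennreal[symmetric]) simp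
        also note E(2)
        finally show "ennreal (?b * (\<Sum>\<eta>\<in>A j. measure sphere_measure (peak \<delta> j \<eta>)))
           \<le> (\<Sum>\<eta>\<in>A j. sample_expectation n ?f (local_loss p (peak \<delta> j \<eta>) fhat ?f))"
          by (subst (asm) ennreal_mult_le_mult_iff) auto
      qed
    qed
  qed
  then show ?thesis using c by blast
qed

text \<open>
  All needlets of one level are perturbed.  Their peak sets have total measure of order \<open>1\<close>, and the
  height of the perturbation is \<open>\<gamma> * amp d j\<close>, of order \<open>2\<^bsup>-js\<^esup>\<close>, with \<open>2\<^bsup>j(2s+d)\<^esup>\<close> of order \<open>n\<close>.
\<close>
lemma minimax_dense:
  assumes d: "d \<ge> 1" and s: "s > 0" and r: "r > 0" and q: "q > 0" and M: "M > 0" and p: "p > 0"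
  shows "\<exists>c>0. \<forall>n\<ge>1. \<forall>fhat. estimator n fhat \<longrightarrow>
      (SUP f \<in> besov_densities s r q M.
         sample_expectation n f (\<lambda>X. enn_powr (sphere_norm (ennreal p) (\<lambda>x. fhat X x - f x)) p))
      \<ge> ennreal (c * real n powr (- (s * p / (2 * s + real d))))"
proof -
  obtain \<delta> c1 where \<delta>: "\<delta> > 0" and c1: "c1 > 0"
    "\<And>j \<eta>. \<eta> \<in> Z j \<Longrightarrow> c1 / (2 ^ j) ^ d \<le> measure sphere_measure (peak \<delta> j \<eta>)"
    using peak_measure_bound by blast
  obtain N where N: "N > 0" "\<And>j y. y \<in> sphere 0 1 \<Longrightarrow> real (card {\<eta> \<in> Z j. y \<in> peak \<delta> j \<eta>}) \<le> N"
    using peak_overlap[OF \<delta>] by blast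
  obtain cz where cz: "cz \<ge> 1" "\<And>j. inverse cz * (2 ^ j) ^ d \<le> real (card (Z j))"
    using cubature_card_bounds by blast
  have "\<exists>c>0. \<forall>n\<ge>1. \<exists>j. 2 powr (2 * (s + real d / 2) * real j) \<le> real n \<and>
    unavoidable_loss (besov_densities s r q M) p n \<delta> j (Z j) (c * 2 powr (- (real j * ((s + real d / 2 - real d / 2) * p))))"
    using s by (intro minimax_local_bound besov_norm_dense d M \<delta> p r q) auto
  then obtain c where c: "c > 0" "\<And>n. n \<ge> 1 \<Longrightarrow> \<exists>j. 2 powr (2 * (s + real d / 2) * real j) \<le> real n \<and>
      unavoidable_loss (besov_densities s r q M) p n \<delta> j (Z j) (c * 2 powr (- (real j * (s * p))))"
    by auto
  define c' where "c' = c * c1 / (cz * N)"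
  have c': "c' > 0" using c c1 cz N by (simp add: c'_def)
  have "ennreal (c' * real n powr (- (s * p / (2 * s + real d))))
    \<le> (SUP f \<in> besov_densities s r q M.
         sample_expectation n f (\<lambda>X. enn_powr (sphere_norm (ennreal p) (\<lambda>x. fhat X x - f x)) p))"
    if n: "n \<ge> 1" and est: "estimator n fhat" for n fhat
  proof -
    obtain j f where j: "2 powr (2 * (s + real d / 2) * real j) \<le> real n"
      and f: "f \<in> besov_densities s r q M"
      and le: "ennreal (c * 2 powr (- (real j * (s * p))) * (\<Sum>\<eta>\<in>Z j. measure sphere_measure (peak \<delta> j \<eta>)))
           \<le> (\<Sum>\<eta>\<in>Z j. sample_expectation n f (local_loss p (peak \<delta> j \<eta>) fhat f))"
      using c(2)[OF n] est unfolding unavoidable_loss_def by blast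
    have fm: "f \<in> borel_measurable sphere_measure" using f by (auto simp: sphere_densities_def)
    have rate: "real n powr (- (s * p / (2 * s + real d))) \<le> 2 powr (- (real j * (s * p)))"
      using rate_le_level[OF j, of "s * p"] s p by (simp add: algebra_simps)
    have "N * (c' * real n powr (- (s * p / (2 * s + real d)))) \<le> N * (c' * 2 powr (- (real j * (s * p))))"
      using rate c' N by (intro mult_left_mono) auto
    also have "\<dots> = c * 2 powr (- (real j * (s * p))) * (inverse cz * (2 ^ j) ^ d * (c1 / (2 ^ j) ^ d))"
      using N cz by (simp add: c'_def field_simps)
    also have "\<dots> \<le> c * 2 powr (- (real j * (s * p))) * (real (card (Z j)) * (c1 / (2 ^ j) ^ d))"
      using cz(2)[of j] c c1 by (intro mult_left_mono mult_right_mono) auto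
    also have "real (card (Z j)) * (c1 / (2 ^ j) ^ d) \<le> (\<Sum>\<eta>\<in>Z j. measure sphere_measure (peak \<delta> j \<eta>))"
      using c1(2) by (intro sum_bounded_below) auto
    finally have "ennreal (N * (c' * real n powr (- (s * p / (2 * s + real d)))))
      \<le> ennreal (c * 2 powr (- (real j * (s * p))) * (\<Sum>\<eta>\<in>Z j. measure sphere_measure (peak \<delta> j \<eta>)))"
      using c(1) by (simp add: ennreal_leI mult_left_mono)
    also note le
    also have "(\<Sum>\<eta>\<in>Z j. sample_expectation n f (local_loss p (peak \<delta> j \<eta>) fhat f))
      = sample_expectation n f (\<lambda>X. \<Sum>\<eta>\<in>Z j. local_loss p (peak \<delta> j \<eta>) fhat f X)"
      unfolding sample_expectation_def
      by (rule nn_integral_sum[symmetric]) (unfold measurable_sample, intro local_loss_measurable est fm peak_measurable)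
    also have "\<dots> \<le> sample_expectation n f (\<lambda>X. ennreal N * local_loss p (sphere 0 1) fhat f X)"
    proof (rule sample_expectation_mono)
      fix X :: "nat \<Rightarrow> 'a" assume X: "X \<in> space (\<Pi>\<^sub>M i\<in>{..<n}. sphere_measure)"
      show "(\<Sum>\<eta>\<in>Z j. local_loss p (peak \<delta> j \<eta>) fhat f X) \<le> ennreal N * local_loss p (sphere 0 1) fhat f X"
        by (rule sum_local_loss_le[OF est X fm peak_measurable finite_Z]) (use N in auto)
    qed
    also have "\<dots> = ennreal N * sample_expectation n f (local_loss p (sphere 0 1) fhat f)"
      by (intro sample_expectation_cmult local_loss_measurable[OF est fm])
        (use sets.top[of "sphere_measure :: 'a measure"] in simp)
    finally have "ennreal N * ennreal (c' * real n powr (- (s * p / (2 * s + real d))))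
       \<le> ennreal N * sample_expectation n f (local_loss p (sphere 0 1) fhat f)"
      using N c' by (simp add: ennreal_mult)
    then have "ennreal (c' * real n powr (- (s * p / (2 * s + real d))))
       \<le> sample_expectation n f (local_loss p (sphere 0 1) fhat f)"
      using N(1) by (subst (asm) ennreal_mult_le_mult_iff) auto
    also have "local_loss p (sphere 0 1) fhat f = (\<lambda>X. enn_powr (sphere_norm (ennreal p) (\<lambda>x. fhat X x - f x)) p)"
      using local_loss_sphere[OF p] by blast
    finally show ?thesis by (rule SUP_upper2[OF f])
  qed
  then show ?thesis using c' by blast
qed

text \<open>
  A single needlet per level is perturbed, at an arbitrary cubature point.  Since the Besov norm
  grows more slowly, the perturbation may have the larger height \<open>2\<^bsup>-j(s-d/r)\<^esup>\<close>, on a set of measure of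
  order \<open>2\<^bsup>-jd\<^esup>\<close>.
\<close>
lemma minimax_sparse_local:
  assumes d: "d \<ge> 1" and r: "r > 0" and q: "q > 0" and M: "M > 0" and p: "p > 0"
    and s: "s > real d * recip r"
  shows "\<exists>\<delta> c1 c. c1 > 0 \<and> c > 0 \<and> (\<forall>n\<ge>1. \<exists>j. \<exists>\<eta>\<in>Z j.
      2 powr (2 * (s + real d * (1/2 - recip r)) * real j) \<le> real n \<and>
      c1 / (2 ^ j) ^ d \<le> measure sphere_measure (peak \<delta> j \<eta>) \<and>
      unavoidable_loss (besov_densities s r q M) p n \<delta> j {\<eta>} (c * 2 powr (- (real j * ((s - real d * recip r) * p)))))"
proof -
  let ?\<alpha> = "s + real d * (1/2 - recip r)"
  obtain \<delta> c1 where \<delta>: "\<delta> > 0" and c1: "c1 > 0"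
    "\<And>j \<eta>. \<eta> \<in> Z j \<Longrightarrow> c1 / (2 ^ j) ^ d \<le> measure sphere_measure (peak \<delta> j \<eta>)"
    using peak_measure_bound by blast
  define node where "node j = (SOME \<eta>. \<eta> \<in> Z j)" for j
  have node: "node j \<in> Z j" for j unfolding node_def using Z_nonempty by (simp add: some_in_eq)
  have \<alpha>: "?\<alpha> \<ge> real d / 2" using s by (simp add: algebra_simps)
  obtain CB where "CB > 0" and "\<forall>a. \<forall>\<gamma>\<ge>0. \<forall>j. \<forall>\<eta>\<in>Z j. \<forall>E\<subseteq>{\<eta>}.
    besov_norm d Z \<psi> s r q (\<lambda>x. a + \<gamma> * needlet_sum j E x) \<le> ennreal (CB * (\<gamma> * 2 powr (real j * ?\<alpha>)))"
    using besov_norm_sparse[OF r q, of s] \<alpha> by auto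
  then have "besov_norm d Z \<psi> s r q (\<lambda>x. a + \<gamma> * needlet_sum j E x) \<le> ennreal (CB * (\<gamma> * 2 powr (real j * ?\<alpha>)))"
    if "\<gamma> \<ge> 0" "E \<subseteq> {node j}" for a \<gamma> j E
    using that node[of j] by blast
  with \<open>CB > 0\<close> have "\<exists>C>0. \<forall>a. \<forall>\<gamma>\<ge>0. \<forall>j. \<forall>E\<subseteq>{node j}.
    besov_norm d Z \<psi> s r q (\<lambda>x. a + \<gamma> * needlet_sum j E x) \<le> ennreal (C * (\<gamma> * 2 powr (real j * ?\<alpha>)))"
    by (intro exI[of _ CB] conjI allI impI)
  then have "\<exists>c>0. \<forall>n\<ge>1. \<exists>j. 2 powr (2 * ?\<alpha> * real j) \<le> real n \<and>
      unavoidable_loss (besov_densities s r q M) p n \<delta> j {node j} (c * 2 powr (- (real j * ((?\<alpha> - real d / 2) * p))))"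
    using node by (intro minimax_local_bound d M \<delta> p \<alpha>) auto
  moreover have "?\<alpha> - real d / 2 = s - real d * recip r" by (simp add: algebra_simps)
  ultimately obtain c where "c > 0" and c: "\<forall>n\<ge>1. \<exists>j. 2 powr (2 * ?\<alpha> * real j) \<le> real n \<and>
      unavoidable_loss (besov_densities s r q M) p n \<delta> j {node j} (c * 2 powr (- (real j * ((s - real d * recip r) * p))))"
    by auto
  show ?thesis
  proof (rule exI[of _ \<delta>], rule exI[of _ c1], rule exI[of _ c], intro conjI allI impI)
    fix n :: nat assume "n \<ge> 1"
    with c obtain j where "2 powr (2 * ?\<alpha> * real j) \<le> real n"
      "unavoidable_loss (besov_densities s r q M) p n \<delta> j {node j} (c * 2 powr (- (real j * ((s - real d * recip r) * p))))"
      by blast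
    with c1(2)[OF node] show "\<exists>j. \<exists>\<eta>\<in>Z j. 2 powr (2 * ?\<alpha> * real j) \<le> real n \<and>
      c1 / (2 ^ j) ^ d \<le> measure sphere_measure (peak \<delta> j \<eta>) \<and>
      unavoidable_loss (besov_densities s r q M) p n \<delta> j {\<eta>} (c * 2 powr (- (real j * ((s - real d * recip r) * p))))"
      by (intro exI[of _ j] bexI[of _ "node j"] node) blast
  qed (use c1 \<open>c > 0\<close> in auto)
qed

lemma minimax_sparse:
  assumes d: "d \<ge> 1" and r: "r > 0" and q: "q > 0" and M: "M > 0" and p: "p > 0"
    and s: "s > real d * recip r"
  shows "\<exists>c>0. \<forall>n\<ge>1. \<forall>fhat. estimator n fhat \<longrightarrow>
      (SUP f \<in> besov_densities s r q M.
         sample_expectation n f (\<lambda>X. enn_powr (sphere_norm (ennreal p) (\<lambda>x. fhat X x - f x)) p))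
      \<ge> ennreal (c * real n powr (- (p * (s + real d * (1 / p - recip r)) / (2 * (s + real d * (1/2 - recip r))))))"
proof -
  let ?\<alpha> = "s + real d * (1/2 - recip r)" and ?\<beta> = "p * (s + real d * (1 / p - recip r))"
  obtain \<delta> c1 c where c: "c1 > 0" "c > 0" and main: "\<And>n. n \<ge> 1 \<Longrightarrow>
    \<exists>j. \<exists>\<eta>\<in>Z j. 2 powr (2 * ?\<alpha> * real j) \<le> real n \<and>
      c1 / (2 ^ j) ^ d \<le> measure sphere_measure (peak \<delta> j \<eta>) \<and>
      unavoidable_loss (besov_densities s r q M) p n \<delta> j {\<eta>} (c * 2 powr (- (real j * ((s - real d * recip r) * p))))"
    using minimax_sparse_local[OF d r q M p s] by auto
  have \<alpha>: "?\<alpha> > 0" using s d by (simp add: algebra_simps add_pos_pos)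
  have \<beta>: "?\<beta> = (s - real d * recip r) * p + real d" using p by (simp add: field_simps)
  have "ennreal ((c * c1) * real n powr (- (?\<beta> / (2 * ?\<alpha>))))
    \<le> (SUP f \<in> besov_densities s r q M.
         sample_expectation n f (\<lambda>X. enn_powr (sphere_norm (ennreal p) (\<lambda>x. fhat X x - f x)) p))"
    if n: "n \<ge> 1" and est: "estimator n fhat" for n fhat
  proof -
    obtain j \<eta> f where j: "2 powr (2 * ?\<alpha> * real j) \<le> real n"
      and D: "c1 / (2 ^ j) ^ d \<le> measure sphere_measure (peak \<delta> j \<eta>)"
      and f: "f \<in> besov_densities s r q M"
      and le: "ennreal (c * 2 powr (- (real j * ((s - real d * recip r) * p))) * measure sphere_measure (peak \<delta> j \<eta>))
           \<le> sample_expectation n f (local_loss p (peak \<delta> j \<eta>) fhat f)"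
      using main[OF n] est by (auto simp: unavoidable_loss_def)
    have "real n powr (- (?\<beta> / (2 * ?\<alpha>))) \<le> 2 powr (- (real j * ?\<beta>))"
      using s p by (intro rate_le_level[OF j \<alpha>]) (simp add: \<beta>)
    also have "\<dots> = 2 powr (- (real j * ((s - real d * recip r) * p))) * 2 powr (- (real j * real d))"
      unfolding \<beta> by (simp add: powr_add[symmetric] algebra_simps)
    also have "2 powr (- (real j * real d)) = 1 / (2 ^ j) ^ d"
      by (simp add: powr_minus powr_powr[symmetric] powr_realpow inverse_eq_divide)
    finally have "(c * c1) * real n powr (- (?\<beta> / (2 * ?\<alpha>)))
        \<le> (c * c1) * (2 powr (- (real j * ((s - real d * recip r) * p))) * (1 / (2 ^ j) ^ d))"
      using c by (intro mult_left_mono) auto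
    also have "\<dots> = c * 2 powr (- (real j * ((s - real d * recip r) * p))) * (c1 / (2 ^ j) ^ d)" by simp
    also have "\<dots> \<le> c * 2 powr (- (real j * ((s - real d * recip r) * p))) * measure sphere_measure (peak \<delta> j \<eta>)"
      using D c by (intro mult_left_mono) auto
    finally have "ennreal ((c * c1) * real n powr (- (?\<beta> / (2 * ?\<alpha>))))
       \<le> ennreal (c * 2 powr (- (real j * ((s - real d * recip r) * p))) * measure sphere_measure (peak \<delta> j \<eta>))"
      by (rule ennreal_leI)
    also note le
    also have "sample_expectation n f (local_loss p (peak \<delta> j \<eta>) fhat f)
      \<le> sample_expectation n f (\<lambda>X. enn_powr (sphere_norm (ennreal p) (\<lambda>x. fhat X x - f x)) p)"
    proof (rule sample_expectation_mono)
      fix X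
      have "local_loss p (peak \<delta> j \<eta>) fhat f X \<le> local_loss p (sphere 0 1) fhat f X"
        unfolding local_loss_def by (intro nn_integral_mono) (auto simp: indicator_def)
      then show "local_loss p (peak \<delta> j \<eta>) fhat f X \<le> enn_powr (sphere_norm (ennreal p) (\<lambda>x. fhat X x - f x)) p"
        unfolding local_loss_sphere[OF p] .
    qed
    finally show ?thesis by (rule SUP_upper2[OF f])
  qed
  then show ?thesis using c by (intro exI[of _ "c * c1"]) auto
qed

text \<open>
  The supremum norm dominates the average of the absolute error over the peak set, so the measure of
  the peak set drops out.
\<close>
lemma minimax_sparse_infinity:
  assumes d: "d \<ge> 1" and r: "r > 0" and q: "q > 0" and M: "M > 0"
    and s: "s > real d * recip r"
  shows "\<exists>c>0. \<forall>n\<ge>1. \<forall>fhat. estimator n fhat \<longrightarrow>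
      (SUP f \<in> besov_densities s r q M.
         sample_expectation n f (\<lambda>X. sphere_norm \<infinity> (\<lambda>x. fhat X x - f x)))
      \<ge> ennreal (c * real n powr (- ((s - real d * recip r) / (2 * (s + real d * (1/2 - recip r))))))"
proof -
  let ?\<alpha> = "s + real d * (1/2 - recip r)" and ?\<beta> = "s - real d * recip r"
  obtain \<delta> c1 c where c: "c1 > 0" "c > 0" and main: "\<And>n. n \<ge> 1 \<Longrightarrow>
    \<exists>j. \<exists>\<eta>\<in>Z j. 2 powr (2 * ?\<alpha> * real j) \<le> real n \<and>
      c1 / (2 ^ j) ^ d \<le> measure sphere_measure (peak \<delta> j \<eta>) \<and>
      unavoidable_loss (besov_densities s r q M) 1 n \<delta> j {\<eta>} (c * 2 powr (- (real j * (?\<beta> * 1))))"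
    using minimax_sparse_local[OF d r q M zero_less_one s] by auto
  have \<alpha>: "?\<alpha> > 0" using s d by (simp add: algebra_simps add_pos_pos)
  have "ennreal (c * real n powr (- (?\<beta> / (2 * ?\<alpha>))))
    \<le> (SUP f \<in> besov_densities s r q M.
         sample_expectation n f (\<lambda>X. sphere_norm \<infinity> (\<lambda>x. fhat X x - f x)))"
    if n: "n \<ge> 1" and est: "estimator n fhat" for n fhat
  proof -
    obtain j \<eta> f where j: "2 powr (2 * ?\<alpha> * real j) \<le> real n"
      and D: "c1 / (2 ^ j) ^ d \<le> measure sphere_measure (peak \<delta> j \<eta>)"
      and f: "f \<in> besov_densities s r q M"
      and le: "ennreal (c * 2 powr (- (real j * (?\<beta> * 1))) * measure sphere_measure (peak \<delta> j \<eta>))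
           \<le> sample_expectation n f (local_loss 1 (peak \<delta> j \<eta>) fhat f)"
      using main[OF n] est by (auto simp: unavoidable_loss_def)
    let ?D = "measure sphere_measure (peak \<delta> j \<eta>)"
    have "0 < c1 / (2 ^ j) ^ d" using c by simp
    with D have D0: "?D > 0" by linarith
    have "real n powr (- (?\<beta> / (2 * ?\<alpha>))) \<le> 2 powr (- (real j * ?\<beta>))"
      using s by (intro rate_le_level[OF j \<alpha>]) simp
    then have "ennreal (c * real n powr (- (?\<beta> / (2 * ?\<alpha>)))) \<le> ennreal (1 / ?D * (c * 2 powr (- (real j * (?\<beta> * 1))) * ?D))"
      using c D0 by (intro ennreal_leI) simp
    also have "\<dots> \<le> ennreal (1 / ?D) * sample_expectation n f (local_loss 1 (peak \<delta> j \<eta>) fhat f)"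
      using le D0 by (subst ennreal_mult') (auto intro: mult_left_mono)
    also have "\<dots> = sample_expectation n f (\<lambda>X. ennreal (1 / ?D) * local_loss 1 (peak \<delta> j \<eta>) fhat f X)"
      using f by (intro sample_expectation_cmult[symmetric] local_loss_measurable[OF est] peak_measurable)
        (auto simp: sphere_densities_def)
    also have "\<dots> \<le> sample_expectation n f (\<lambda>X. sphere_norm \<infinity> (\<lambda>x. fhat X x - f x))"
    proof (rule sample_expectation_mono)
      fix X
      have "ennreal (1 / ?D) * local_loss 1 (peak \<delta> j \<eta>) fhat f X
        \<le> ennreal (1 / ?D) * (ennreal ?D * sphere_norm \<infinity> (\<lambda>x. fhat X x - f x))"
        by (intro mult_left_mono local_loss_le_sphere_norm_infinity peak_measurable) simp
      then show "ennreal (1 / ?D) * local_loss 1 (peak \<delta> j \<eta>) fhat f X \<le> sphere_norm \<infinity> (\<lambda>x. fhat X x - f x)"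
        using D0 by (simp add: mult.assoc[symmetric] ennreal_mult[symmetric])
    qed
    finally have "ennreal (c * real n powr (- (?\<beta> / (2 * ?\<alpha>))))
        \<le> sample_expectation n f (\<lambda>X. sphere_norm \<infinity> (\<lambda>x. fhat X x - f x))" .
    then show ?thesis by (rule SUP_upper2[OF f])
  qed
  then show ?thesis using c by blast
qed

end

theorem theorem11:
  fixes d :: nat
    and s M :: real
    and r q :: ennreal
    and \<phi> :: "real \<Rightarrow> real"
    and L :: "nat \<Rightarrow> real poly"
    and Z :: "nat \<Rightarrow> 'a::euclidean_space set"
    and w :: "nat \<Rightarrow> 'a \<Rightarrow> real"
  assumes "d \<ge> 1" and "DIM('a) = d + 1"
    and "s > 0" and "r > 0" and "q > 0" and "M > 0"
    and "\<And>l. harmonic_projection_kernel TYPE('a) l (L l)"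
    and "needlet_cutoff \<phi>"
    and "needlet_cubature d Z w"
    and "needlets_localized d Z (needlet \<phi> L w)"
    and "needlets_norm_bounds d Z (needlet \<phi> L w)"
  shows
    "(\<forall>p::real. 1 \<le> p \<and> p \<le> 2 \<longrightarrow>
       (\<exists>c>0. \<forall>n\<ge>1. \<forall>fhat. estimator n fhat \<longrightarrow>
          (SUP f \<in> sphere_densities \<inter> besov_ball d Z (needlet \<phi> L w) s r q M.
             sample_expectation n f
               (\<lambda>X. enn_powr (sphere_norm (ennreal p) (\<lambda>x. fhat X x - f x)) p))
          \<ge> ennreal (c * real n powr (- (s * p / (2 * s + real d))))))
     \<and>
     (\<forall>p::real. 2 < p \<and> s > p * (real d / 2) * max (recip r - 1 / p) 0 \<longrightarrow>
       (\<exists>c>0. \<forall>n\<ge>1. \<forall>fhat. estimator n fhat \<longrightarrow>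
          (SUP f \<in> sphere_densities \<inter> besov_ball d Z (needlet \<phi> L w) s r q M.
             sample_expectation n f
               (\<lambda>X. enn_powr (sphere_norm (ennreal p) (\<lambda>x. fhat X x - f x)) p))
          \<ge> ennreal (c * real n powr (- (s * p / (2 * s + real d))))))
     \<and>
     (\<forall>p::real. 2 < p \<and> real d * recip r < s \<and> s \<le> p * (real d / 2) * (recip r - 1 / p) \<longrightarrow>
       (\<exists>c>0. \<forall>n\<ge>1. \<forall>fhat. estimator n fhat \<longrightarrow>
          (SUP f \<in> sphere_densities \<inter> besov_ball d Z (needlet \<phi> L w) s r q M.
             sample_expectation n f
               (\<lambda>X. enn_powr (sphere_norm (ennreal p) (\<lambda>x. fhat X x - f x)) p))
          \<ge> ennreal (c * real n powr
               (- (p * (s + real d * (1 / p - recip r)) /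
                   (2 * (s + real d * (1/2 - recip r))))))))
     \<and>
     (s > real d * recip r \<longrightarrow>
       (\<exists>c>0. \<forall>n\<ge>1. \<forall>fhat. estimator n fhat \<longrightarrow>
          (SUP f \<in> sphere_densities \<inter> besov_ball d Z (needlet \<phi> L w) s r q M.
             sample_expectation n f (\<lambda>X. sphere_norm \<infinity> (\<lambda>x. fhat X x - f x)))
          \<ge> ennreal (c * real n powr
               (- ((s - real d * recip r) / (2 * (s + real d * (1/2 - recip r))))))))"
proof -
  interpret needlet_frame d \<phi> L Z w
    using assms by unfold_locales
  show ?thesis
    using assms by (intro conjI allI impI minimax_dense minimax_sparse minimax_sparse_infinity) auto
qed

end
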